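(* Suppose $W\in\mathcal R(\mathbb T)$, $g_2\in L^\infty(\mathbb T)$, and $g_1,|g_2|^2\in\mathcal{ACF}(\mathbb T)$. Then $$\|\widehat g_1W\widehat g_2\|_\mu^2=\frac1{(2\pi)^2}\int_{\mathbb T^2}|g_1(x)|^2\,\nu(x,a)\,|g_2(a)|^2\,da\,dx .$$
   Context: $\mathbb T=\mathbb R/2\pi\mathbb Z$ with measure $d\mu=dx/2\pi$. A bounded operator $W$ on $L^2(\mathbb T,\mu)$ has matrix $(W_{j,k})_{j,k\in\mathbb Z}$: $W\sum_kf_ke^{ikx}=\sum_{j,k}W_{j,k}f_ke^{ijx}$. $W\in\mathcal{DT}(\mathbb T)$ (diagonal type) means $c_k=\sup_j|W_{j+k,j}|<\infty$ for all $k\in\mathbb Z$ and $\|W\|_{\mathcal{DT}}:=\sum_{k\in\mathbb Z}c_k<\infty$. $W$ is regular ($W\in\mathcal R(\mathbb T)$) if $W\in\mathcal{DT}(\mathbb T)$ and for all $m,n\in\mathbb Z$ the limit $\omega_{m,n}=\lim_{\#I\to\infty}\frac1{\#I}\sum_{j\in\mathbb Z,\,l\in I}W_{l+m,j}\overline{W_{l,j+n}}$ exists, where $I\subset\mathbb Z$ ranges over finite intervals of consecutive integers (limit over all such intervals, irrespective of position, as $\#I\to\infty$). $\nu(x,a)=\sum_{m,n}\omega_{m,n}e^{imx+ina}$ is a formal Fourier series; $\nu(x,a)\frac{dx\,da}{4\pi^2}$ denotes the non-negative finite Borel measure on $\mathbb T^2$ with Fourier coefficients $\int e^{-imx-ina}\,\nu\frac{dx\,da}{4\pi^2}=\omega_{m,n}$,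 and integrals against $\nu$ are integrals against this measure (both of its marginals are absolutely continuous with bounded density). $\mathcal{ACF}(\mathbb T)$ is the space of functions on $\mathbb T$ with absolutely converging Fourier series; $\widehat g$ is multiplication by $g$. $\mu$-norm: $\|W\|_\mu^2=\inf_\chi\sum_{j=1}^K\mu(Y_j)\|W\pi_{Y_j}\|^2$, where the infimum is over finite measurable partitions $\chi=\{Y_1,\dots,Y_K\}$ of $\mathbb T$ (modulo null sets), $\pi_Y$ is multiplication by the indicator $\mathbf 1_Y$, and $\|\cdot\|$ is the $L^2$ operator norm. *)

theory Defs
  imports "HOL-Analysis.Analysis"
begin

text \<open>
  The circle \<open>\<real>/2\<pi>\<int>\<close> is modelled by its fundamental domain \<open>[0, 2\<pi>)\<close> with the normalised measure
  \<open>dx/2\<pi>\<close>; a function on the circle is a function on the reals of which only the values on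
  \<open>[0, 2\<pi>)\<close> matter.
\<close>

definition circle :: "real measure" where
  "circle = density (restrict_space lborel {0..<2*pi}) (\<lambda>_. ennreal (1 / (2*pi)))"

definition character :: "int \<Rightarrow> real \<Rightarrow> complex" where
  "character k x = cis (of_int k * x)"

definition fourier_coeff :: "(real \<Rightarrow> complex) \<Rightarrow> int \<Rightarrow> complex" where
  "fourier_coeff f k = (\<integral>x. f x * cnj (character k x) \<partial>circle)"

text \<open>
  Elements of \<open>L\<^sup>2\<close> and \<open>L\<^sup>\<infinity>\<close> are given by representatives. An operator on \<open>L\<^sup>2\<close> acts on
  representatives; linearity up to null sets and boundedness force it to respect equality
  almost everywhere.
\<close>

definition L2 :: "(real \<Rightarrow> complex) set" where
  "L2 = {f \<in> borel_measurable circle. integrable circle (\<lambda>x. (cmod (f x))\<^sup>2)}"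

definition L2_norm :: "(real \<Rightarrow> complex) \<Rightarrow> real" where
  "L2_norm f = sqrt (\<integral>x. (cmod (f x))\<^sup>2 \<partial>circle)"

definition Linfty :: "(real \<Rightarrow> complex) set" where
  "Linfty = {g \<in> borel_measurable circle. \<exists>B. AE x in circle. cmod (g x) \<le> B}"

type_synonym operator = "(real \<Rightarrow> complex) \<Rightarrow> (real \<Rightarrow> complex)"

definition bounded_operator :: "operator \<Rightarrow> bool" where
  "bounded_operator W \<longleftrightarrow>
     (\<forall>f\<in>L2. W f \<in> L2) \<and>
     (\<forall>f\<in>L2. \<forall>g\<in>L2. AE x in circle. W (\<lambda>y. f y + g y) x = W f x + W g x) \<and>
     (\<forall>c. \<forall>f\<in>L2. AE x in circle. W (\<lambda>y. c * f y) x = c * W f x) \<and>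
     (\<exists>B. \<forall>f\<in>L2. L2_norm (W f) \<le> B * L2_norm f)"

definition operator_norm :: "operator \<Rightarrow> real" where
  "operator_norm A = (SUP f\<in>{f \<in> L2. L2_norm f \<le> 1}. L2_norm (A f))"

definition mult_op :: "(real \<Rightarrow> complex) \<Rightarrow> operator" where
  "mult_op g f = (\<lambda>x. g x * f x)"

text \<open>\<open>W\<^bsub>j,k\<^esub>\<close>: the \<open>j\<close>-th Fourier coefficient of the image of the \<open>k\<close>-th character.\<close>

definition matrix_entry :: "operator \<Rightarrow> int \<Rightarrow> int \<Rightarrow> complex" where
  "matrix_entry W j k = fourier_coeff (W (character k)) j"

definition diagonal_type :: "operator \<Rightarrow> bool" where
  "diagonal_type W \<longleftrightarrow> bounded_operator W \<and>
     (\<forall>k. bdd_above (range (\<lambda>j. cmod (matrix_entry W (j + k) j)))) \<and>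
     (\<lambda>k. SUP j. cmod (matrix_entry W (j + k) j)) summable_on UNIV"

text \<open>The filter of finite integer intervals \<open>I\<close>, at arbitrary position, with \<open>#I \<rightarrow> \<infinity>\<close>.\<close>

definition long_intervals :: "int set filter" where
  "long_intervals = inf (filtercomap card at_top) (principal {I. \<exists>a b. I = {a..b}})"

definition correlation_mean :: "operator \<Rightarrow> int \<Rightarrow> int \<Rightarrow> int set \<Rightarrow> complex" where
  "correlation_mean W m n I =
     1 / of_nat (card I) *
     (\<Sum>l\<in>I. \<Sum>\<^sub>\<infinity>j\<in>UNIV. matrix_entry W (l + m) j * cnj (matrix_entry W l (j + n)))"

definition regular :: "operator \<Rightarrow> bool" where
  "regular W \<longleftrightarrow> diagonal_type W \<and>
     (\<forall>m n. \<exists>w. (correlation_mean W m n \<longlongrightarrow> w) long_intervals)"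

definition omega :: "operator \<Rightarrow> int \<Rightarrow> int \<Rightarrow> complex" where
  "omega W m n = Lim long_intervals (correlation_mean W m n)"

text \<open>
  \<open>nu W\<close> is the measure \<open>\<nu>(x,a) dx da / 4\<pi>\<^sup>2\<close>, normalising factor included. A finite measure on the
  torus is determined by its Fourier coefficients, so the choice is immaterial.
\<close>

definition nu :: "operator \<Rightarrow> (real \<times> real) measure" where
  "nu W = (SOME N. finite_measure N \<and>
      space N = space (circle \<Otimes>\<^sub>M circle) \<and> sets N = sets (circle \<Otimes>\<^sub>M circle) \<and>
      (\<forall>m n. (\<integral>z. cnj (character m (fst z)) * cnj (character n (snd z)) \<partial>N) = omega W m n))"

definition ACF :: "(real \<Rightarrow> complex) set" where
  "ACF = {g. integrable circle g \<and> (\<lambda>k. cmod (fourier_coeff g k)) summable_on UNIV}"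

definition partition_mod_null :: "nat \<Rightarrow> (nat \<Rightarrow> real set) \<Rightarrow> bool" where
  "partition_mod_null K Y \<longleftrightarrow>
     (\<forall>i<K. Y i \<in> sets circle) \<and>
     (\<forall>i<K. \<forall>j<K. i \<noteq> j \<longrightarrow> Y i \<inter> Y j \<in> null_sets circle) \<and>
     (AE x in circle. x \<in> (\<Union>i<K. Y i))"

definition mu_norm :: "operator \<Rightarrow> real" where
  "mu_norm W = sqrt (Inf {\<Sum>i<K. measure circle (Y i) * (operator_norm (W \<circ> mult_op (indicator (Y i))))\<^sup>2
                          | K Y. partition_mod_null K Y})"

end

theory Submission
  imports Defs "HOL-Probability.Probability"
begin

text \<open>
  Write \<open>e\<^sub>k\<close> for the characters and \<open>A\<close> for the operator \<open>h \<mapsto> g1 \<cdot> W h\<close>. The statement rests on one local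
  principle: if \<open>h\<close> lives on a short arc around \<open>a\<close>, then \<open>\<parallel>A h\<parallel>\<^sup>2\<close> is nearly \<open>\<rho>(a) \<parallel>h\<parallel>\<^sup>2\<close>, where
  \<open>\<rho>(a) = \<integral> |g1(x)|\<^sup>2 \<nu>(x,a) dx/2\<pi>\<close>.

  The principle holds because on a short arc \<open>e\<^sub>s\<close> is nearly the constant \<open>e\<^sub>s(a)\<close> as long as \<open>s\<close> is not
  too large. Hence \<open>\<parallel>A h\<parallel>\<^sup>2\<close> is nearly the mean of \<open>\<parallel>A (e\<^sub>s h)\<parallel>\<^sup>2\<close> over \<open>s < L\<close>. Multiplication by \<open>e\<^sub>s\<close>
  shifts Fourier coefficients by \<open>s\<close>, so this mean is a quadratic form in the coefficients of \<open>h\<close>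
  whose matrix consists of means of correlation sums of \<open>W\<close> over windows of length \<open>L\<close>. Regularity
  says that such means converge uniformly in the position of the window, and their limits are the
  Fourier coefficients of \<open>\<rho>\<close>. As the entries are also dominated by a summable function of the
  diagonal, Schur's test turns the convergence of entries into convergence of quadratic forms
  (\<open>modulated_energy\<close>), and \<open>local_energy\<close> follows. Two points need care: regularity averages over
  rows of \<open>W\<close> whereas the quadratic form averages over columns (\<open>window_mean_row_col_diff\<close>), and the
  errors of infinitely many diagonals have to be summed (\<open>weighted_col_means\<close>).

  Given the principle, cutting the circle into short arcs bounds the partition norm of \<open>A \<circ> g2\<close> from
  above by \<open>\<integral> \<rho> |g2|\<^sup>2\<close>. For the lower bound, the pieces of an arbitrary partition are cut further
  along arcs and \<open>A \<circ> g2\<close> is tested on the indicators of the pieces (\<open>mu_norm_eq_energy\<close>).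

  It remains to see that \<open>\<integral> \<rho> |g2|\<^sup>2\<close> is the integral against \<open>\<nu>\<close>. Since \<open>nu\<close> is chosen by its Fourier
  coefficients, a measure with these coefficients must be exhibited. It arises as a weak limit of the
  densities \<open>|\<Sum>\<^sub>l\<^sub><\<^sub>L \<Sum>\<^sub>j W\<^sub>l\<^sub>j e\<^sub>l(x) e\<^sub>-\<^sub>j(a)|\<^sup>2 / L\<close>, whose coefficients tend to \<open>\<omega>\<close>
  (\<open>periodogram_coeff_tendsto\<close>). Compactness of measures on the torus is reduced to Helly's theorem on
  the line by a space-filling curve (\<open>torus_measure_limit\<close>). Finally \<open>g1\<close> and \<open>|g2|\<^sup>2\<close> agree with
  their Fourier series only almost everywhere, so the marginals of \<open>\<nu>\<close> have to be absolutely
  continuous; this holds because \<open>\<omega>\<^sub>m\<^sub>0\<close> and \<open>\<omega>\<^sub>0\<^sub>n\<close> are absolutely summable (\<open>omega_marginals_summable\<close>,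
  \<open>AE_of_summable_fourier_coeff\<close>).
\<close>

section \<open>The circle and its characters\<close>

lemma space_circle [simp]: "space circle = {0..<2*pi}"
  by (simp add: circle_def space_restrict_space)

lemma sets_circle: "sets circle = sets (restrict_space borel {0..<2*pi})"
  by (simp add: circle_def cong: sets_restrict_space_cong)

lemma sets_circle_iff: "A \<in> sets circle \<longleftrightarrow> A \<in> sets borel \<and> A \<subseteq> {0..<2*pi}"
  by (auto simp: sets_circle sets_restrict_space_iff)

lemma borel_measurable_circle:
  "f \<in> borel_measurable borel \<Longrightarrow> f \<in> borel_measurable circle"
  unfolding measurable_cong_sets[OF sets_circle refl] by (rule measurable_restrict_space1)

lemma measurable_to_circle:
  assumes "f \<in> borel_measurable M" "\<And>x. x \<in> space M \<Longrightarrow> f x \<in> {0..<2*pi}"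
  shows "f \<in> measurable M circle"
  unfolding measurable_cong_sets[OF refl sets_circle]
  by (intro measurable_restrict_space2) (use assms in auto)

lemma emeasure_circle:
  assumes "A \<in> sets circle"
  shows "emeasure circle A = ennreal (1 / (2*pi)) * emeasure lborel A"
  using assms unfolding circle_def
  by (subst emeasure_density_const)
     (auto simp: sets_restrict_space_iff emeasure_restrict_space)

interpretation circle: prob_space circle
proof
  have "ennreal (1 / (2*pi)) * ennreal (2*pi) = 1"
    by (simp add: ennreal_mult[symmetric])
  then show "emeasure circle (space circle) = 1"
    by (subst emeasure_circle) (auto simp: sets_circle_iff)
qed

lemma measure_circle_atLeastLessThan:
  assumes "0 \<le> a" "a \<le> b" "b \<le> 2*pi"
  shows "measure circle {a..<b} = (b - a) / (2*pi)"
  using assms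
  by (simp add: measure_def emeasure_circle sets_circle_iff ennreal_mult[symmetric])

lemma integral_circle:
  fixes f :: "real \<Rightarrow> complex"
  assumes "f \<in> borel_measurable borel"
  shows "(\<integral>x. f x \<partial>circle) = (1 / (2*pi)) *\<^sub>R (\<integral>x. indicator {0..<2*pi} x *\<^sub>R f x \<partial>lborel)"
proof -
  have "f \<in> borel_measurable (restrict_space lborel {0..<2*pi})"
    using assms by (intro measurable_restrict_space1) simp
  then show ?thesis
    unfolding circle_def
    by (subst integral_density) (auto simp: integral_restrict_space)
qed

lemma norm_character [simp]: "cmod (character k x) = 1"
  by (simp add: character_def)

lemma character_measurable [measurable]: "character k \<in> borel_measurable borel"
  unfolding character_def [abs_def] by (intro borel_measurable_continuous_onI continuous_intros)

lemma continuous_on_character [continuous_intros]: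
  "continuous_on A f \<Longrightarrow> continuous_on A (\<lambda>x. character k (f x))"
  unfolding character_def by (intro continuous_intros)

lemma character_0 [simp]: "character 0 = (\<lambda>_. 1)"
  by (auto simp: character_def)

lemma character_add: "character (j + k) x = character j x * character k x"
  by (simp add: character_def cis_mult algebra_simps)

lemma cnj_character: "cnj (character k x) = character (- k) x"
  by (simp add: character_def cis_cnj)

lemma character_periodic: "character k (x + 2 * pi * of_int n) = character k x"
proof -
  have "cis (2 * pi * of_int (k * n)) = 1"
    by (rule cis_multiple_2pi) simp
  moreover have "of_int k * (x + 2 * pi * of_int n) = of_int k * x + 2 * pi * of_int (k * n)"
    by (simp add: algebra_simps)
  ultimately show ?thesis
    by (simp add: character_def cis_mult[symmetric])
qed

lemma integral_character: "(\<integral>x. character k x \<partial>circle) = (if k = 0 then 1 else 0)"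
proof (cases "k = 0")
  case True
  then show ?thesis using circle.prob_space by simp
next
  case False
  define F where "F x = cis (of_int k * x) / (\<i> * of_int k)" for x :: real
  have der: "(F has_vector_derivative character k x) (at x within S)" for x S
  proof -
    have "((\<lambda>z. exp (\<i> * (of_int k * z)) / (\<i> * of_int k)) has_field_derivative
        exp (\<i> * (of_int k * complex_of_real x))) (at (of_real x))"
      using False by (auto intro!: derivative_eq_intros simp: algebra_simps)
    from has_vector_derivative_real_field[OF this, of S] show ?thesis
      by (simp add: F_def [abs_def] character_def cis_conv_exp)
  qed
  have "(\<integral>x. indicator {0..2*pi} x *\<^sub>R character k x \<partial>lborel) = F (2*pi) - F 0"
    by (rule integral_FTC_Icc) (auto intro: der continuous_intros)
  also have "\<dots> = 0"
    using character_periodic[of k 0 1] by (simp add: F_def character_def)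
  also have "(\<integral>x. indicator {0..2*pi} x *\<^sub>R character k x \<partial>lborel) =
      (\<integral>x. indicator {0..<2*pi} x *\<^sub>R character k x \<partial>lborel)"
  proof (rule integral_cong_AE)
    show "AE x in lborel. indicator {0..2*pi} x *\<^sub>R character k x = indicator {0..<2*pi} x *\<^sub>R
        character k x"
      using AE_lborel_singleton[of "2*pi"] by eventually_elim (auto simp: indicator_def)
  qed measurable
  finally show ?thesis
    using False by (subst integral_circle) auto
qed

section \<open>From characters to bounded measurable functions\<close>

definition bounded_measurable :: "(real \<Rightarrow> complex) \<Rightarrow> bool" where
  "bounded_measurable f \<longleftrightarrow>
     f \<in> borel_measurable circle \<and> (\<exists>C. \<forall>x\<in>{0..<2*pi}. cmod (f x) \<le> C)"

inductive trig_poly :: "(real \<Rightarrow> complex) \<Rightarrow> bool" where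
  character: "trig_poly (character k)"
| scale: "trig_poly f \<Longrightarrow> trig_poly (\<lambda>x. c * f x)"
| add: "trig_poly f \<Longrightarrow> trig_poly g \<Longrightarrow> trig_poly (\<lambda>x. f x + g x)"

lemma trig_poly_mult:
  assumes "trig_poly f" "trig_poly g" shows "trig_poly (\<lambda>x. f x * g x)"
  using assms(1)
proof induction
  case (character k)
  from assms(2) show ?case
  proof induction
    case (character j)
    then show ?case using trig_poly.character[of "k + j"] by (simp add: character_add[abs_def])
  next
    case (scale f c)
    then show ?case using trig_poly.scale[of _ c] by (simp add: mult.left_commute)
  next
    case (add f g)
    then show ?case using trig_poly.add by (simp add: distrib_left)
  qed
next
  case (scale f c)
  then show ?case using trig_poly.scale[of _ c] by (simp add: mult.assoc)
next
  case (add f g)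
  then show ?case using trig_poly.add by (simp add: distrib_right)
qed

lemma trig_poly_const: "trig_poly (\<lambda>_. c)"
  using trig_poly.scale[OF trig_poly.character[of 0], of c] by simp

text \<open>
  Through \<open>x \<mapsto> cis x\<close> the circle is a compact subset of the plane, on which the
  Stone-Weierstrass theorem speaks about real polynomials in two variables. This lemma translates
  these into trigonometric polynomials.
\<close>

lemma trig_poly_cis_polynomial:
  fixes q :: "complex \<Rightarrow> real"
  assumes "real_polynomial_function q"
  shows "trig_poly (\<lambda>x. of_real (q (cis x)))"
  using assms
proof induction
  case (linear f)
  have "f (cis x) = cos x * f 1 + sin x * f \<i>" for x
  proof -
    interpret bounded_linear f by fact
    have "cis x = cos x *\<^sub>R 1 + sin x *\<^sub>R \<i>"
      by (simp add: complex_eq_iff)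
    then show ?thesis by (simp only: add scaleR) simp
  qed
  moreover have "complex_of_real (cos x) = 1/2 * (character 1 x + character (-1) x)"
    "complex_of_real (sin x) = (-\<i>/2) * (character 1 x + (-1) * character (-1) x)" for x
    by (simp_all add: character_def complex_eq_iff)
  ultimately have "(\<lambda>x. complex_of_real (f (cis x))) =
     (\<lambda>x. of_real (f 1) * (1/2 * (character 1 x + character (-1) x)) +
          of_real (f \<i>) * ((-\<i>/2) * (character 1 x + (-1) * character (-1) x)))"
    by (auto simp: mult.commute)
  then show ?case
    by (simp only:) (intro trig_poly.intros)
next
  case (const c)
  then show ?case by (rule trig_poly_const)
next
  case (add f g)
  then show ?case using trig_poly.add by simp
next
  case (mult f g)
  then show ?case using trig_poly_mult by simp
qed

lemma trig_poly_measurable: "trig_poly f \<Longrightarrow> f \<in> borel_measurable borel"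
  by (induction rule: trig_poly.induct) (simp_all add: character_measurable)

lemma trig_poly_bounded: "trig_poly f \<Longrightarrow> \<exists>C. \<forall>x. cmod (f x) \<le> C"
proof (induction rule: trig_poly.induct)
  case (character k)
  then show ?case by (intro exI[of _ 1]) simp
next
  case (scale f c)
  then obtain C where "\<forall>x. cmod (f x) \<le> C" by auto
  then have "\<forall>x. cmod (c * f x) \<le> cmod c * C" by (auto simp: norm_mult intro: mult_left_mono)
  then show ?case by blast
next
  case (add f g)
  then obtain C D where "\<forall>x. cmod (f x) \<le> C" "\<forall>x. cmod (g x) \<le> D" by auto
  then have "\<forall>x. cmod (f x + g x) \<le> C + D" by (meson norm_triangle_mono)
  then show ?case by blast
qed

lemma bounded_measurableI:
  assumes "f \<in> borel_measurable borel" "\<And>x. cmod (f x) \<le> C"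
  shows "bounded_measurable f"
  using assms borel_measurable_circle unfolding bounded_measurable_def by blast

lemma bounded_measurable_trig_poly: "trig_poly f \<Longrightarrow> bounded_measurable f"
  using trig_poly_measurable trig_poly_bounded bounded_measurableI by blast

lemma bounded_measurable_indicator:
  "A \<in> sets circle \<Longrightarrow> bounded_measurable (indicator A)"
  unfolding bounded_measurable_def by (auto intro!: exI[of _ 1] simp: indicator_def)

lemma bounded_measurable_mult:
  assumes "bounded_measurable f" "bounded_measurable g"
  shows "bounded_measurable (\<lambda>x. f x * g x)"
proof -
  obtain C D where "\<forall>x\<in>{0..<2*pi}. cmod (f x) \<le> C" "\<forall>x\<in>{0..<2*pi}. cmod (g x) \<le> D"
    using assms unfolding bounded_measurable_def by auto
  then have "\<forall>x\<in>{0..<2*pi}. cmod (f x * g x) \<le> C * D"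
    by (auto simp: norm_mult intro!: mult_mono intro: order_trans[OF norm_ge_zero])
  then show ?thesis using assms unfolding bounded_measurable_def by auto
qed

lemma bounded_measurable_add:
  assumes "bounded_measurable f" "bounded_measurable g"
  shows "bounded_measurable (\<lambda>x. f x + g x)"
proof -
  obtain C D where "\<forall>x\<in>{0..<2*pi}. cmod (f x) \<le> C" "\<forall>x\<in>{0..<2*pi}. cmod (g x) \<le> D"
    using assms unfolding bounded_measurable_def by auto
  then have "\<forall>x\<in>{0..<2*pi}. cmod (f x + g x) \<le> C + D"
    by (meson norm_triangle_mono)
  then show ?thesis using assms unfolding bounded_measurable_def by auto
qed

lemma bounded_measurable_const: "bounded_measurable (\<lambda>_. c)"
  by (rule bounded_measurableI[of _ "cmod c"]) auto

lemma inj_on_cis: "inj_on cis {0..<2*pi}"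
proof (rule inj_onI)
  fix x y assume "x \<in> {0..<2*pi}" "y \<in> {0..<2*pi}" "cis x = cis y"
  then show "x = y"
    using Arg2pi_unique[of 1 x "cis x"] Arg2pi_unique[of 1 y "cis y"] by (auto simp: cis_conv_exp)
qed

lemma circle_domain_eq_UN: "{0..<2*pi} = (\<Union>n. {0..2*pi - 1/Suc n})"
proof (intro equalityI subsetI)
  fix x assume x: "x \<in> {0..<2*pi}"
  then have "0 < 2*pi - x" by simp
  then obtain n where "inverse (real (Suc n)) < 2*pi - x"
    using reals_Archimedean by blast
  then have "x \<in> {0..2*pi - 1/Suc n}" using x by (simp add: inverse_eq_divide)
  then show "x \<in> (\<Union>n. {0..2*pi - 1/Suc n})" by blast
next
  fix x assume "x \<in> (\<Union>n. {0..2*pi - 1/Suc n})"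
  then obtain n where "0 \<le> x" "x \<le> 2*pi - 1/Suc n" by auto
  moreover have "2*pi - 1/real (Suc n) < 2*pi" by simp
  ultimately show "x \<in> {0..<2*pi}"
    by (meson atLeastLessThan_iff order.strict_trans1)
qed

text \<open>
  The half-open interval is not compact, and \<open>cis\<close> wraps its right end around to its left end. A
  closed subset of the interval is therefore a countable union of pieces that stay away from \<open>2\<pi>\<close>;
  each piece is compact and is the preimage of its compact image.
\<close>

lemma sets_circle_generated:
  "sets circle = sigma_sets {0..<2*pi} {{0..<2*pi} \<inter> cis -` F | F. closed F}"
proof (rule antisym)
  let ?G = "{{0..<2*pi} \<inter> cis -` F | F. closed F}"
  interpret S: sigma_algebra "{0..<2*pi}" "sigma_sets {0..<2*pi} ?G"
    by (rule sigma_algebra_sigma_sets) auto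
  have cl: "{0..<2*pi} \<inter> C \<in> sigma_sets {0..<2*pi} ?G" if "closed C" for C
  proof -
    have "{0..2*pi - 1/Suc n} \<inter> C \<in> sigma_sets {0..<2*pi} ?G" for n
    proof (rule sigma_sets.Basic)
      have "compact (cis ` ({0..2*pi - 1/Suc n} \<inter> C))"
        by (intro compact_continuous_image continuous_intros compact_Int_closed that) auto
      moreover have "{0..2*pi - 1/Suc n} \<inter> C = {0..<2*pi} \<inter> cis -` (cis ` ({0..2*pi - 1/Suc n} \<inter> C))"
      proof -
        have "2*pi - 1/Suc n < 2*pi" by simp
        then have "{0..2*pi - 1/Suc n} \<inter> C \<subseteq> {0..<2*pi}"
          by (meson IntD1 atLeastAtMost_iff atLeastLessThan_iff order.strict_trans1 subsetI)
        then show ?thesis using inj_on_image_mem_iff[OF inj_on_cis] by blast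
      qed
      ultimately show "{0..2*pi - 1/Suc n} \<inter> C \<in> ?G"
        using compact_imp_closed by blast
    qed
    then have "(\<Union>n. {0..2*pi - 1/Suc n} \<inter> C) \<in> sigma_sets {0..<2*pi} ?G"
      by (rule sigma_sets.Union)
    moreover have "{0..<2*pi} \<inter> C = (\<Union>n. {0..2*pi - 1/Suc n} \<inter> C)"
      by (subst circle_domain_eq_UN) (simp only: UN_simps)
    ultimately show ?thesis by (simp only:)
  qed
  have "sets (borel :: real measure) = sigma_sets UNIV (Collect closed)"
    unfolding borel_eq_closed by (rule sets_measure_of) simp
  note B = this
  have dom: "{0..<2*pi} \<in> sigma_sets UNIV (Collect closed)"
    unfolding B[symmetric] by (rule atLeastLessThan_borel)
  have "sets circle = (\<inter>) {0..<2*pi} ` sigma_sets UNIV (Collect closed)"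
    unfolding sets_circle sets_restrict_space B by (rule refl)
  also have "\<dots> = sigma_sets {0..<2*pi} ((\<inter>) {0..<2*pi} ` Collect closed)"
    by (rule sigma_sets_Int[OF dom subset_UNIV])
  also have "\<dots> \<subseteq> sigma_sets {0..<2*pi} ?G"
  proof (rule sigma_sets_mono, rule subsetI)
    fix A assume "A \<in> (\<inter>) {0..<2*pi} ` Collect closed"
    then show "A \<in> sigma_sets {0..<2*pi} ?G" using cl by blast
  qed
  finally show "sets circle \<subseteq> sigma_sets {0..<2*pi} ?G" .
  show "sigma_sets {0..<2*pi} ?G \<subseteq> sets circle"
  proof (rule sets.sigma_sets_subset[of _ circle, simplified])
    show "?G \<subseteq> sets circle"
    proof safe
      fix F :: "complex set" assume "closed F"
      then have "closed (cis -` F)"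
        by (rule closed_vimage) (intro continuous_intros)
      then have "cis -` F \<in> sets borel" by (rule borel_closed)
      then show "{0..<2*pi} \<inter> cis -` F \<in> sets circle"
        unfolding sets_circle_iff by (intro conjI Int_lower1 sets.Int atLeastLessThan_borel)
    qed
  qed
qed

lemma bounded_measurable_lim:
  assumes "\<And>n. f n \<in> borel_measurable circle"
    and "\<And>n x. x \<in> {0..<2*pi} \<Longrightarrow> cmod (f n x) \<le> C"
    and "\<And>x. x \<in> {0..<2*pi} \<Longrightarrow> (\<lambda>n. f n x) \<longlonglongrightarrow> g x"
  shows "bounded_measurable g"
proof -
  have "g \<in> borel_measurable circle"
    by (rule borel_measurable_LIMSEQ_metric[of f]) (simp_all add: assms(1,3))
  moreover have "cmod (g x) \<le> C" if "x \<in> {0..<2*pi}" for x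
    using assms(2)[OF that] by (intro LIMSEQ_le_const2[OF tendsto_norm[OF assms(3)[OF that]]]) blast
  ultimately show ?thesis unfolding bounded_measurable_def by blast
qed

text \<open>
  A functional monotone class theorem. It replaces density arguments for the various norms in use: a
  property of characters that survives linear combinations and bounded pointwise limits holds for
  every bounded measurable function. From characters one reaches continuous functions by
  Stone-Weierstrass, indicators of closed sets by cut-offs of the distance, indicators of measurable
  sets by Dynkin's lemma, and the rest by simple functions.
\<close>

theorem bounded_measurable_induct_characters [consumes 1, case_names character scale add lim]:
  assumes phi: "bounded_measurable \<phi>"
    and char: "\<And>k. P (character k)"
    and scale: "\<And>c f. bounded_measurable f \<Longrightarrow> P f \<Longrightarrow> P (\<lambda>x. c * f x)"
    and add: "\<And>f g. bounded_measurable f \<Longrightarrow> P f \<Longrightarrow> bounded_measurable g \<Longrightarrow> P g \<Longrightarrow> P (\<lambda>x. f x + g x)"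
    and lim: "\<And>f g C. (\<And>n. f n \<in> borel_measurable circle) \<Longrightarrow> (\<And>n. P (f n)) \<Longrightarrow>
        (\<And>n x. x \<in> {0..<2*pi} \<Longrightarrow> cmod (f n x) \<le> C) \<Longrightarrow> g \<in> borel_measurable circle \<Longrightarrow>
        (\<And>x. x \<in> {0..<2*pi} \<Longrightarrow> (\<lambda>n. f n x) \<longlonglongrightarrow> g x) \<Longrightarrow> P g"
  shows "P \<phi>"
proof -
  have lim': "P g" if f: "\<And>n. f n \<in> borel_measurable circle" "\<And>n. P (f n)"
      "\<And>n x. x \<in> {0..<2*pi} \<Longrightarrow> cmod (f n x) \<le> C"
      "\<And>x. x \<in> {0..<2*pi} \<Longrightarrow> (\<lambda>n. f n x) \<longlonglongrightarrow> g x" for f g C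
  proof -
    have "g \<in> borel_measurable circle"
      using bounded_measurable_lim[of f C g] f by (simp add: bounded_measurable_def)
    then show ?thesis
      using f by (intro lim[where f = f and C = C and g = g]) simp_all
  qed
  have trig: "P f" if "trig_poly f" for f
    using that
  proof induction
    case (scale f c)
    then show ?case by (intro assms(3) bounded_measurable_trig_poly)
  next
    case (add f g)
    then show ?case by (intro assms(4) bounded_measurable_trig_poly)
  qed (rule char)
  have cont: "P (\<lambda>x. of_real (F (cis x)))" if F: "continuous_on (sphere 0 1) F" for F :: "complex
      \<Rightarrow> real"
  proof -
    have "\<exists>q. real_polynomial_function q \<and> (\<forall>z\<in>sphere 0 1. \<bar>F z - q z\<bar> < 1 / real (Suc n))" for n
      by (rule Stone_Weierstrass_real_polynomial_function[OF compact_sphere F, of "1 / real (Suc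
          n)"]) auto
    then obtain q where q: "\<And>n. real_polynomial_function (q n)"
      "\<And>n z. z \<in> sphere 0 1 \<Longrightarrow> \<bar>F z - q n z\<bar> < 1 / real (Suc n)"
      by metis
    have "bounded (F ` sphere 0 1)"
      by (intro compact_imp_bounded compact_continuous_image F compact_sphere)
    then obtain C where C: "\<And>z. z \<in> sphere 0 1 \<Longrightarrow> \<bar>F z\<bar> \<le> C"
      unfolding bounded_iff by (metis imageI real_norm_def)
    show ?thesis
    proof (rule lim'[where f = "\<lambda>n x. complex_of_real (q n (cis x))" and C = "C + 1"])
      show "P (\<lambda>x. complex_of_real (q n (cis x)))" for n
        by (intro trig trig_poly_cis_polynomial q)
      show "(\<lambda>x. complex_of_real (q n (cis x))) \<in> borel_measurable circle" for n
        by (intro borel_measurable_circle trig_poly_measurable trig_poly_cis_polynomial q)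
      show "cmod (complex_of_real (q n (cis x))) \<le> C + 1" for n x
      proof -
        have "\<bar>F (cis x) - q n (cis x)\<bar> < 1 / real (Suc n)" "\<bar>F (cis x)\<bar> \<le> C"
          using q(2)[of "cis x" n] C[of "cis x"] by auto
        moreover have "1 / real (Suc n) \<le> 1" by simp
        ultimately have "\<bar>q n (cis x)\<bar> \<le> C + 1" by linarith
        then show ?thesis by simp
      qed
      show "(\<lambda>n. complex_of_real (q n (cis x))) \<longlonglongrightarrow> complex_of_real (F (cis x))" for x
      proof (rule tendsto_of_real)
        have "(\<lambda>n. 1 / real (Suc n)) \<longlonglongrightarrow> 0"
          using LIMSEQ_inverse_real_of_nat by (simp add: inverse_eq_divide)
        then show "(\<lambda>n. q n (cis x)) \<longlonglongrightarrow> F (cis x)"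
          by (rule metric_tendsto_imp_tendsto, intro always_eventually allI)
             (use q(2)[of "cis x"] in \<open>simp add: dist_real_def abs_minus_commute less_imp_le\<close>)
      qed
    qed
  qed
  have closed: "P (indicator ({0..<2*pi} \<inter> cis -` F))" if F: "closed F" for F :: "complex set"
  proof -
    have "P (\<lambda>x. of_real (indicator F (cis x)))"
    proof (cases "F = {}")
      case True
      then show ?thesis using trig[OF trig_poly_const[of 0]] by simp
    next
      case False
      (* Cut-offs of the distance decrease to the indicator of the closed set F. *)
      define H where "H n z = max 0 (1 - real n * infdist z F)" for n and z :: complex
      have cH: "continuous_on S (H n)" for S n
        unfolding H_def by (intro continuous_intros)
      show ?thesis
      proof (rule lim'[where f = "\<lambda>n x. complex_of_real (H n (cis x))" and C = 1])
        show "P (\<lambda>x. complex_of_real (H n (cis x)))" for n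
          by (intro cont cH)
        show "(\<lambda>x. complex_of_real (H n (cis x))) \<in> borel_measurable circle" for n
          by (intro borel_measurable_circle borel_measurable_continuous_onI continuous_intros
               continuous_on_compose2[OF cH[of UNIV]]) auto
        show "cmod (complex_of_real (H n (cis x))) \<le> 1" for n x
          by (simp add: H_def infdist_nonneg)
        show "(\<lambda>n. complex_of_real (H n (cis x))) \<longlonglongrightarrow> complex_of_real (indicator F (cis x))" for x
        proof (rule tendsto_of_real, cases "cis x \<in> F")
          case True
          then show "(\<lambda>n. H n (cis x)) \<longlonglongrightarrow> indicator F (cis x)" by (simp add: H_def)
        next
          case False
          then have pos: "infdist (cis x) F > 0"
            using F \<open>F \<noteq> {}\<close> by (metis in_closed_iff_infdist_zero infdist_nonneg less_eq_real_def)
          then obtain N where N: "1 < real N * infdist (cis x) F"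
            using reals_Archimedean3 by blast
          have "H n (cis x) = 0" if "n \<ge> N" for n
          proof -
            have "real N * infdist (cis x) F \<le> real n * infdist (cis x) F"
              using pos that by (intro mult_right_mono) auto
            then show ?thesis using N by (simp add: H_def)
          qed
          then have "eventually (\<lambda>n. H n (cis x) = 0) sequentially"
            unfolding eventually_sequentially by blast
          then show "(\<lambda>n. H n (cis x)) \<longlonglongrightarrow> indicator F (cis x)"
            using False by (simp add: tendsto_eventually)
        qed
      qed
    qed
    moreover have "(\<lambda>x. complex_of_real (indicator F (cis x))) \<in> borel_measurable circle"
    proof (rule borel_measurable_circle)
      have [measurable]: "F \<in> sets borel" using F by (rule borel_closed)
      have [measurable]: "cis \<in> borel_measurable borel"
        by (intro borel_measurable_continuous_onI continuous_intros)
      show "(\<lambda>x. complex_of_real (indicator F (cis x))) \<in> borel_measurable borel" by measurable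
    qed
    ultimately show ?thesis
      by - (rule lim'[where f = "\<lambda>n x. complex_of_real (indicator F (cis x))" and C = 1],
         auto simp: indicator_def)
  qed
  have ind: "P (indicator E)" if E: "E \<in> sets circle" for E
  proof -
    have "Int_stable {{0..<2*pi} \<inter> cis -` F | F. closed F}"
    proof (rule Int_stableI, safe)
      fix F F' :: "complex set" assume "closed F" "closed F'"
      then show "\<exists>G. {0..<2*pi} \<inter> cis -` F \<inter> ({0..<2*pi} \<inter> cis -` F') = {0..<2*pi} \<inter> cis -` G \<and>
          closed G"
        by (intro exI[of _ "F \<inter> F'"]) auto
    qed
    moreover have "{{0..<2*pi} \<inter> cis -` F | F. closed F} \<subseteq> Pow {0..<2*pi}" by auto
    ultimately show ?thesis using E unfolding sets_circle_generated
    proof (induction rule: sigma_sets_induct_disjoint)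
      case (basic A)
      then show ?case using closed by auto
    next
      case empty
      then show ?case using trig[OF trig_poly_const[of 0]] by (simp add: indicator_def[abs_def])
    next
      case (compl A)
      then have A: "A \<in> sets circle" by (simp add: sets_circle_generated)
      have "P (\<lambda>x. 1 + (-1) * indicator A x)"
        by (intro add[OF bounded_measurable_const trig[OF trig_poly_const]
              bounded_measurable_mult[OF bounded_measurable_const] scale]
            bounded_measurable_indicator A compl(2))
      moreover have "({0..<2*pi} - A) \<in> sets circle"
        using A sets.compl_sets[of A circle] by simp
      ultimately show ?case
        using A by - (rule lim'[where f = "\<lambda>n x. 1 + (-1) * indicator A x" and C = 1],
            auto simp: indicator_def)
    next
      case (union A)
      then have A: "A i \<in> sets circle" for i by (auto simp: sets_circle_generated)
      have bm: "bounded_measurable (\<lambda>x. \<Sum>i<n. indicator (A i) x) \<and> P (\<lambda>x. \<Sum>i<n. indicator (A i)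
          x)" for n :: nat
      proof (induction n)
        case 0
        then show ?case using trig[OF trig_poly_const[of 0]] bounded_measurable_const[of 0] by simp
      next
        case (Suc n)
        then show ?case using add A union(3) bounded_measurable_indicator bounded_measurable_add by simp
      qed
      have part: "(\<Sum>i<n. indicator (A i) x) = (indicator (\<Union>i<n. A i) x :: complex)" for n x
        by (rule indicator_UN_disjoint[symmetric])
           (use union(1) in \<open>auto simp: disjoint_family_on_def\<close>)
      show ?case
      proof (rule lim'[where f = "\<lambda>n x. \<Sum>i<n. indicator (A i) x" and C = 1])
        show "(\<lambda>x. \<Sum>i<n. indicator (A i) x :: complex) \<in> borel_measurable circle" for n
          using bm[of n] by (simp add: bounded_measurable_def)
        show "(\<lambda>n. \<Sum>i<n. indicator (A i) x :: complex) \<longlonglongrightarrow> indicator (\<Union>i. A i) x" for x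
          unfolding part by (rule LIMSEQ_indicator_UN)
        show "cmod (\<Sum>i<n. indicator (A i) x) \<le> 1" for n x
          unfolding part by (simp add: indicator_def)
      qed (use bm in auto)
    qed
  qed
  have [measurable]: "\<phi> \<in> borel_measurable circle"
    using phi by (simp add: bounded_measurable_def)
  obtain C where C: "\<And>x. x \<in> {0..<2*pi} \<Longrightarrow> cmod (\<phi> x) \<le> C"
    using phi unfolding bounded_measurable_def by blast
  obtain F where F0: "(\<forall>i. simple_function circle (F i)) \<and>
      (\<forall>x\<in>space circle. (\<lambda>i. F i x) \<longlonglongrightarrow> \<phi> x) \<and>
      (\<forall>i. \<forall>x\<in>space circle. dist (F i x) 0 \<le> 2 * dist (\<phi> x) 0)"
    using borel_measurable_implies_sequence_metric[of \<phi> circle 0] \<open>\<phi> \<in> borel_measurable circle\<close>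
    by blast
  have F: "\<And>i. simple_function circle (F i)"
    "\<And>x. x \<in> {0..<2*pi} \<Longrightarrow> (\<lambda>i. F i x) \<longlonglongrightarrow> \<phi> x"
    "\<And>i x. x \<in> {0..<2*pi} \<Longrightarrow> cmod (F i x) \<le> 2 * cmod (\<phi> x)"
    using F0 unfolding space_circle dist_complex_def diff_zero by blast+
  define S where "S i x = (\<Sum>y\<in>F i ` {0..<2*pi}. y * indicator (F i -` {y} \<inter> {0..<2*pi}) x)" for i x
  have SF: "S i x = F i x" if x: "x \<in> {0..<2*pi}" for i x
  proof -
    have "F i x = (\<Sum>y\<in>F i ` {0..<2*pi}. indicator (F i -` {y} \<inter> {0..<2*pi}) x *\<^sub>R y)"
      using simple_function_indicator_representation_banach[OF F(1), of x i] x by (simp only: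
          space_circle)
    also have "\<dots> = S i x"
      unfolding S_def by (intro sum.cong refl) (simp add: indicator_def)
    finally show ?thesis by (rule sym)
  qed
  have level: "F i -` {y} \<inter> {0..<2*pi} \<in> sets circle" for i y
    using simple_functionD(2)[OF F(1)[of i], of "{y}"] by simp
  have fin: "finite (F i ` {0..<2*pi})" for i
    using simple_functionD(1)[OF F(1)[of i]] by simp
  have "bounded_measurable (\<lambda>x. \<Sum>y\<in>Y. y * indicator (F i -` {y} \<inter> {0..<2*pi}) x) \<and>
      P (\<lambda>x. \<Sum>y\<in>Y. y * indicator (F i -` {y} \<inter> {0..<2*pi}) x)" if "finite Y" for Y i
    using that
  proof induction
    case empty
    then show ?case using trig[OF trig_poly_const[of 0]] bounded_measurable_const[of 0] by simp
  next
    case (insert y Y)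
    have "bounded_measurable (\<lambda>x. y * indicator (F i -` {y} \<inter> {0..<2*pi}) x)"
      by (rule bounded_measurable_mult[OF bounded_measurable_const bounded_measurable_indicator[OF
          level]])
    note a = this
    have b: "P (\<lambda>x. y * indicator (F i -` {y} \<inter> {0..<2*pi}) x)"
      by (rule scale[OF bounded_measurable_indicator[OF level] ind[OF level]])
    show ?case
      unfolding sum.insert[OF insert(1,2)]
      by (rule conjI[OF bounded_measurable_add[OF a conjunct1[OF insert.IH]]
            add[OF a b conjunct1[OF insert.IH] conjunct2[OF insert.IH]]])
  qed
  from this[OF fin] have S: "bounded_measurable (S i)" "P (S i)" for i
    unfolding S_def by auto
  show ?thesis
  proof (rule lim'[where f = S and C = "2 * C"])
    show "cmod (S n x) \<le> 2 * C" if "x \<in> {0..<2*pi}" for n x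
      using F(3)[OF that, of n] C[OF that] SF[OF that] by simp
  qed (use S F(2) SF in \<open>auto simp: bounded_measurable_def\<close>)
qed

lemma cnj_measurable [measurable]: "cnj \<in> borel_measurable borel"
  by (intro borel_measurable_continuous_onI continuous_intros)

section \<open>Absolutely convergent Fourier series\<close>

text \<open>
  Unordered sums over a countable index type become limits of sequences here, so that the dominated
  convergence theorem for sequences applies to them.
\<close>

lemma has_sum_imp_tendsto_to_nat:
  fixes f :: "'i :: countable \<Rightarrow> 'b :: {comm_monoid_add, topological_space}"
  assumes "(f has_sum s) UNIV"
  shows "(\<lambda>n. \<Sum>i | to_nat i < n. f i) \<longlonglongrightarrow> s"
proof -
  have fin: "finite {i :: 'i. to_nat i < n}" for n
    by (rule finite_imageD[OF finite_subset[of _ "{..<n}"]]) auto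
  have "filterlim (\<lambda>n. {i :: 'i. to_nat i < n}) (finite_subsets_at_top UNIV) sequentially"
  proof (rule filterlim_finite_subsets_at_top[THEN iffD2], safe)
    fix X :: "'i set" assume X: "finite X"
    have "finite {i :: 'i. to_nat i < n} \<and> X \<subseteq> {i. to_nat i < n} \<and> {i :: 'i. to_nat i < n} \<subseteq> UNIV"
        if n: "n \<ge> Suc (Max (insert 0 (to_nat ` X)))" for n
    proof -
      have "to_nat i < n" if "i \<in> X" for i
      proof -
        have "to_nat i \<le> Max (insert 0 (to_nat ` X))"
          using X that by (intro Max_ge) auto
        then show ?thesis using n by linarith
      qed
      then show ?thesis using fin by auto
    qed
    then show "\<forall>\<^sub>F n in sequentially. finite {i :: 'i. to_nat i < n} \<and> X \<subseteq> {i. to_nat i < n} \<and> {i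
        :: 'i. to_nat i < n} \<subseteq> UNIV"
      by (rule eventually_sequentiallyI[where c = "Suc (Max (insert 0 (to_nat ` X)))"])
  qed
  then show ?thesis
    using assms unfolding has_sum_def by (rule filterlim_compose[rotated])
qed

lemma abs_summable_bounded:
  fixes f :: "'i \<Rightarrow> 'b :: banach"
  assumes "b summable_on A" "\<And>i. i \<in> A \<Longrightarrow> norm (f i) \<le> (b i :: real)"
  shows "f abs_summable_on A" "f summable_on A" "norm (infsum f A) \<le> infsum b A"
proof -
  show *: "f abs_summable_on A"
    by (rule summable_on_comparison_test[OF assms(1)]) (use assms(2) in auto)
  then show "f summable_on A" by (rule abs_summable_summable)
  show "norm (infsum f A) \<le> infsum b A"
    by (rule order_trans[OF norm_infsum_bound[OF *]]) (rule infsum_mono[OF * assms(1)], use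
        assms(2) in auto)
qed

lemma integral_infsum:
  fixes f :: "'i :: countable \<Rightarrow> 'a \<Rightarrow> complex"
  assumes "finite_measure M"
    and meas: "\<And>i. f i \<in> borel_measurable M"
    and bound: "\<And>i x. x \<in> space M \<Longrightarrow> cmod (f i x) \<le> b i"
    and b: "b summable_on UNIV"
  shows "(\<lambda>x. \<Sum>\<^sub>\<infinity>i. f i x) \<in> borel_measurable M"
    and "(\<integral>x. (\<Sum>\<^sub>\<infinity>i. f i x) \<partial>M) = (\<Sum>\<^sub>\<infinity>i. \<integral>x. f i x \<partial>M)"
proof -
  interpret finite_measure M by fact
  have lim: "(\<lambda>n. \<Sum>i | to_nat i < n. f i x) \<longlonglongrightarrow> (\<Sum>\<^sub>\<infinity>i. f i x)" if "x \<in> space M" for x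
    using abs_summable_bounded(2)[OF b bound[OF that]]
    by (intro has_sum_imp_tendsto_to_nat) (rule has_sum_infsum)
  have fin: "finite {i :: 'i. to_nat i < n}" for n
    by (rule finite_imageD[OF finite_subset[of _ "{..<n}"]]) auto
  have msum: "(\<lambda>x. \<Sum>i | to_nat i < n. f i x) \<in> borel_measurable M" for n
    by (intro borel_measurable_sum meas)
  show meas': "(\<lambda>x. \<Sum>\<^sub>\<infinity>i. f i x) \<in> borel_measurable M"
    by (rule borel_measurable_LIMSEQ_metric[OF msum lim])
  have int: "integrable M (f i)" for i
    by (rule integrable_const_bound[of _ "b i"]) (use meas bound in auto)
  have nonneg: "b i \<ge> 0" if "space M \<noteq> {}" for i
    using that bound[of _ i] norm_ge_zero order_trans by blast
  have "(\<lambda>n. \<integral>x. (\<Sum>i | to_nat i < n. f i x) \<partial>M) \<longlonglongrightarrow> (\<integral>x. (\<Sum>\<^sub>\<infinity>i. f i x) \<partial>M)"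
  proof (rule integral_dominated_convergence[where w = "\<lambda>_. infsum b UNIV"])
    show "AE x in M. norm (\<Sum>i | to_nat i < n. f i x) \<le> infsum b UNIV" for n
    proof (rule AE_I2)
      fix x assume x: "x \<in> space M"
      have "norm (\<Sum>i | to_nat i < n. f i x) \<le> (\<Sum>i | to_nat i < n. b i)"
        by (intro sum_norm_le bound x)
      also have "\<dots> \<le> infsum b UNIV"
        by (rule finite_sum_le_infsum[OF b fin]) (use nonneg x in auto)
      finally show "norm (\<Sum>i | to_nat i < n. f i x) \<le> infsum b UNIV" .
    qed
  qed (use meas' msum lim in auto)
  also have "(\<lambda>n. \<integral>x. (\<Sum>i | to_nat i < n. f i x) \<partial>M) = (\<lambda>n. \<Sum>i | to_nat i < n. \<integral>x. f i x \<partial>M)"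
    by (intro ext Bochner_Integration.integral_sum int)
  finally have 1: "(\<lambda>n. \<Sum>i | to_nat i < n. \<integral>x. f i x \<partial>M) \<longlonglongrightarrow> (\<integral>x. (\<Sum>\<^sub>\<infinity>i. f i x) \<partial>M)" .
  have "cmod (\<integral>x. f i x \<partial>M) \<le> b i * measure M (space M)" for i
  proof -
    have "cmod (\<integral>x. f i x \<partial>M) \<le> (\<integral>x. cmod (f i x) \<partial>M)" by (rule integral_norm_bound)
    also have "\<dots> \<le> (\<integral>x. b i \<partial>M)"
      by (rule integral_mono) (use int bound in auto)
    finally show ?thesis by (simp add: mult.commute)
  qed
  then have "(\<lambda>i. \<integral>x. f i x \<partial>M) summable_on UNIV"
    by (intro abs_summable_bounded(2)[OF summable_on_cmult_left[OF b]]) auto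
  then have "(\<lambda>n. \<Sum>i | to_nat i < n. \<integral>x. f i x \<partial>M) \<longlonglongrightarrow> (\<Sum>\<^sub>\<infinity>i. \<integral>x. f i x \<partial>M)"
    by (intro has_sum_imp_tendsto_to_nat) (rule has_sum_infsum)
  with 1 show "(\<integral>x. (\<Sum>\<^sub>\<infinity>i. f i x) \<partial>M) = (\<Sum>\<^sub>\<infinity>i. \<integral>x. f i x \<partial>M)"
    by (rule LIMSEQ_unique)
qed

text \<open>
  Tannery's theorem. All passages to the limit inside sums over diagonals go through it.
\<close>

lemma infsum_dominated_convergence:
  fixes f :: "nat \<Rightarrow> 'i \<Rightarrow> 'b :: banach"
  assumes b: "b summable_on UNIV"
    and bound: "\<And>n i. norm (f n i) \<le> b i"
    and lim: "\<And>i. (\<lambda>n. f n i) \<longlonglongrightarrow> g i"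
  shows "(\<lambda>n. \<Sum>\<^sub>\<infinity>i. f n i) \<longlonglongrightarrow> (\<Sum>\<^sub>\<infinity>i. g i)"
proof (rule LIMSEQ_I)
  fix e :: real assume e: "e > 0"
  have bg: "norm (g i) \<le> b i" for i
    using bound by (intro LIMSEQ_le_const2[OF tendsto_norm[OF lim]]) auto
  have b0: "b i \<ge> 0" for i
    using bg[of i] norm_ge_zero order_trans by blast
  obtain S where S: "finite S" "dist (sum b S) (infsum b UNIV) \<le> e / 4"
    using infsum_finite_approximation[OF b, of "e/4"] e by auto
  have "infsum b UNIV = infsum b S + infsum b (-S)"
    using infsum_Un_disjoint[of b S "-S"] summable_on_subset_banach[OF b] by auto
  then have tail: "infsum b (-S) \<le> e / 4"
    using S by (simp add: dist_real_def)
  have split: "norm ((\<Sum>\<^sub>\<infinity>i. h i) - (\<Sum>i\<in>S. h i)) \<le> e / 4" if h: "\<And>i. norm (h i) \<le> b i" for h :: "'i \<Rightarrow> 'b"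
  proof -
    have "h summable_on A" for A
      by (rule abs_summable_bounded(2)[OF summable_on_subset_banach[OF b]]) (auto intro: h)
    then have "(\<Sum>\<^sub>\<infinity>i. h i) = (\<Sum>i\<in>S. h i) + infsum h (-S)"
      using infsum_Un_disjoint[of h S "-S"] S(1) by auto
    moreover have "norm (infsum h (-S)) \<le> infsum b (-S)"
      by (rule abs_summable_bounded(3)[OF summable_on_subset_banach[OF b]]) (auto intro: h)
    ultimately show ?thesis using tail by simp
  qed
  have "(\<lambda>n. \<Sum>i\<in>S. f n i) \<longlonglongrightarrow> (\<Sum>i\<in>S. g i)"
    by (intro tendsto_sum lim)
  then obtain N where N: "\<And>n. n \<ge> N \<Longrightarrow> norm ((\<Sum>i\<in>S. f n i) - (\<Sum>i\<in>S. g i)) < e / 4"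
    using LIMSEQ_D[of _ _ "e/4"] e by fastforce
  have "norm ((\<Sum>\<^sub>\<infinity>i. f n i) - (\<Sum>\<^sub>\<infinity>i. g i)) < e" if n: "n \<ge> N" for n
  proof -
    have "(\<Sum>\<^sub>\<infinity>i. f n i) - (\<Sum>\<^sub>\<infinity>i. g i) = ((\<Sum>\<^sub>\<infinity>i. f n i) - (\<Sum>i\<in>S. f n i)) +
        ((\<Sum>i\<in>S. f n i) - (\<Sum>i\<in>S. g i)) - ((\<Sum>\<^sub>\<infinity>i. g i) - (\<Sum>i\<in>S. g i))" by simp
    also have "norm \<dots> \<le> norm ((\<Sum>\<^sub>\<infinity>i. f n i) - (\<Sum>i\<in>S. f n i)) +
        norm ((\<Sum>i\<in>S. f n i) - (\<Sum>i\<in>S. g i)) + norm ((\<Sum>\<^sub>\<infinity>i. g i) - (\<Sum>i\<in>S. g i))"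
      by (meson add_right_mono norm_triangle_ineq norm_triangle_ineq4 order_trans)
    also have "\<dots> < e"
      using split[OF bound[of n]] split[OF bg] N[OF n] e by linarith
    finally show ?thesis .
  qed
  then show "\<exists>N. \<forall>n\<ge>N. norm ((\<Sum>\<^sub>\<infinity>i. f n i) - (\<Sum>\<^sub>\<infinity>i. g i)) < e" by blast
qed

abbreviation abs_summable :: "(int \<Rightarrow> complex) \<Rightarrow> bool" where
  "abs_summable a \<equiv> (\<lambda>k. cmod (a k)) summable_on UNIV"

definition fourier_series :: "(int \<Rightarrow> complex) \<Rightarrow> real \<Rightarrow> complex" where
  "fourier_series a x = (\<Sum>\<^sub>\<infinity>k. a k * character k x)"

lemma summable_mult_unimodular:
  fixes a :: "'i \<Rightarrow> complex"
  assumes "(\<lambda>k. cmod (a k)) summable_on UNIV" "\<And>k. cmod (u k) \<le> C"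
  shows "(\<lambda>k. a k * u k) summable_on UNIV"
  by (rule abs_summable_bounded(2)[OF summable_on_cmult_left[OF assms(1), of C]])
     (auto simp: norm_mult intro!: mult_left_mono assms(2))

lemma norm_fourier_series_le:
  assumes "abs_summable a"
  shows "cmod (fourier_series a x) \<le> (\<Sum>\<^sub>\<infinity>k. cmod (a k))"
  unfolding fourier_series_def by (rule abs_summable_bounded(3)[OF assms]) (simp add: norm_mult)

text \<open>
  The series is composed with a map \<open>g\<close> so that the lemma serves both the circle and the two
  coordinates of the torus.
\<close>

lemma fourier_series_integral:
  assumes "finite_measure M" "f \<in> borel_measurable M" "\<And>x. x \<in> space M \<Longrightarrow> cmod (f x) \<le> C"
    and g: "g \<in> borel_measurable M" and a: "abs_summable a"
  shows "(\<integral>x. fourier_series a (g x) * f x \<partial>M) = (\<Sum>\<^sub>\<infinity>k. a k * (\<integral>x. character k (g x) * f x \<partial>M))"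
proof -
  have "(\<integral>x. (\<Sum>\<^sub>\<infinity>k. a k * (character k (g x) * f x)) \<partial>M) = (\<Sum>\<^sub>\<infinity>k. \<integral>x. a k * (character k (g x) * f
      x) \<partial>M)"
  proof (rule integral_infsum(2)[OF assms(1) _ _ summable_on_cmult_left[OF a, of C]])
    show "(\<lambda>x. a i * (character i (g x) * f x)) \<in> borel_measurable M" for i
      using measurable_compose[OF g character_measurable] assms(2) by measurable
  qed (auto simp: norm_mult intro!: mult_left_mono assms)
  also have "(\<lambda>x. \<Sum>\<^sub>\<infinity>k. a k * (character k (g x) * f x)) = (\<lambda>x. fourier_series a (g x) * f x)"
    unfolding fourier_series_def
    by (intro ext) (subst infsum_cmult_left[symmetric], auto simp: mult.assoc intro!:
        summable_mult_unimodular[OF a, of _ 1])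
  finally show ?thesis by simp
qed

lemma continuous_on_fourier_series:
  assumes "abs_summable a" shows "continuous_on S (fourier_series a)"
proof -
  have "continuous_on UNIV (fourier_series a)"
    unfolding continuous_on_sequentially
  proof safe
    fix x :: "nat \<Rightarrow> real" and l assume x: "x \<longlonglongrightarrow> l"
    have "(\<lambda>n. character k (x n)) \<longlonglongrightarrow> character k l" for k
      by (rule continuous_on_tendsto_compose[OF _ x, of UNIV]) (auto intro: continuous_intros)
    then show "(fourier_series a \<circ> x) \<longlonglongrightarrow> fourier_series a l"
      unfolding o_def fourier_series_def
      by (intro infsum_dominated_convergence[OF assms] tendsto_intros) (auto simp: norm_mult)
  qed
  then show ?thesis by (rule continuous_on_subset) simp
qed

lemma fourier_series_measurable: "abs_summable a \<Longrightarrow> fourier_series a \<in> borel_measurable borel"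
  by (intro borel_measurable_continuous_onI continuous_on_fourier_series)

lemma bounded_measurable_fourier_series: "abs_summable a \<Longrightarrow> bounded_measurable (fourier_series a)"
  by (rule bounded_measurableI[OF fourier_series_measurable norm_fourier_series_le])

lemma integral_character_mult:
  "(\<integral>x. character j x * character k x \<partial>circle) = (if j + k = 0 then 1 else 0)"
  using integral_character[of "j + k"] by (simp add: character_add)

lemma infsum_single:
  fixes f :: "'i \<Rightarrow> 'b :: {topological_comm_monoid_add, t2_space}"
  assumes "\<And>i. i \<noteq> k \<Longrightarrow> f i = 0" shows "(\<Sum>\<^sub>\<infinity>i. f i) = f k"
  using infsum_cong_neutral[of "{k}" UNIV f f] assms by auto

lemma fourier_coeff_fourier_series:
  assumes "abs_summable a" shows "fourier_coeff (fourier_series a) k = a k"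
proof -
  have "(\<integral>x. fourier_series a x * cnj (character k x) \<partial>circle) =
      (\<Sum>\<^sub>\<infinity>j. a j * (\<integral>x. character j x * cnj (character k x) \<partial>circle))"
    by (rule fourier_series_integral[OF circle.finite_measure_axioms, of _ 1 "\<lambda>x. x", OF _ _ _ assms])
       (auto simp: cnj_character intro!: borel_measurable_circle character_measurable)
  also have "\<dots> = a k"
    by (subst infsum_single[of k]) (auto simp: cnj_character integral_character_mult)
  finally show ?thesis unfolding fourier_coeff_def .
qed

lemma integral_fourier_series_cnj:
  assumes a: "abs_summable a" and b: "abs_summable b"
  shows "(\<integral>x. character m x * (fourier_series a x * cnj (fourier_series b x)) \<partial>circle) =
    (\<Sum>\<^sub>\<infinity>j. a j * cnj (b (j + m)))"
proof -
  have bm: "fourier_series b \<in> borel_measurable circle"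
    by (intro borel_measurable_circle fourier_series_measurable b)
  have "(\<integral>x. fourier_series a x * (character m x * cnj (fourier_series b x)) \<partial>circle) =
      (\<Sum>\<^sub>\<infinity>j. a j * (\<integral>x. character j x * (character m x * cnj (fourier_series b x)) \<partial>circle))"
  proof (rule fourier_series_integral[OF circle.finite_measure_axioms, where C = "\<Sum>\<^sub>\<infinity>k. cmod (b
      k)" and g = "\<lambda>x. x", OF _ _ _ a])
    show "(\<lambda>x. character m x * cnj (fourier_series b x)) \<in> borel_measurable circle"
    proof -
      note [measurable] = bm borel_measurable_circle[OF character_measurable, of m]
      show ?thesis by measurable
    qed
  qed (auto simp: norm_mult norm_fourier_series_le[OF b] intro: borel_measurable_circle)
  also have "(\<lambda>j. \<integral>x. character j x * (character m x * cnj (fourier_series b x)) \<partial>circle) = (\<lambda>j.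
      cnj (b (j + m)))"
  proof
    fix j
    have "(\<integral>x. character j x * (character m x * cnj (fourier_series b x)) \<partial>circle) =
      (\<integral>x. cnj (fourier_series b x * cnj (character (j + m) x)) \<partial>circle)"
      by (simp add: character_add mult_ac)
    also have "\<dots> = cnj (fourier_coeff (fourier_series b) (j + m))"
      unfolding fourier_coeff_def by (rule Bochner_Integration.integral_cnj)
    finally show "(\<integral>x. character j x * (character m x * cnj (fourier_series b x)) \<partial>circle) = cnj
        (b (j + m))"
      by (simp add: fourier_coeff_fourier_series[OF b])
  qed
  finally show ?thesis by (simp add: mult_ac)
qed

section \<open>Uniqueness of Fourier coefficients\<close>

lemma bounded_measurable_integrable:
  assumes "bounded_measurable f" "finite_measure M" "sets M = sets circle"
  shows "integrable M f"
proof -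
  interpret finite_measure M by fact
  have sp: "space M = {0..<2*pi}" using sets_eq_imp_space_eq[OF assms(3)] by simp
  from assms(1) obtain C where C: "\<forall>x\<in>{0..<2*pi}. cmod (f x) \<le> C" "f \<in> borel_measurable circle"
    unfolding bounded_measurable_def by blast
  then have "f \<in> borel_measurable M"
    using measurable_cong_sets[OF assms(3) refl] by blast
  then show ?thesis
    by (rule integrable_const_bound[of _ C, rotated]) (use C sp in auto)
qed

lemma integrable_bounded_measurable_mult:
  assumes "bounded_measurable g" "integrable circle f"
  shows "integrable circle (\<lambda>x. g x * f x)"
proof -
  obtain C where C: "\<forall>x\<in>{0..<2*pi}. cmod (g x) \<le> C" and g: "g \<in> borel_measurable circle"
    using assms(1) unfolding bounded_measurable_def by blast
  show ?thesis
  proof (rule Bochner_Integration.integrable_bound[OF integrable_mult_right[of C, OF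
      integrable_norm[OF assms(2)]]])
    show "(\<lambda>x. g x * f x) \<in> borel_measurable circle"
      using g borel_measurable_integrable[OF assms(2)] by measurable
    show "AE x in circle. norm (g x * f x) \<le> norm (C * norm (f x))"
    proof (rule AE_I2)
      fix x assume "x \<in> space circle"
      then have "cmod (g x) \<le> C" using C by simp
      then have "cmod (g x) * cmod (f x) \<le> C * cmod (f x)" by (intro mult_right_mono) auto
      then show "norm (g x * f x) \<le> norm (C * norm (f x))" by (simp add: norm_mult)
    qed
  qed
qed

text \<open>
  A finite measure on the circle is determined by its Fourier coefficients. The right-hand side is a
  complex density, so that the same lemma yields uniqueness for integrable functions (with \<open>M = 0\<close>)
  and the absolute continuity of measures with summable coefficients.
\<close>

theorem integral_eq_of_fourier_coeff_eq:
  assumes "finite_measure M" "sets M = sets circle" "integrable circle f"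
    and coeff: "\<And>n. (\<integral>x. character n x \<partial>M) = (\<integral>x. character n x * f x \<partial>circle)"
    and "bounded_measurable \<phi>"
  shows "(\<integral>x. \<phi> x \<partial>M) = (\<integral>x. \<phi> x * f x \<partial>circle)"
  using assms(5)
proof (induction rule: bounded_measurable_induct_characters)
  case (character k)
  then show ?case by (rule coeff)
next
  case (scale c g)
  then show ?case by (simp add: mult.assoc)
next
  case (add g h)
  then show ?case
    by (simp add: distrib_right Bochner_Integration.integral_add bounded_measurable_integrable[OF
        _ assms(1,2)]
        integrable_bounded_measurable_mult[OF _ assms(3)])
next
  case (lim g h C)
  have sp: "space M = {0..<2*pi}" using sets_eq_imp_space_eq[OF assms(2)] by simp
  interpret finite_measure M by fact
  note mM = measurable_cong_sets[OF assms(2) refl]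
  have fm: "f \<in> borel_measurable circle" by (rule borel_measurable_integrable[OF assms(3)])
  have "(\<lambda>n. \<integral>x. g n x \<partial>M) \<longlonglongrightarrow> (\<integral>x. h x \<partial>M)"
    by (rule integral_dominated_convergence[where w = "\<lambda>_. C"]) (use lim sp in \<open>auto simp: mM\<close>)
  moreover have "(\<lambda>n. \<integral>x. g n x * f x \<partial>circle) \<longlonglongrightarrow> (\<integral>x. h x * f x \<partial>circle)"
  proof (rule integral_dominated_convergence[where w = "\<lambda>x. C * cmod (f x)"])
    show "(\<lambda>x. g n x * f x) \<in> borel_measurable circle" for n
      by (rule borel_measurable_times[OF lim(1) fm])
    show "(\<lambda>x. h x * f x) \<in> borel_measurable circle"
      by (rule borel_measurable_times[OF \<open>h \<in> borel_measurable circle\<close> fm])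
    show "integrable circle (\<lambda>x. C * cmod (f x))"
      by (intro integrable_mult_right integrable_norm assms(3))
    show "AE x in circle. (\<lambda>n. g n x * f x) \<longlonglongrightarrow> h x * f x"
      by (rule AE_I2, intro tendsto_mult tendsto_const) (use lim in simp)
    show "AE x in circle. norm (g n x * f x) \<le> C * cmod (f x)" for n
      by (rule AE_I2) (use lim(2) in \<open>auto simp: norm_mult intro!: mult_right_mono\<close>)
  qed
  ultimately show ?case
    using lim(5) LIMSEQ_unique by simp
qed

text \<open>
  Testing with the conjugated sign of \<open>f\<close> gives \<open>\<integral> |f| = 0\<close>.
\<close>

lemma AE_circle_zero_of_fourier_coeff_zero:
  assumes f: "integrable circle f" and "\<And>n. fourier_coeff f n = 0"
  shows "AE x in circle. f x = 0"
proof -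
  have [measurable]: "f \<in> borel_measurable circle" by (rule borel_measurable_integrable[OF f])
  have null: "finite_measure (null_measure circle)"
    by (rule finite_measureI) simp
  have "bounded_measurable (\<lambda>x. cnj (sgn (f x)))"
    unfolding bounded_measurable_def
  proof (intro conjI exI[of _ 1] ballI)
    show "(\<lambda>x. cnj (sgn (f x))) \<in> borel_measurable circle"
      unfolding sgn_div_norm by measurable
  qed (simp add: norm_sgn)
  then have "(\<integral>x. cnj (sgn (f x)) \<partial>(null_measure circle)) = (\<integral>x. cnj (sgn (f x)) * f x \<partial>circle)"
  proof (rule integral_eq_of_fourier_coeff_eq[OF null _ f, rotated 2])
    fix n
    have "(\<integral>x. character n x * f x \<partial>circle) = fourier_coeff f (- n)"
      by (simp add: fourier_coeff_def cnj_character mult.commute)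
    then show "(\<integral>x. character n x \<partial>null_measure circle) = (\<integral>x. character n x * f x \<partial>circle)"
      using assms(2) by simp
  qed simp
  also have "(\<lambda>x. cnj (sgn (f x)) * f x) = (\<lambda>x. complex_of_real (cmod (f x)))"
  proof
    fix x show "cnj (sgn (f x)) * f x = complex_of_real (cmod (f x))"
      using complex_norm_square[of "f x"]
      by (cases "f x = 0") (auto simp: sgn_div_norm scaleR_conv_of_real field_simps power2_eq_square)
  qed
  finally have "(\<integral>x. cmod (f x) \<partial>circle) = 0"
    by simp
  then show ?thesis
    by (subst (asm) integral_nonneg_eq_0_iff_AE) (use f in auto)
qed

lemma ACF_eq_fourier_series:
  assumes "g \<in> ACF"
  shows "AE x in circle. g x = fourier_series (fourier_coeff g) x" "abs_summable (fourier_coeff g)"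
proof -
  show a: "abs_summable (fourier_coeff g)" using assms by (simp add: ACF_def)
  have g: "integrable circle g" using assms by (simp add: ACF_def)
  have s: "integrable circle (fourier_series (fourier_coeff g))"
    by (rule bounded_measurable_integrable[OF bounded_measurable_fourier_series[OF a]
        circle.finite_measure_axioms refl])
  have "fourier_coeff (\<lambda>x. g x - fourier_series (fourier_coeff g) x) n = 0" for n
  proof -
    have ch: "bounded_measurable (\<lambda>x. cnj (character n x))"
      unfolding cnj_character by (intro bounded_measurable_trig_poly trig_poly.character)
    have "fourier_coeff (\<lambda>x. g x - fourier_series (fourier_coeff g) x) n =
      fourier_coeff g n - fourier_coeff (fourier_series (fourier_coeff g)) n"
      using Bochner_Integration.integral_diff[OF integrable_bounded_measurable_mult[OF ch g]
          integrable_bounded_measurable_mult[OF ch s]]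
      unfolding fourier_coeff_def [of _ n] left_diff_distrib by (simp only: mult.commute)
    then show ?thesis by (simp add: fourier_coeff_fourier_series[OF a])
  qed
  then have "AE x in circle. g x - fourier_series (fourier_coeff g) x = 0"
    by (intro AE_circle_zero_of_fourier_coeff_zero Bochner_Integration.integrable_diff g s)
  then show "AE x in circle. g x = fourier_series (fourier_coeff g) x" by simp
qed

text \<open>
  The Fourier series with the coefficients of \<open>M\<close> converges to a bounded function, and by uniqueness
  this function is a density of \<open>M\<close>.
\<close>

lemma AE_of_summable_fourier_coeff:
  assumes M: "finite_measure M" "sets M = sets circle"
    and c: "abs_summable (\<lambda>n. \<integral>x. cnj (character n x) \<partial>M)"
    and P: "AE x in circle. P x"
  shows "AE x in M. P x"
proof -
  interpret finite_measure M by fact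
  define c where "c n = (\<integral>x. cnj (character n x) \<partial>M)" for n
  have c: "abs_summable c" using c by (simp add: c_def)
  obtain N where N: "{x \<in> space circle. \<not> P x} \<subseteq> N" "emeasure circle N = 0" "N \<in> sets circle"
    using P by (auto elim: AE_E)
  have ind: "bounded_measurable (indicator N)" by (rule bounded_measurable_indicator[OF N(3)])
  have "(\<integral>x. indicator N x \<partial>M) = (\<integral>x. indicator N x * fourier_series c x \<partial>circle)"
  proof (rule integral_eq_of_fourier_coeff_eq[OF M _ _ ind])
    show "integrable circle (fourier_series c)"
      by (rule bounded_measurable_integrable[OF bounded_measurable_fourier_series[OF c]
          circle.finite_measure_axioms refl])
    fix n
    have "(\<integral>x. character n x * fourier_series c x \<partial>circle) = fourier_coeff (fourier_series c) (- n)"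
      by (simp add: fourier_coeff_def cnj_character mult.commute)
    also have "\<dots> = (\<integral>x. character n x \<partial>M)"
      unfolding fourier_coeff_fourier_series[OF c] by (simp add: c_def cnj_character)
    finally show "(\<integral>x. character n x \<partial>M) = (\<integral>x. character n x * fourier_series c x \<partial>circle)" ..
  qed
  also have "\<dots> = 0"
  proof (rule integral_eq_zero_AE)
    have "AE x in circle. x \<notin> N" using N by (intro AE_not_in) auto
    then show "AE x in circle. indicator N x * fourier_series c x = 0" by eventually_elim simp
  qed
  also have "(\<integral>x. indicator N x \<partial>M) = (\<integral>x. complex_of_real (indicat_real N x) \<partial>M)"
    by (intro Bochner_Integration.integral_cong refl) (simp add: indicator_def)
  also have "\<dots> = complex_of_real (measure M N)"
    using N(3) M(2) sets.sets_into_space[of N M] by (simp add: Int_absorb2)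
  finally have "complex_of_real (measure M N) = 0" .
  then have "emeasure M N = 0" by (simp add: emeasure_eq_measure)
  moreover have "{x \<in> space M. \<not> P x} \<subseteq> N"
    using N(1) sets_eq_imp_space_eq[OF M(2)] by simp
  ultimately show ?thesis using N(3) M(2) by (auto intro: AE_I)
qed

section \<open>Square-integrable functions\<close>

lemma L2_measurable: "f \<in> L2 \<Longrightarrow> f \<in> borel_measurable circle"
  and L2_integrable: "f \<in> L2 \<Longrightarrow> integrable circle (\<lambda>x. (cmod (f x))\<^sup>2)"
  by (simp_all add: L2_def)

lemma L2_norm_nonneg: "0 \<le> L2_norm f"
  by (simp add: L2_norm_def)

lemma L2_norm_power2: "(L2_norm f)\<^sup>2 = (\<integral>x. (cmod (f x))\<^sup>2 \<partial>circle)"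
  by (simp add: L2_norm_def)

lemma L2_mult:
  assumes f: "f \<in> L2" and g: "g \<in> borel_measurable circle" and B: "AE x in circle. cmod (g x) \<le> B"
  shows "(\<lambda>x. g x * f x) \<in> L2" "L2_norm (\<lambda>x. g x * f x) \<le> \<bar>B\<bar> * L2_norm f"
proof -
  note [measurable] = L2_measurable[OF f] g
  have le: "AE x in circle. (cmod (g x * f x))\<^sup>2 \<le> B\<^sup>2 * (cmod (f x))\<^sup>2"
    using B
  proof eventually_elim
    case (elim x)
    then have "(cmod (g x))\<^sup>2 \<le> B\<^sup>2" by (simp add: power_mono)
    then show ?case by (simp add: norm_mult power_mult_distrib mult_right_mono)
  qed
  have int: "integrable circle (\<lambda>x. B\<^sup>2 * (cmod (f x))\<^sup>2)"
    by (rule integrable_mult_right[OF L2_integrable[OF f]])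
  have int': "integrable circle (\<lambda>x. (cmod (g x * f x))\<^sup>2)"
    by (rule Bochner_Integration.integrable_bound[OF int]) (use le in auto)
  then show "(\<lambda>x. g x * f x) \<in> L2" by (simp add: L2_def)
  have "(L2_norm (\<lambda>x. g x * f x))\<^sup>2 \<le> (\<integral>x. B\<^sup>2 * (cmod (f x))\<^sup>2 \<partial>circle)"
    unfolding L2_norm_power2 by (rule integral_mono_AE[OF int' int le])
  also have "\<dots> = (\<bar>B\<bar> * L2_norm f)\<^sup>2"
    by (simp add: L2_norm_power2 power_mult_distrib)
  finally show "L2_norm (\<lambda>x. g x * f x) \<le> \<bar>B\<bar> * L2_norm f"
    by (rule power2_le_imp_le) (simp add: L2_norm_nonneg)
qed

lemma L2_scale: "f \<in> L2 \<Longrightarrow> (\<lambda>x. c * f x) \<in> L2"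
  using L2_mult(1)[of f "\<lambda>_. c" "cmod c"] by simp

lemma L2_norm_scale: "L2_norm (\<lambda>x. c * f x) = cmod c * L2_norm f"
  by (simp add: L2_norm_def norm_mult power_mult_distrib real_sqrt_mult)

lemma bounded_measurable_L2: "bounded_measurable f \<Longrightarrow> f \<in> L2"
proof -
  assume f: "bounded_measurable f"
  have one: "(\<lambda>_. 1) \<in> L2" by (simp add: L2_def)
  obtain C where "\<forall>x\<in>{0..<2*pi}. cmod (f x) \<le> C" "f \<in> borel_measurable circle"
    using f unfolding bounded_measurable_def by blast
  then have "AE x in circle. cmod (f x) \<le> C" by (intro AE_I2) simp
  then show ?thesis using L2_mult(1)[OF one \<open>f \<in> borel_measurable circle\<close>] by simp
qed

text \<open>
  Minkowski's inequality, obtained by integrating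
  \<open>|u + v|\<^sup>2 \<le> (1 + t) |u|\<^sup>2 + (1 + 1/t) |v|\<^sup>2\<close> and choosing \<open>t\<close> as the ratio of the norms. The norms are
  first increased by \<open>e/2\<close> so that the ratio makes sense.
\<close>

lemma L2_norm_triangle:
  assumes f: "f \<in> L2" and g: "g \<in> L2"
  shows "(\<lambda>x. f x + g x) \<in> L2" "L2_norm (\<lambda>x. f x + g x) \<le> L2_norm f + L2_norm g"
proof -
  note [measurable] = L2_measurable[OF f] L2_measurable[OF g]
  have pt: "(cmod (u + v))\<^sup>2 \<le> (1 + t) * (cmod u)\<^sup>2 + (1 + 1/t) * (cmod v)\<^sup>2" if t: "t > 0" for u
      v and t :: real
  proof -
    have "(cmod (u + v))\<^sup>2 \<le> (cmod u + cmod v)\<^sup>2"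
      by (intro power_mono norm_triangle_ineq) simp
    also have "\<dots> = (1 + t) * (cmod u)\<^sup>2 + (1 + 1/t) * (cmod v)\<^sup>2 - (t * cmod u - cmod v)\<^sup>2 / t"
      using t by (simp add: field_simps power2_eq_square)
    also have "\<dots> \<le> (1 + t) * (cmod u)\<^sup>2 + (1 + 1/t) * (cmod v)\<^sup>2" using t by simp
    finally show ?thesis .
  qed
  have int: "integrable circle (\<lambda>x. (1 + t) * (cmod (f x))\<^sup>2 + (1 + 1/t) * (cmod (g x))\<^sup>2)" for t
      :: real
    by (intro Bochner_Integration.integrable_add integrable_mult_right L2_integrable f g)
  have int': "integrable circle (\<lambda>x. (cmod (f x + g x))\<^sup>2)"
    by (rule Bochner_Integration.integrable_bound[OF int[of 1]]) (use pt[of 1] in auto)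
  then show "(\<lambda>x. f x + g x) \<in> L2" by (simp add: L2_def)
  show "L2_norm (\<lambda>x. f x + g x) \<le> L2_norm f + L2_norm g"
  proof (rule field_le_epsilon)
    fix e :: real assume e: "e > 0"
    define a b where "a = L2_norm f + e/2" and "b = L2_norm g + e/2"
    have ab: "a > 0" "b > 0" using e L2_norm_nonneg[of f] L2_norm_nonneg[of g] by (auto simp:
        a_def b_def)
    define t where "t = b / a"
    have t: "t > 0" using ab by (simp add: t_def)
    have "(L2_norm (\<lambda>x. f x + g x))\<^sup>2 \<le> (\<integral>x. (1 + t) * (cmod (f x))\<^sup>2 + (1 + 1/t) * (cmod (g x))\<^sup>2
        \<partial>circle)"
      unfolding L2_norm_power2 by (rule integral_mono[OF int' int pt[OF t]])
    also have "\<dots> = (1 + t) * (L2_norm f)\<^sup>2 + (1 + 1/t) * (L2_norm g)\<^sup>2"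
      unfolding L2_norm_power2 by (simp add: L2_integrable f g)
    also have "\<dots> \<le> (1 + t) * a\<^sup>2 + (1 + 1/t) * b\<^sup>2"
      by (intro add_mono mult_left_mono power_mono) (use e t L2_norm_nonneg in \<open>auto simp: a_def b_def\<close>)
    also have "\<dots> = (a + b)\<^sup>2"
      using ab by (simp add: t_def field_simps power2_eq_square)
    finally have "L2_norm (\<lambda>x. f x + g x) \<le> a + b"
      by (rule power2_le_imp_le) (use ab in simp)
    then show "L2_norm (\<lambda>x. f x + g x) \<le> L2_norm f + L2_norm g + e"
      by (simp add: a_def b_def)
  qed
qed

lemma L2_diff:
  assumes "f \<in> L2" "g \<in> L2"
  shows "(\<lambda>x. f x - g x) \<in> L2"
  using L2_norm_triangle(1)[OF assms(1) L2_scale[OF assms(2), of "-1"]] by simp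

lemma L2_norm_cong_AE:
  assumes "f \<in> L2" "g \<in> L2" "AE x in circle. f x = g x"
  shows "L2_norm f = L2_norm g"
  unfolding L2_norm_def
  by (rule arg_cong[where f = sqrt], rule integral_cong_AE)
     (use assms L2_measurable in auto)

lemma L2_norm_minus_commute: "L2_norm (\<lambda>x. f x - g x) = L2_norm (\<lambda>x. g x - f x)"
  by (simp add: L2_norm_def norm_minus_commute)

lemma L2_norm_diff_triangle:
  assumes "f \<in> L2" "g \<in> L2" "h \<in> L2"
  shows "L2_norm (\<lambda>x. f x - h x) \<le> L2_norm (\<lambda>x. f x - g x) + L2_norm (\<lambda>x. g x - h x)"
  using L2_norm_triangle(2)[OF L2_diff[OF assms(1,2)] L2_diff[OF assms(2,3)]] by simp

lemma L2_norm_reverse_triangle: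
  assumes f: "f \<in> L2" and g: "g \<in> L2"
  shows "\<bar>L2_norm f - L2_norm g\<bar> \<le> L2_norm (\<lambda>x. f x - g x)"
  using L2_norm_triangle(2)[OF L2_diff[OF f g] g] L2_norm_triangle(2)[OF L2_diff[OF g f] f]
    L2_norm_minus_commute[of f g] by simp

text \<open>
  Bounded measurable functions are covered by the monotone class theorem, because bounded pointwise
  limits are limits in the norm. A general function is the limit of its truncations.
\<close>

lemma trig_poly_dense_L2:
  assumes f: "f \<in> L2" and "e > 0"
  shows "\<exists>p. trig_poly p \<and> L2_norm (\<lambda>x. f x - p x) < e"
proof -
  define D where "D \<phi> \<longleftrightarrow> (\<forall>e>0. \<exists>p. trig_poly p \<and> L2_norm (\<lambda>x. \<phi> x - p x) < e)" for \<phi>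
  have closed: "D g" if g: "g \<in> L2" and hn: "\<And>n. h n \<in> L2" "\<And>n. D (h n)"
    and lim: "(\<lambda>n. \<integral>x. (cmod (g x - h n x))\<^sup>2 \<partial>circle) \<longlonglongrightarrow> 0" for g :: "real \<Rightarrow> complex" and h :: "nat \<Rightarrow> _"
    unfolding D_def
  proof (intro allI impI)
    fix e :: real assume e: "e > 0"
    have "(\<lambda>n. L2_norm (\<lambda>x. g x - h n x)) \<longlonglongrightarrow> 0"
      unfolding L2_norm_def using tendsto_real_sqrt[OF lim] by simp
    then have "eventually (\<lambda>n. L2_norm (\<lambda>x. g x - h n x) < e/2) sequentially"
      using e by (intro order_tendstoD) auto
    then obtain n where n: "L2_norm (\<lambda>x. g x - h n x) < e/2"
      unfolding eventually_sequentially by auto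
    obtain p where p: "trig_poly p" "L2_norm (\<lambda>x. h n x - p x) < e/2"
      using hn(2)[of n] e unfolding D_def by (meson half_gt_zero)
    have "L2_norm (\<lambda>x. g x - p x) < e"
      using L2_norm_diff_triangle[OF g hn(1)[of n] bounded_measurable_L2[OF
          bounded_measurable_trig_poly[OF p(1)]]] n p(2)
      by linarith
    then show "\<exists>p. trig_poly p \<and> L2_norm (\<lambda>x. g x - p x) < e" using p(1) by blast
  qed
  have bounded: "D \<phi>" if "bounded_measurable \<phi>" for \<phi>
    using that
  proof (induction rule: bounded_measurable_induct_characters)
    case (character k)
    have "L2_norm (\<lambda>x. character k x - character k x) = 0" by (simp add: L2_norm_def)
    then show ?case unfolding D_def using trig_poly.character by metis
  next
    case (scale c g)
    show ?case unfolding D_def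
    proof (intro allI impI)
      fix e :: real assume e: "e > 0"
      then have "e / (cmod c + 1) > 0" by (simp add: add_nonneg_pos)
      then obtain p where p: "trig_poly p" "L2_norm (\<lambda>x. g x - p x) < e / (cmod c + 1)"
        using scale(2) unfolding D_def by blast
      have "L2_norm (\<lambda>x. c * g x - c * p x) = cmod c * L2_norm (\<lambda>x. g x - p x)"
        unfolding L2_norm_scale[symmetric] by (simp add: right_diff_distrib)
      also have "\<dots> \<le> cmod c * (e / (cmod c + 1))"
        using p(2) by (intro mult_left_mono) auto
      also have "\<dots> < e"
        using e add_nonneg_pos[OF norm_ge_zero zero_less_one, of c]
        by (simp add: pos_divide_less_eq algebra_simps)
      finally show "\<exists>p. trig_poly p \<and> L2_norm (\<lambda>x. c * g x - p x) < e"
        using trig_poly.scale[OF p(1)] by blast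
    qed
  next
    case (add g h)
    show ?case unfolding D_def
    proof (intro allI impI)
      fix e :: real assume "e > 0"
      then have e: "e/2 > 0" by simp
      obtain p q where p: "trig_poly p" "L2_norm (\<lambda>x. g x - p x) < e/2"
        and q: "trig_poly q" "L2_norm (\<lambda>x. h x - q x) < e/2"
        using add(3,4) e unfolding D_def by meson
      have "L2_norm (\<lambda>x. (g x - p x) + (h x - q x)) \<le> L2_norm (\<lambda>x. g x - p x) + L2_norm (\<lambda>x. h x - q x)"
        by (intro L2_norm_triangle L2_diff bounded_measurable_L2 bounded_measurable_trig_poly p q add)
      then have "L2_norm (\<lambda>x. (g x + h x) - (p x + q x)) < e"
        using p(2) q(2) by (simp add: algebra_simps)
      then show "\<exists>p. trig_poly p \<and> L2_norm (\<lambda>x. (g x + h x) - p x) < e"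
        using trig_poly.add[OF p(1) q(1)] by blast
    qed
  next
    case (lim g h C)
    have bg: "bounded_measurable (g n)" for n
      using lim(1,2) unfolding bounded_measurable_def by blast
    have bh: "bounded_measurable h"
      by (rule bounded_measurable_lim[of g C]) (use lim in auto)
    have hC: "cmod (h x) \<le> C" if "x \<in> {0..<2*pi}" for x
    proof (rule LIMSEQ_le_const2[OF tendsto_norm])
      show "(\<lambda>n. g n x) \<longlonglongrightarrow> h x" using lim(4) that by simp
      show "\<exists>N. \<forall>n\<ge>N. cmod (g n x) \<le> C" using lim(2) that by blast
    qed
    show ?case
    proof (rule closed[of h g])
      have "(\<lambda>n. \<integral>x. (cmod (h x - g n x))\<^sup>2 \<partial>circle) \<longlonglongrightarrow> (\<integral>x. 0 \<partial>circle)"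
      proof (rule integral_dominated_convergence[where w = "\<lambda>_. (2*C)\<^sup>2"])
        show "(\<lambda>x. (cmod (h x - g n x))\<^sup>2) \<in> borel_measurable circle" for n
          by (rule borel_measurable_integrable[OF L2_integrable[OF L2_diff[OF
              bounded_measurable_L2[OF bh] bounded_measurable_L2[OF bg]]]])
        show "AE x in circle. (\<lambda>n. (cmod (h x - g n x))\<^sup>2) \<longlonglongrightarrow> 0"
        proof (rule AE_I2)
          fix x assume "x \<in> space circle"
          then have "(\<lambda>n. g n x) \<longlonglongrightarrow> h x" using lim(4) by simp
          then have "(\<lambda>n. (cmod (h x - g n x))\<^sup>2) \<longlonglongrightarrow> (cmod (h x - h x))\<^sup>2"
            by (intro tendsto_intros)
          then show "(\<lambda>n. (cmod (h x - g n x))\<^sup>2) \<longlonglongrightarrow> 0" by simp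
        qed
        show "AE x in circle. norm ((cmod (h x - g n x))\<^sup>2) \<le> (2*C)\<^sup>2" for n
        proof (rule AE_I2)
          fix x assume "x \<in> space circle"
          then have "cmod (g n x) \<le> C" "cmod (h x) \<le> C" using lim(2) hC by auto
          then have "cmod (h x - g n x) \<le> 2 * C"
            using norm_triangle_ineq4[of "h x" "g n x"] by linarith
          then show "norm ((cmod (h x - g n x))\<^sup>2) \<le> (2*C)\<^sup>2" using power_mono[OF _ norm_ge_zero,
              of "h x - g n x" "2 * C" 2] by simp
        qed
      qed auto
      then show "(\<lambda>n. \<integral>x. (cmod (h x - g n x))\<^sup>2 \<partial>circle) \<longlonglongrightarrow> 0" by simp
    qed (use bg bh bounded_measurable_L2 lim(5) in auto)
  qed
  note [measurable] = L2_measurable[OF f]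
  define h where "h n x = f x * of_real (indicator {y \<in> space circle. cmod (f y) \<le> real n} x)" for
      n :: nat and x
  have hm: "h n \<in> borel_measurable circle" for n
    unfolding h_def by measurable
  have hb: "cmod (h n x) \<le> real n" if "x \<in> {0..<2*pi}" for n x
    using that by (auto simp: h_def indicator_def)
  have bh: "bounded_measurable (h n)" for n
    using hm hb unfolding bounded_measurable_def by blast
  have "D f"
  proof (rule closed[of f h])
    have "(\<lambda>n. \<integral>x. (cmod (f x - h n x))\<^sup>2 \<partial>circle) \<longlonglongrightarrow> (\<integral>x. 0 \<partial>circle)"
    proof (rule integral_dominated_convergence[where w = "\<lambda>x. (cmod (f x))\<^sup>2"])
      show "(\<lambda>x. (cmod (f x - h n x))\<^sup>2) \<in> borel_measurable circle" for n
        by (rule borel_measurable_integrable[OF L2_integrable[OF L2_diff[OF f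
            bounded_measurable_L2[OF bh]]]])
      show "AE x in circle. (\<lambda>n. (cmod (f x - h n x))\<^sup>2) \<longlonglongrightarrow> 0"
      proof (rule AE_I2)
        fix x assume x: "x \<in> space circle"
        obtain N where N: "cmod (f x) \<le> real N" using real_arch_simple by blast
        have "(cmod (f x - h n x))\<^sup>2 = 0" if "n \<ge> N" for n
          using that N x by (simp add: h_def indicator_def)
        then show "(\<lambda>n. (cmod (f x - h n x))\<^sup>2) \<longlonglongrightarrow> 0"
          by (intro tendsto_eventually eventually_sequentiallyI[of N])
      qed
      show "AE x in circle. norm ((cmod (f x - h n x))\<^sup>2) \<le> (cmod (f x))\<^sup>2" for n
        by (rule AE_I2) (simp add: h_def indicator_def)
    qed (auto intro: L2_integrable f)
    then show "(\<lambda>n. \<integral>x. (cmod (f x - h n x))\<^sup>2 \<partial>circle) \<longlonglongrightarrow> 0" by simp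
  qed (use f bh bounded bounded_measurable_L2 in auto)
  then show ?thesis using \<open>e > 0\<close> unfolding D_def by blast
qed

lemma trig_poly_eq_sum:
  assumes "trig_poly p"
  shows "\<exists>S c. finite S \<and> p = (\<lambda>x. \<Sum>k\<in>S. c k * character k x)"
  using assms
proof induction
  case (character k)
  show ?case by (intro exI[of _ "{k}"] exI[of _ "\<lambda>_. 1"]) simp
next
  case (scale f c)
  then obtain S d where "finite S" "f = (\<lambda>x. \<Sum>k\<in>S. d k * character k x)" by blast
  then show ?case
    by (intro exI[of _ S] exI[of _ "\<lambda>k. c * d k"]) (simp add: sum_distrib_left mult.assoc)
next
  case (add f g)
  then obtain S d T e where S: "finite S" "f = (\<lambda>x. \<Sum>k\<in>S. d k * character k x)"
    and T: "finite T" "g = (\<lambda>x. \<Sum>k\<in>T. e k * character k x)" by blast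
  define c where "c k = (if k \<in> S then d k else 0) + (if k \<in> T then e k else 0)" for k
  have "f x + g x = (\<Sum>k\<in>S \<union> T. c k * character k x)" for x
  proof -
    have "f x = (\<Sum>k\<in>S \<union> T. (if k \<in> S then d k else 0) * character k x)"
      unfolding S(2) by (rule sum.mono_neutral_cong_left) (use S T in auto)
    moreover have "g x = (\<Sum>k\<in>S \<union> T. (if k \<in> T then e k else 0) * character k x)"
      unfolding T(2) by (rule sum.mono_neutral_cong_left) (use S T in auto)
    ultimately show ?thesis
      by (simp add: c_def distrib_right sum.distrib)
  qed
  then show ?case using S(1) T(1) by (intro exI[of _ "S \<union> T"] exI[of _ c]) auto
qed

section \<open>Matrices dominated by a summable function of the diagonal\<close>

lemma summable_on_int_shift:
  fixes a :: "int \<Rightarrow> 'b :: banach"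
  shows "(\<lambda>i. a (i + t)) summable_on UNIV \<longleftrightarrow> a summable_on UNIV"
    and "(\<Sum>\<^sub>\<infinity>i. a (i + t)) = (\<Sum>\<^sub>\<infinity>i. a i)"
    and "(\<lambda>i. a (t - i)) summable_on UNIV \<longleftrightarrow> a summable_on UNIV"
    and "(\<Sum>\<^sub>\<infinity>i. a (t - i)) = (\<Sum>\<^sub>\<infinity>i. a i)"
proof -
  have 1: "bij_betw (\<lambda>i. i + t) (UNIV :: int set) UNIV"
    by (rule bij_betw_byWitness[where f' = "\<lambda>i. i - t"]) auto
  have 2: "bij_betw (\<lambda>i. t - i) (UNIV :: int set) UNIV"
    by (rule bij_betw_byWitness[where f' = "\<lambda>i. t - i"]) auto
  show "(\<lambda>i. a (i + t)) summable_on UNIV \<longleftrightarrow> a summable_on UNIV"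
    by (rule summable_on_reindex_bij_betw[OF 1])
  show "(\<Sum>\<^sub>\<infinity>i. a (i + t)) = (\<Sum>\<^sub>\<infinity>i. a i)"
    by (rule infsum_reindex_bij_betw[OF 1])
  show "(\<lambda>i. a (t - i)) summable_on UNIV \<longleftrightarrow> a summable_on UNIV"
    by (rule summable_on_reindex_bij_betw[OF 2])
  show "(\<Sum>\<^sub>\<infinity>i. a (t - i)) = (\<Sum>\<^sub>\<infinity>i. a i)"
    by (rule infsum_reindex_bij_betw[OF 2])
qed

text \<open>
  The source of all summability over diagonals: correlations of summable sequences are summable.
\<close>

lemma summable_convolution:
  fixes a b :: "int \<Rightarrow> real"
  assumes a: "a summable_on UNIV" "\<And>i. 0 \<le> a i" and b: "b summable_on UNIV" "\<And>i. 0 \<le> b i"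
  shows "(\<lambda>i. a (i + t) * b i) summable_on UNIV"
    and "(\<lambda>t. \<Sum>\<^sub>\<infinity>i. a (i + t) * b i) summable_on UNIV"
proof -
  have "(\<lambda>(i,t). a (i + t) * b i) summable_on UNIV \<times> UNIV"
  proof (rule summable_on_SigmaI)
    show "((\<lambda>t. case (i, t) of (i, t) \<Rightarrow> a (i + t) * b i) has_sum (\<Sum>\<^sub>\<infinity>j. a j) * b i) UNIV" for i
    proof -
      have "((\<lambda>t. a (t + i)) has_sum (\<Sum>\<^sub>\<infinity>j. a j)) UNIV"
        using has_sum_infsum[of "\<lambda>t. a (t + i)" UNIV] a(1) by (simp add: summable_on_int_shift)
      from has_sum_cmult_left[OF this, of "b i"] show ?thesis by (simp add: add.commute)
    qed
    show "(\<lambda>i. (\<Sum>\<^sub>\<infinity>j. a j) * b i) summable_on UNIV"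
      by (rule summable_on_cmult_right[OF b(1)])
  qed (use a b in auto)
  then have s: "(\<lambda>(t,i). a (i + t) * b i) summable_on UNIV \<times> UNIV"
    using summable_on_swap[of "\<lambda>(i,t). a (i + t) * b i" UNIV UNIV] by simp
  then show 1: "(\<lambda>i. a (i + t) * b i) summable_on UNIV" for t
    using summable_on_SigmaD1[of "\<lambda>t i. a (i + t) * b i" UNIV "\<lambda>_. UNIV" t] by simp
  show "(\<lambda>t. \<Sum>\<^sub>\<infinity>i. a (i + t) * b i) summable_on UNIV"
    using summable_on_SigmaD[OF s] 1 by simp
qed

text \<open>
  A window is given by its start and its length because uniformity in the start is what regularity
  provides.
\<close>

definition window_mean :: "nat \<Rightarrow> int \<Rightarrow> (int \<Rightarrow> complex) \<Rightarrow> complex" where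
  "window_mean L j f = (\<Sum>s<L. f (j + int s)) / of_nat L"

lemma norm_window_mean_le:
  assumes "\<And>s. cmod (f s) \<le> B" shows "cmod (window_mean L j f) \<le> B"
proof (cases "L = 0")
  case True
  then show ?thesis using assms[of 0] norm_ge_zero[of "f 0"] by (simp add: window_mean_def del:
      norm_ge_zero)
next
  case False
  have "cmod (\<Sum>s<L. f (j + int s)) \<le> (\<Sum>s<L. B)" by (intro sum_norm_le assms)
  then show ?thesis using False by (simp add: window_mean_def norm_divide pos_divide_le_eq mult.commute)
qed

text \<open>
  Moving a window by one step replaces only its two end terms.
\<close>

lemma sum_window_shift:
  fixes f :: "int \<Rightarrow> complex"
  assumes f: "\<And>s. cmod (f s) \<le> B"
  shows "cmod ((\<Sum>s<L. f (j + int s + i)) - (\<Sum>s<L. f (j + int s))) \<le> 2 * B * \<bar>of_int i\<bar>"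
proof -
  have step: "cmod ((\<Sum>s<L. g (j + int s + 1)) - (\<Sum>s<L. g (j + int s))) \<le> 2 * B"
    if g: "\<And>s. cmod (g s) \<le> B" for g :: "int \<Rightarrow> complex"
  proof -
    have "(\<Sum>s<L. g (j + int s + 1)) - (\<Sum>s<L. g (j + int s)) = g (j + int L) - g j"
    proof -
      have "j + int s + 1 = j + int (Suc s)" for s by simp
      then show ?thesis
        using sum_lessThan_telescope[of "\<lambda>s. g (j + int s)" L]
        by (simp only: sum_subtractf) simp
    qed
    also have "cmod \<dots> \<le> 2 * B"
      using norm_triangle_ineq4[of "g (j + int L)" "g j"] g[of "j + int L"] g[of j] by linarith
    finally show ?thesis .
  qed
  have pos: "cmod ((\<Sum>s<L. g (j + int s + int n)) - (\<Sum>s<L. g (j + int s))) \<le> 2 * B * n"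
    if g: "\<And>s. cmod (g s) \<le> B" for g :: "int \<Rightarrow> complex" and n
  proof (induction n)
    case (Suc n)
    have "cmod ((\<Sum>s<L. g (j + int s + 1 + int n)) - (\<Sum>s<L. g (j + int s + int n))) \<le> 2 * B"
      by (rule step[of "\<lambda>s. g (s + int n)"]) (rule g)
    then have "cmod (((\<Sum>s<L. g (j + int s + 1 + int n)) - (\<Sum>s<L. g (j + int s + int n))) +
      ((\<Sum>s<L. g (j + int s + int n)) - (\<Sum>s<L. g (j + int s)))) \<le> 2 * B + 2 * B * n"
      by (intro norm_triangle_mono Suc)
    then show ?case by (simp add: algebra_simps)
  qed simp
  show ?thesis
  proof (cases "i \<ge> 0")
    case True
    then show ?thesis using pos[of f "nat i"] f by simp
  next
    case False
    then show ?thesis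
      using pos[of "\<lambda>s. f (s + i)" "nat (- i)"] f by (simp add: norm_minus_commute)
  qed
qed

lemma window_mean_shift:
  assumes f: "\<And>s. cmod (f s) \<le> B"
  shows "cmod (window_mean L j (\<lambda>s. f (s + i)) - window_mean L j f) \<le> min (2 * B) (2 * B * \<bar>of_int
      i\<bar> / real L)"
proof -
  have "cmod (window_mean L j (\<lambda>s. f (s + i)) - window_mean L j f) \<le> B + B"
    using norm_triangle_ineq4[of "window_mean L j (\<lambda>s. f (s + i))" "window_mean L j f"]
      norm_window_mean_le[of "\<lambda>s. f (s + i)" B L j] norm_window_mean_le[of f B L j] f
    by fastforce
  moreover have "cmod (window_mean L j (\<lambda>s. f (s + i)) - window_mean L j f) \<le> 2 * B * \<bar>of_int i\<bar> /
      real L"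
    using divide_right_mono[OF sum_window_shift[of f B j i L, OF f], of "real L"]
    by (simp add: window_mean_def diff_divide_distrib[symmetric] norm_divide)
  ultimately show ?thesis by simp
qed

lemma has_sum_finite_sum:
  fixes f :: "'s \<Rightarrow> 'i \<Rightarrow> 'b :: topological_comm_monoid_add"
  assumes "finite S" "\<And>s. s \<in> S \<Longrightarrow> (f s has_sum a s) A"
  shows "((\<lambda>i. \<Sum>s\<in>S. f s i) has_sum (\<Sum>s\<in>S. a s)) A"
  using assms by (induction S) (auto intro!: has_sum_add)

lemma infsum_diff:
  fixes f g :: "'i \<Rightarrow> 'b :: real_normed_vector"
  assumes "f summable_on A" "g summable_on A"
  shows "(\<Sum>\<^sub>\<infinity>i\<in>A. f i - g i) = infsum f A - infsum g A"
  using infsum_add[OF assms(1) summable_on_uminus[THEN iffD2, OF assms(2)]]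
  by (simp add: infsum_uminus)

lemma norm_min_le: "0 \<le> a \<Longrightarrow> 0 \<le> b \<Longrightarrow> norm (min a b) \<le> (a :: real)"
  by simp

lemma window_mean_infsum:
  fixes T :: "int \<Rightarrow> int \<Rightarrow> complex"
  assumes "\<And>s. (\<lambda>i. T i s) summable_on UNIV"
  shows "window_mean L j (\<lambda>s. \<Sum>\<^sub>\<infinity>i. T i s) = (\<Sum>\<^sub>\<infinity>i. window_mean L j (T i))"
    and "(\<lambda>i. window_mean L j (T i)) summable_on UNIV"
proof -
  have "((\<lambda>i. \<Sum>s<L. T i (j + int s)) has_sum (\<Sum>s<L. \<Sum>\<^sub>\<infinity>i. T i (j + int s))) UNIV"
    by (intro has_sum_finite_sum has_sum_infsum assms) auto
  from has_sum_cmult_left[OF this, of "1 / of_nat L"]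
  have "((\<lambda>i. window_mean L j (T i)) has_sum window_mean L j (\<lambda>s. \<Sum>\<^sub>\<infinity>i. T i s)) UNIV"
    by (simp add: window_mean_def)
  then show "window_mean L j (\<lambda>s. \<Sum>\<^sub>\<infinity>i. T i s) = (\<Sum>\<^sub>\<infinity>i. window_mean L j (T i))"
    "(\<lambda>i. window_mean L j (T i)) summable_on UNIV"
    by (auto simp: infsumI intro: has_sum_imp_summable)
qed

locale dominated_matrix =
  fixes w :: "int \<Rightarrow> int \<Rightarrow> complex" and c :: "int \<Rightarrow> real"
  assumes entry_le: "cmod (w l j) \<le> c (l - j)"
    and c_summable: "c summable_on UNIV"
begin

definition row_corr :: "int \<Rightarrow> int \<Rightarrow> int \<Rightarrow> complex" where
  "row_corr m n l = (\<Sum>\<^sub>\<infinity>j. w (l + m) j * cnj (w l (j + n)))"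

definition col_corr :: "int \<Rightarrow> int \<Rightarrow> int \<Rightarrow> complex" where
  "col_corr m n j = (\<Sum>\<^sub>\<infinity>l. w (l + m) j * cnj (w l (j + n)))"

definition corr_bound :: "int \<Rightarrow> real" where
  "corr_bound t = (\<Sum>\<^sub>\<infinity>i. c (i + t) * c i)"

text \<open>
  The product that \<open>row_corr m n s\<close> sums, indexed by the distance \<open>i\<close> of the first factor's column
  from the row \<open>s\<close>. It is dominated by a summable function of \<open>i\<close> alone.
\<close>

definition diag_corr :: "int \<Rightarrow> int \<Rightarrow> int \<Rightarrow> int \<Rightarrow> complex" where
  "diag_corr m n i s = w (s + m) (s - i) * cnj (w s (s - i + n))"

lemma c_nonneg: "0 \<le> c i"
  using order_trans[OF norm_ge_zero entry_le[of i 0]] by simp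

lemma corr_bound_summable: "corr_bound summable_on UNIV"
  using summable_convolution(2)[OF c_summable c_nonneg c_summable c_nonneg]
  by (simp add: corr_bound_def[abs_def])

lemma diag_corr_le: "cmod (diag_corr m n i s) \<le> c (i + m) * c (i - n)"
  unfolding diag_corr_def norm_mult complex_mod_cnj
  using entry_le[of "s + m" "s - i"] entry_le[of s "s - i + n"]
  by (intro mult_mono) (auto simp: c_nonneg algebra_simps)

lemma diag_bound_has_sum: "((\<lambda>i. c (i + m) * c (i - n)) has_sum corr_bound (m + n)) UNIV"
proof -
  have "((\<lambda>i. c (i + (m + n)) * c i) has_sum corr_bound (m + n)) UNIV"
    unfolding corr_bound_def
    by (intro has_sum_infsum summable_convolution c_summable c_nonneg)
  moreover have "bij_betw (\<lambda>i. i - n) (UNIV :: int set) UNIV"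
    by (rule bij_betw_byWitness[where f' = "\<lambda>i. i + n"]) auto
  ultimately have "((\<lambda>i. c (i - n + (m + n)) * c (i - n)) has_sum corr_bound (m + n)) UNIV"
    using has_sum_reindex_bij_betw[where f = "\<lambda>i. c (i + (m + n)) * c i" and g = "\<lambda>i. i - n"] by blast
  moreover have "i - n + (m + n) = i + m" for i by simp
  ultimately show ?thesis by simp
qed

lemmas diag_bound_summable = has_sum_imp_summable[OF diag_bound_has_sum]

lemma corr_bound_nonneg: "0 \<le> corr_bound t"
  unfolding corr_bound_def by (intro infsum_nonneg mult_nonneg_nonneg c_nonneg)

lemma diag_corr_summable: "(\<lambda>i. diag_corr m n i (s i)) summable_on UNIV"
  by (rule abs_summable_bounded(2)[OF diag_bound_summable diag_corr_le])

lemma norm_infsum_diag_corr_le: "cmod (\<Sum>\<^sub>\<infinity>i. diag_corr m n i (s i)) \<le> corr_bound (m + n)"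
  by (rule order_trans[OF abs_summable_bounded(3)[OF diag_bound_summable diag_corr_le]])
     (simp add: infsumI[OF diag_bound_has_sum])

lemma row_corr_diag: "row_corr m n l = (\<Sum>\<^sub>\<infinity>i. diag_corr m n i l)"
  using summable_on_int_shift(4)[of "\<lambda>j. w (l + m) j * cnj (w l (j + n))" l]
  by (simp add: row_corr_def diag_corr_def)

lemma col_corr_diag: "col_corr m n j = (\<Sum>\<^sub>\<infinity>i. diag_corr m n i (j + i))"
  using summable_on_int_shift(2)[of "\<lambda>l. w (l + m) j * cnj (w l (j + n))" j]
  by (simp add: col_corr_def diag_corr_def add.commute)

lemma row_corr_le: "cmod (row_corr m n l) \<le> corr_bound (m + n)"
  unfolding row_corr_diag by (rule norm_infsum_diag_corr_le)

lemma col_corr_le: "cmod (col_corr m n j) \<le> corr_bound (m + n)"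
  unfolding col_corr_diag by (rule norm_infsum_diag_corr_le)

definition shift_bound :: "int \<Rightarrow> int \<Rightarrow> nat \<Rightarrow> int \<Rightarrow> real" where
  "shift_bound m n L i =
     min (2 * (c (i + m) * c (i - n))) (2 * (c (i + m) * c (i - n)) * \<bar>of_int i\<bar> / real L)"

lemma norm_shift_bound_le: "norm (shift_bound m n L i) \<le> 2 * (c (i + m) * c (i - n))"
  unfolding shift_bound_def
  by (intro norm_min_le mult_nonneg_nonneg divide_nonneg_nonneg c_nonneg) simp_all

text \<open>
  Summing the same products over a window of columns or over a window of rows differs, on each
  diagonal \<open>i\<close>, only by a shift of the window by \<open>i\<close>.
\<close>

lemma window_mean_row_col_diff:
  "cmod (window_mean L j (col_corr m n) - window_mean L j (row_corr m n)) \<le>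
     (\<Sum>\<^sub>\<infinity>i. shift_bound m n L i)"
proof -
  have "window_mean L j (col_corr m n) - window_mean L j (row_corr m n) =
     (\<Sum>\<^sub>\<infinity>i. window_mean L j (\<lambda>s. diag_corr m n i (s + i)) - window_mean L j (diag_corr m n i))"
    unfolding col_corr_diag[abs_def] row_corr_diag[abs_def]
    by (simp add: window_mean_infsum diag_corr_summable infsum_diff)
  then show ?thesis
  proof (simp only:, intro abs_summable_bounded(3))
    show "shift_bound m n L summable_on UNIV"
      by (rule abs_summable_bounded(2)[OF summable_on_cmult_right[OF diag_bound_summable[of m n],
          of 2] norm_shift_bound_le])
    show "cmod (window_mean L j (\<lambda>s. diag_corr m n i (s + i)) - window_mean L j (diag_corr m n i))
        \<le> shift_bound m n L i" for i
      unfolding shift_bound_def by (rule window_mean_shift[OF diag_corr_le])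
  qed
qed

text \<open>
  For fixed \<open>i\<close> a shift is negligible for long windows; the contributions of large \<open>i\<close> are small
  uniformly in the window.
\<close>

lemma row_col_diff_tendsto:
  "(\<lambda>L. \<Sum>\<^sub>\<infinity>i. shift_bound m n L i) \<longlonglongrightarrow> 0"
proof -
  have "(\<lambda>L. \<Sum>\<^sub>\<infinity>i. shift_bound m n L i) \<longlonglongrightarrow>
      (\<Sum>\<^sub>\<infinity>i::int. 0)"
  proof (rule infsum_dominated_convergence[OF summable_on_cmult_right[OF diag_bound_summable[of m
      n], of 2]])
    fix i
    have "(\<lambda>L. 2 * (c (i + m) * c (i - n)) * \<bar>of_int i\<bar> / real L) \<longlonglongrightarrow> 0"
      by (rule lim_const_over_n)
    then have "(\<lambda>L. shift_bound m n L i) \<longlonglongrightarrow> min (2 * (c (i + m) * c (i - n))) 0"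
      unfolding shift_bound_def by (intro tendsto_min tendsto_const)
    then show "(\<lambda>L. shift_bound m n L i) \<longlonglongrightarrow> 0"
      by (simp add: c_nonneg min_absorb2)
  qed (rule norm_shift_bound_le)
  then show ?thesis by simp
qed

end

text \<open>
  The uniformity in \<open>j\<close> encodes that the limits are taken over intervals at arbitrary position.
\<close>

locale regular_matrix = dominated_matrix +
  fixes \<omega> :: "int \<Rightarrow> int \<Rightarrow> complex"
  assumes row_mean_uniform:
    "\<And>m n e. e > 0 \<Longrightarrow> \<exists>L0. \<forall>L\<ge>L0. \<forall>j. cmod (window_mean L j (row_corr m n) - \<omega> m n) \<le> e"
begin

lemma omega_le: "cmod (\<omega> m n) \<le> corr_bound (m + n)"
proof (rule field_le_epsilon)
  fix e :: real assume "e > 0"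
  then obtain L where "cmod (window_mean L 0 (row_corr m n) - \<omega> m n) \<le> e"
    using row_mean_uniform by blast
  moreover have "cmod (window_mean L 0 (row_corr m n)) \<le> corr_bound (m + n)"
    by (intro norm_window_mean_le row_corr_le)
  moreover have "cmod (\<omega> m n) \<le> cmod (window_mean L 0 (row_corr m n)) + cmod (window_mean L 0
      (row_corr m n) - \<omega> m n)"
    by (metis norm_minus_commute norm_triangle_sub)
  ultimately show "cmod (\<omega> m n) \<le> corr_bound (m + n) + e" by linarith
qed

definition col_error :: "nat \<Rightarrow> int \<Rightarrow> int \<Rightarrow> real" where
  "col_error L m n = (SUP j. cmod (window_mean L j (col_corr m n) - \<omega> m n))"

lemma col_error_le: "cmod (window_mean L j (col_corr m n) - \<omega> m n) \<le> 2 * corr_bound (m + n)"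
  using norm_triangle_ineq4[of "window_mean L j (col_corr m n)" "\<omega> m n"] omega_le[of m n]
    norm_window_mean_le[of "col_corr m n" "corr_bound (m + n)" L j, OF col_corr_le] by linarith

lemma col_error_upper: "cmod (window_mean L j (col_corr m n) - \<omega> m n) \<le> col_error L m n"
  unfolding col_error_def
  by (rule cSUP_upper) (auto intro!: bdd_aboveI2 col_error_le)

lemma col_error_bound: "0 \<le> col_error L m n" "col_error L m n \<le> 2 * corr_bound (m + n)"
proof -
  show "0 \<le> col_error L m n"
    by (rule order_trans[OF norm_ge_zero col_error_upper[of L 0 m n]])
  show "col_error L m n \<le> 2 * corr_bound (m + n)"
    unfolding col_error_def by (rule cSUP_least) (auto intro: col_error_le)
qed

lemma col_error_tendsto: "(\<lambda>L. col_error L m n) \<longlonglongrightarrow> 0"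
proof (rule LIMSEQ_I)
  fix e :: real assume e: "e > 0"
  obtain L1 where L1: "\<And>L j. L \<ge> L1 \<Longrightarrow> cmod (window_mean L j (row_corr m n) - \<omega> m n) \<le> e/3"
    using row_mean_uniform[of "e/3" m n] e by auto
  define E where "E L = (\<Sum>\<^sub>\<infinity>i. shift_bound m n L i)" for L
  have "E \<longlonglongrightarrow> 0" unfolding E_def by (rule row_col_diff_tendsto)
  then have "eventually (\<lambda>L. E L < e/3) sequentially"
    using e by (intro order_tendstoD(2)) auto
  then obtain L2 where L2: "\<And>L. L \<ge> L2 \<Longrightarrow> E L < e/3"
    unfolding eventually_sequentially by blast
  have "norm (col_error L m n - 0) < e" if L: "L \<ge> max L1 L2" for L
  proof -
    have "col_error L m n \<le> 2 * e / 3"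
      unfolding col_error_def
    proof (rule cSUP_least)
      fix j
      have "cmod (window_mean L j (col_corr m n) - window_mean L j (row_corr m n)) \<le> E L"
        unfolding E_def by (rule window_mean_row_col_diff)
      then show "cmod (window_mean L j (col_corr m n) - \<omega> m n) \<le> 2 * e / 3"
        using norm_triangle_ineq[of "window_mean L j (col_corr m n) - window_mean L j (row_corr m n)"
            "window_mean L j (row_corr m n) - \<omega> m n"] L1[of L j] L2[of L] L by simp
    qed simp
    then show ?thesis using col_error_bound(1)[of L m n] e by simp
  qed
  then show "\<exists>no. \<forall>n'\<ge>no. norm (col_error n' m n - 0) < e" by blast
qed

text \<open>
  The error on the \<open>n\<close>-th diagonal of the weighted Gram matrix is at most \<open>b n\<close>, and it is the sum
  of the \<open>b n\<close>, not only each of them, that becomes small. This is the form Schur's test consumes.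
  Tannery's theorem is applied twice, for the weight index \<open>m\<close> and for the diagonal \<open>n\<close>, with the
  convolution of \<open>|\<gamma>|\<close> and the correlation bound as majorant.
\<close>

lemma weighted_col_means:
  fixes \<gamma> :: "int \<Rightarrow> complex"
  assumes \<gamma>: "abs_summable \<gamma>" and e: "e > 0"
  obtains L b where "L > 0" "b summable_on UNIV" "(\<Sum>\<^sub>\<infinity>n. b n) \<le> e" "\<And>n. 0 \<le> b n"
    "\<And>j n. cmod (window_mean L j (\<lambda>s. \<Sum>\<^sub>\<infinity>m. \<gamma> m * col_corr m n s) - (\<Sum>\<^sub>\<infinity>m. \<gamma> m * \<omega> m n)) \<le> b n"
proof -
  have d\<gamma>: "(\<lambda>m. corr_bound (m + n) * cmod (\<gamma> m)) summable_on UNIV" for n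
    by (rule summable_convolution(1)[OF corr_bound_summable corr_bound_nonneg \<gamma>]) simp
  have d\<gamma>': "(\<lambda>n. \<Sum>\<^sub>\<infinity>m. corr_bound (m + n) * cmod (\<gamma> m)) summable_on UNIV"
    by (rule summable_convolution(2)[OF corr_bound_summable corr_bound_nonneg \<gamma>]) simp
  have le: "cmod (\<gamma> m) * col_error L m n \<le> 2 * (corr_bound (m + n) * cmod (\<gamma> m))" for m n L
    using mult_left_mono[OF col_error_bound(2)[of L m n], of "cmod (\<gamma> m)"] by (simp add: mult_ac)
  have ss: "(\<lambda>m. cmod (\<gamma> m) * col_error L m n) summable_on UNIV" for L n
    by (rule abs_summable_bounded(2)[OF summable_on_cmult_right[OF d\<gamma>[of n], of 2]])
       (use le col_error_bound in auto)
  define b where "b L n = (\<Sum>\<^sub>\<infinity>m. cmod (\<gamma> m) * col_error L m n)" for L n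
  have b0: "0 \<le> b L n" for L n
    unfolding b_def by (intro infsum_nonneg mult_nonneg_nonneg col_error_bound norm_ge_zero)
  have b_le: "b L n \<le> 2 * (\<Sum>\<^sub>\<infinity>m. corr_bound (m + n) * cmod (\<gamma> m))" for L n
    unfolding b_def using infsum_mono[OF ss[of L n] summable_on_cmult_right[OF d\<gamma>[of n], of 2] le]
    by (simp add: infsum_cmult_right d\<gamma>)
  have blim: "(\<lambda>L. b L n) \<longlonglongrightarrow> 0" for n
  proof -
    have "(\<lambda>L. b L n) \<longlonglongrightarrow> (\<Sum>\<^sub>\<infinity>m::int. 0)"
      unfolding b_def
    proof (rule infsum_dominated_convergence[OF summable_on_cmult_right[OF d\<gamma>[of n], of 2]])
      show "norm (cmod (\<gamma> m) * col_error L m n) \<le> 2 * (corr_bound (m + n) * cmod (\<gamma> m))" for L m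
        using le[of m L n] col_error_bound(1)[of L m n] by simp
      show "(\<lambda>L. cmod (\<gamma> m) * col_error L m n) \<longlonglongrightarrow> 0" for m
        using tendsto_mult[OF tendsto_const col_error_tendsto, of "cmod (\<gamma> m)"] by simp
    qed
    then show ?thesis by simp
  qed
  have "(\<lambda>L. \<Sum>\<^sub>\<infinity>n. b L n) \<longlonglongrightarrow> (\<Sum>\<^sub>\<infinity>n::int. 0)"
  proof (rule infsum_dominated_convergence[OF summable_on_cmult_right[OF d\<gamma>', of 2] _ blim])
    show "norm (b L n) \<le> 2 * (\<Sum>\<^sub>\<infinity>m. corr_bound (m + n) * cmod (\<gamma> m))" for L n
      using b_le b0 by simp
  qed
  then have "eventually (\<lambda>L. (\<Sum>\<^sub>\<infinity>n. b L n) < e) sequentially"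
    using e by (intro order_tendstoD(2)) auto
  then obtain L0 where L0: "\<And>L. L \<ge> L0 \<Longrightarrow> (\<Sum>\<^sub>\<infinity>n. b L n) < e"
    unfolding eventually_sequentially by blast
  define L where "L = Suc L0"
  show thesis
  proof (rule that)
    show "L > 0" by (simp add: L_def)
    show "b L summable_on UNIV"
      by (rule abs_summable_bounded(2)[OF summable_on_cmult_right[OF d\<gamma>', of 2]]) (use b_le b0 in auto)
    show "(\<Sum>\<^sub>\<infinity>n. b L n) \<le> e" using L0[of L] by (simp add: L_def)
    show "0 \<le> b L n" for n by (rule b0)
    fix j n
    have s1: "(\<lambda>m. \<gamma> m * col_corr m n s) summable_on UNIV" for s
      by (rule abs_summable_bounded(2)[OF d\<gamma>[of n]])
         (auto simp: norm_mult mult.commute intro!: mult_left_mono col_corr_le)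
    have s2: "(\<lambda>m. \<gamma> m * \<omega> m n) summable_on UNIV"
      by (rule abs_summable_bounded(2)[OF d\<gamma>[of n]])
         (auto simp: norm_mult mult.commute intro!: mult_left_mono omega_le)
    have wm: "window_mean L j (\<lambda>s. \<gamma> m * col_corr m n s) = \<gamma> m * window_mean L j (col_corr m n)" for m
      by (simp add: window_mean_def sum_distrib_left)
    have "window_mean L j (\<lambda>s. \<Sum>\<^sub>\<infinity>m. \<gamma> m * col_corr m n s) - (\<Sum>\<^sub>\<infinity>m. \<gamma> m * \<omega> m n) =
        (\<Sum>\<^sub>\<infinity>m. \<gamma> m * (window_mean L j (col_corr m n) - \<omega> m n))"
      using window_mean_infsum(2)[of "\<lambda>m s. \<gamma> m * col_corr m n s" L j, OF s1] s2
      by (simp add: window_mean_infsum(1)[OF s1] wm right_diff_distrib infsum_diff)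
    also have "cmod \<dots> \<le> (\<Sum>\<^sub>\<infinity>m. cmod (\<gamma> m) * col_error L m n)"
      by (rule abs_summable_bounded(3)[OF ss])
         (auto simp: norm_mult intro!: mult_left_mono col_error_upper)
    finally show "cmod (window_mean L j (\<lambda>s. \<Sum>\<^sub>\<infinity>m. \<gamma> m * col_corr m n s) - (\<Sum>\<^sub>\<infinity>m. \<gamma> m * \<omega> m n)) \<le> b L n"
      unfolding b_def .
  qed
qed

lemma summable_weighted_omega:
  fixes \<gamma> :: "int \<Rightarrow> complex"
  assumes \<gamma>: "abs_summable \<gamma>"
  shows "abs_summable (\<lambda>n. \<Sum>\<^sub>\<infinity>m. \<gamma> m * \<omega> m n)"
proof -
  have d\<gamma>: "(\<lambda>m. corr_bound (m + n) * cmod (\<gamma> m)) summable_on UNIV" for n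
    by (rule summable_convolution(1)[OF corr_bound_summable corr_bound_nonneg \<gamma>]) simp
  have le: "cmod (\<gamma> m * \<omega> m n) \<le> corr_bound (m + n) * cmod (\<gamma> m)" for m n
    by (auto simp: norm_mult mult.commute intro!: mult_left_mono omega_le)
  show "abs_summable (\<lambda>n. \<Sum>\<^sub>\<infinity>m. \<gamma> m * \<omega> m n)"
    by (rule abs_summable_bounded(1)[OF summable_convolution(2)[OF corr_bound_summable
        corr_bound_nonneg \<gamma>]])
       (simp, rule abs_summable_bounded(3)[OF d\<gamma> le])
qed

lemma omega_marginals_summable: "abs_summable (\<lambda>m. \<omega> m 0)" "abs_summable (\<lambda>n. \<omega> 0 n)"
  using abs_summable_bounded(1)[OF corr_bound_summable, of "\<lambda>m. \<omega> m 0"]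
    abs_summable_bounded(1)[OF corr_bound_summable, of "\<lambda>n. \<omega> 0 n"]
    omega_le[of _ 0] omega_le[of 0] by simp_all

end

section \<open>Bounded operators\<close>

lemma L2_norm_eq_0_imp_AE:
  assumes "f \<in> L2" "L2_norm f = 0" shows "AE x in circle. f x = 0"
proof -
  have "(\<integral>x. (cmod (f x))\<^sup>2 \<partial>circle) = 0"
    using assms(2) by (simp add: L2_norm_def)
  then show ?thesis
    by (subst (asm) integral_nonneg_eq_0_iff_AE) (use L2_integrable[OF assms(1)] in auto)
qed

lemma
  assumes "bounded_operator A"
  shows bounded_operator_L2: "f \<in> L2 \<Longrightarrow> A f \<in> L2"
    and bounded_operator_add: "f \<in> L2 \<Longrightarrow> g \<in> L2 \<Longrightarrow> AE x in circle. A (\<lambda>y. f y + g y) x = A f x + A g x"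
    and bounded_operator_scale: "f \<in> L2 \<Longrightarrow> AE x in circle. A (\<lambda>y. c * f y) x = c * A f x"
    and bounded_operator_bound: "\<exists>B\<ge>0. \<forall>f\<in>L2. L2_norm (A f) \<le> B * L2_norm f"
proof -
  show "f \<in> L2 \<Longrightarrow> A f \<in> L2"
    "f \<in> L2 \<Longrightarrow> g \<in> L2 \<Longrightarrow> AE x in circle. A (\<lambda>y. f y + g y) x = A f x + A g x"
    "f \<in> L2 \<Longrightarrow> AE x in circle. A (\<lambda>y. c * f y) x = c * A f x"
    using assms unfolding bounded_operator_def by blast+
  obtain B where B: "\<forall>f\<in>L2. L2_norm (A f) \<le> B * L2_norm f"
    using assms unfolding bounded_operator_def by blast
  have "\<forall>f\<in>L2. L2_norm (A f) \<le> max 0 B * L2_norm f"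
    using B by (meson L2_norm_nonneg max.cobounded2 mult_right_mono order_trans)
  then show "\<exists>B\<ge>0. \<forall>f\<in>L2. L2_norm (A f) \<le> B * L2_norm f"
    by (meson max.cobounded1)
qed

lemma bounded_operator_diff:
  assumes A: "bounded_operator A" and f: "f \<in> L2" and g: "g \<in> L2"
  shows "AE x in circle. A (\<lambda>y. f y - g y) x = A f x - A g x"
  using bounded_operator_add[OF A L2_diff[OF f g] g]
  by eventually_elim (simp add: algebra_simps)

lemma bounded_operator_diff_norm:
  assumes A: "bounded_operator A" and f: "f \<in> L2" and g: "g \<in> L2"
    and B: "\<forall>f\<in>L2. L2_norm (A f) \<le> B * L2_norm f"
  shows "L2_norm (\<lambda>x. A f x - A g x) \<le> B * L2_norm (\<lambda>x. f x - g x)"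
proof -
  have "L2_norm (A (\<lambda>y. f y - g y)) = L2_norm (\<lambda>x. A f x - A g x)"
    by (rule L2_norm_cong_AE[OF _ _ bounded_operator_diff[OF A f g]])
       (intro bounded_operator_L2[OF A] L2_diff f g)+
  then show ?thesis using B L2_diff[OF f g] by metis
qed

text \<open>
  Operators act on representatives; linearity up to null sets together with boundedness makes them
  respect equality almost everywhere, as \<open>A (f - g)\<close> has norm zero.
\<close>

lemma bounded_operator_cong_AE:
  assumes A: "bounded_operator A" and f: "f \<in> L2" and g: "g \<in> L2" and eq: "AE x in circle. f x = g x"
  shows "AE x in circle. A f x = A g x"
proof -
  obtain B where B: "\<forall>f\<in>L2. L2_norm (A f) \<le> B * L2_norm f"
    using bounded_operator_bound[OF A] by blast
  have "L2_norm (\<lambda>x. f x - g x) = L2_norm (\<lambda>x. 0)"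
    by (rule L2_norm_cong_AE[OF L2_diff[OF f g]]) (use eq in \<open>auto simp: L2_def\<close>)
  then have "L2_norm (\<lambda>x. f x - g x) = 0" by (simp add: L2_norm_def)
  then have "L2_norm (\<lambda>x. A f x - A g x) \<le> 0"
    using bounded_operator_diff_norm[OF A f g B] by simp
  then have "L2_norm (\<lambda>x. A f x - A g x) = 0"
    using L2_norm_nonneg by (rule order_antisym)
  from L2_norm_eq_0_imp_AE[OF L2_diff[OF bounded_operator_L2[OF A f] bounded_operator_L2[OF A g]] this]
  show ?thesis by simp
qed

lemma bounded_operator_comp:
  assumes A: "bounded_operator A" and C: "bounded_operator C"
  shows "bounded_operator (A \<circ> C)"
  unfolding bounded_operator_def
proof (intro conjI ballI allI)
  fix f assume f: "f \<in> L2"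
  note Cf = bounded_operator_L2[OF C f]
  show "(A \<circ> C) f \<in> L2" using bounded_operator_L2[OF A Cf] by simp
  show "AE x in circle. (A \<circ> C) (\<lambda>y. c * f y) x = c * (A \<circ> C) f x" for c
    using bounded_operator_cong_AE[OF A bounded_operator_L2[OF C L2_scale[OF f]] L2_scale[OF Cf]
        bounded_operator_scale[OF C f], of c]
      bounded_operator_scale[OF A Cf, of c] by eventually_elim simp
  fix g assume g: "g \<in> L2"
  note Cg = bounded_operator_L2[OF C g]
  show "AE x in circle. (A \<circ> C) (\<lambda>y. f y + g y) x = (A \<circ> C) f x + (A \<circ> C) g x"
    using bounded_operator_cong_AE[OF A bounded_operator_L2[OF C L2_norm_triangle(1)[OF f g]]
        L2_norm_triangle(1)[OF Cf Cg] bounded_operator_add[OF C f g]]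
      bounded_operator_add[OF A Cf Cg] by eventually_elim simp
next
  obtain a b where a: "a \<ge> 0" "\<forall>f\<in>L2. L2_norm (A f) \<le> a * L2_norm f"
    and b: "\<forall>f\<in>L2. L2_norm (C f) \<le> b * L2_norm f"
    using bounded_operator_bound[OF A] bounded_operator_bound[OF C] by blast
  have "L2_norm ((A \<circ> C) f) \<le> (a * b) * L2_norm f" if f: "f \<in> L2" for f
  proof -
    have "L2_norm ((A \<circ> C) f) \<le> a * L2_norm (C f)"
      using a(2) bounded_operator_L2[OF C f] by simp
    also have "\<dots> \<le> a * (b * L2_norm f)"
      using b f a(1) by (intro mult_left_mono) auto
    finally show ?thesis by (simp add: mult.assoc)
  qed
  then show "\<exists>B. \<forall>f\<in>L2. L2_norm ((A \<circ> C) f) \<le> B * L2_norm f" by blast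
qed

lemma bounded_operator_mult:
  assumes "g \<in> Linfty" shows "bounded_operator (mult_op g)"
proof -
  obtain B where g: "g \<in> borel_measurable circle" and B: "AE x in circle. cmod (g x) \<le> B"
    using assms unfolding Linfty_def by blast
  show ?thesis
    unfolding bounded_operator_def mult_op_def
  proof (intro conjI ballI allI)
    show "\<exists>B. \<forall>f\<in>L2. L2_norm (\<lambda>x. g x * f x) \<le> B * L2_norm f"
      using L2_mult(2)[OF _ g B] by blast
  qed (use L2_mult(1)[OF _ g B] in \<open>auto simp: distrib_left mult_ac\<close>)
qed

lemma bounded_measurable_Linfty: "bounded_measurable g \<Longrightarrow> g \<in> Linfty"
proof -
  assume "bounded_measurable g"
  then obtain C where "g \<in> borel_measurable circle" and C: "\<forall>x\<in>{0..<2*pi}. cmod (g x) \<le> C"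
    unfolding bounded_measurable_def by blast
  moreover have "AE x in circle. cmod (g x) \<le> C"
    by (rule AE_I2) (use C in simp)
  ultimately show ?thesis unfolding Linfty_def by blast
qed

lemma bounded_operator_sum:
  assumes A: "bounded_operator A" and "finite S" and f: "\<And>k. k \<in> S \<Longrightarrow> f k \<in> L2"
  shows "(\<lambda>x. \<Sum>k\<in>S. c k * f k x) \<in> L2 \<and>
    (AE x in circle. A (\<lambda>x. \<Sum>k\<in>S. c k * f k x) x = (\<Sum>k\<in>S. c k * A (f k) x))"
  using assms(2) f
proof (induction S)
  case empty
  have z: "(\<lambda>_. 0) \<in> L2" by (simp add: L2_def)
  show ?case using bounded_operator_scale[OF A z, of 0] z by simp
next
  case (insert k S)
  then have IH: "(\<lambda>x. \<Sum>k\<in>S. c k * f k x) \<in> L2"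
    "AE x in circle. A (\<lambda>x. \<Sum>k\<in>S. c k * f k x) x = (\<Sum>k\<in>S. c k * A (f k) x)" and fk: "f k \<in> L2"
    by auto
  have "(\<lambda>x. c k * f k x + (\<Sum>k\<in>S. c k * f k x)) \<in> L2"
    by (rule L2_norm_triangle(1)[OF L2_scale[OF fk] IH(1)])
  moreover have "AE x in circle. A (\<lambda>x. c k * f k x + (\<Sum>k\<in>S. c k * f k x)) x = c k * A (f k) x +
      (\<Sum>k\<in>S. c k * A (f k) x)"
    using bounded_operator_add[OF A L2_scale[OF fk, of "c k"] IH(1)] bounded_operator_scale[OF A
        fk, of "c k"] IH(2)
    by eventually_elim simp
  ultimately show ?case by (simp only: sum.insert[OF insert(1,2)] simp_thms)
qed

lemma L2_norm_convergent:
  assumes "h \<in> L2" "\<And>n. p n \<in> L2" "(\<lambda>n. L2_norm (\<lambda>x. h x - p n x)) \<longlonglongrightarrow> 0" and A: "bounded_operator A"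
  shows "(\<lambda>n. L2_norm (A (p n))) \<longlonglongrightarrow> L2_norm (A h)"
proof -
  obtain B where B: "B \<ge> 0" "\<forall>f\<in>L2. L2_norm (A f) \<le> B * L2_norm f"
    using bounded_operator_bound[OF A] by blast
  have "norm (L2_norm (A (p n)) - L2_norm (A h)) \<le> L2_norm (\<lambda>x. h x - p n x) * B" for n
    using L2_norm_reverse_triangle[OF bounded_operator_L2[OF A assms(1)] bounded_operator_L2[OF A
        assms(2)[of n]]]
      bounded_operator_diff_norm[OF A assms(1) assms(2)[of n] B(2)]
    by (simp add: mult.commute abs_minus_commute)
  then have "(\<lambda>n. L2_norm (A (p n)) - L2_norm (A h)) \<longlonglongrightarrow> 0"
    by (intro tendsto_0_le[OF assms(3), of _ B]) (auto simp: L2_norm_nonneg)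
  then show ?thesis by (simp add: LIM_zero_iff)
qed

text \<open>
  A function of norm zero has no normalised multiple and is handled by boundedness.
\<close>

lemma operator_norm_upper:
  assumes A: "bounded_operator A" and f: "f \<in> L2"
  shows "L2_norm (A f) \<le> operator_norm A * L2_norm f" "0 \<le> operator_norm A"
proof -
  obtain B where B: "B \<ge> 0" "\<forall>f\<in>L2. L2_norm (A f) \<le> B * L2_norm f"
    using bounded_operator_bound[OF A] by blast
  have bdd: "bdd_above ((\<lambda>f. L2_norm (A f)) ` {f \<in> L2. L2_norm f \<le> 1})"
  proof (rule bdd_aboveI2[of _ _ B])
    fix h assume h: "h \<in> {f \<in> L2. L2_norm f \<le> 1}"
    then have "L2_norm (A h) \<le> B * L2_norm h" using B(2) by blast
    also have "\<dots> \<le> B * 1" using h B(1) by (intro mult_left_mono) auto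
    finally show "L2_norm (A h) \<le> B" by simp
  qed
  have up: "L2_norm (A h) \<le> operator_norm A" if "h \<in> L2" "L2_norm h \<le> 1" for h
    unfolding operator_norm_def by (rule cSUP_upper[OF _ bdd]) (use that in simp)
  have z: "(\<lambda>_. 0) \<in> L2" by (simp add: L2_def)
  show "0 \<le> operator_norm A"
    using order_trans[OF L2_norm_nonneg up[OF z]] by (simp add: L2_norm_def)
  show "L2_norm (A f) \<le> operator_norm A * L2_norm f"
  proof (cases "L2_norm f = 0")
    case True
    then show ?thesis using B(2) f by fastforce
  next
    case False
    define t where "t = complex_of_real (1 / L2_norm f)"
    have t: "cmod t = 1 / L2_norm f" unfolding t_def norm_of_real using L2_norm_nonneg[of f] by simp
    have "L2_norm (\<lambda>x. t * f x) = 1" using False by (simp add: L2_norm_scale t)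
    then have "L2_norm (A (\<lambda>x. t * f x)) \<le> operator_norm A"
      by (intro up L2_scale f) simp
    moreover have "L2_norm (A (\<lambda>x. t * f x)) = L2_norm (\<lambda>x. t * A f x)"
      by (rule L2_norm_cong_AE[OF _ _ bounded_operator_scale[OF A f]])
         (intro bounded_operator_L2[OF A] L2_scale f)+
    ultimately have "1 / L2_norm f * L2_norm (A f) \<le> operator_norm A"
      by (simp add: L2_norm_scale t)
    then show ?thesis using False L2_norm_nonneg[of f] by (simp add: field_simps)
  qed
qed

lemma operator_norm_least:
  assumes A: "\<And>f. f \<in> L2 \<Longrightarrow> (L2_norm (A f))\<^sup>2 \<le> M * (L2_norm f)\<^sup>2"
  shows "(operator_norm A)\<^sup>2 \<le> M"
proof -
  have one: "(\<lambda>_. 1) \<in> L2" "L2_norm (\<lambda>_. 1) = 1"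
    using circle.prob_space by (simp_all add: L2_def L2_norm_def)
  have M: "0 \<le> M" using order_trans[OF zero_le_power2 A[OF one(1)]] one(2) by simp
  have "L2_norm (A f) \<le> sqrt M" if f: "f \<in> L2" "L2_norm f \<le> 1" for f
  proof -
    have "(L2_norm f)\<^sup>2 \<le> 1" using f(2) L2_norm_nonneg[of f] by (simp add: power_le_one)
    then have "(L2_norm (A f))\<^sup>2 \<le> M"
      using order_trans[OF A[OF f(1)] mult_left_mono[OF _ M, of "(L2_norm f)\<^sup>2" 1]] by simp
    then show ?thesis by (rule real_le_rsqrt)
  qed
  then have "operator_norm A \<le> sqrt M"
    unfolding operator_norm_def by (intro cSUP_least) (use one in auto)
  moreover have "0 \<le> operator_norm A"
  proof -
    have "L2_norm (A (\<lambda>_. 1)) \<le> operator_norm A"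
      unfolding operator_norm_def
      by (rule cSUP_upper, use one in simp, rule bdd_aboveI2[of _ _ "sqrt M"]) 
         (use \<open>\<And>f. f \<in> L2 \<Longrightarrow> L2_norm f \<le> 1 \<Longrightarrow> L2_norm (A f) \<le> sqrt M\<close> in auto)
    then show ?thesis using L2_norm_nonneg order_trans by blast
  qed
  ultimately have "(operator_norm A)\<^sup>2 \<le> (sqrt M)\<^sup>2" by (rule power_mono)
  then show ?thesis using M by simp
qed

lemma L2_imp_integrable: "f \<in> L2 \<Longrightarrow> integrable circle f"
proof -
  assume f: "f \<in> L2"
  have "integrable circle (\<lambda>x. 1 + (cmod (f x))\<^sup>2)"
    by (intro Bochner_Integration.integrable_add L2_integrable[OF f]) simp
  then show ?thesis
  proof (rule Bochner_Integration.integrable_bound[OF _ L2_measurable[OF f]])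
    have "cmod z \<le> 1 + (cmod z)\<^sup>2" for z
      using zero_le_power2[of "cmod z - 1/2"] by (simp add: power2_eq_square algebra_simps)
    then show "AE x in circle. norm (f x) \<le> norm (1 + (cmod (f x))\<^sup>2)" by (simp add: abs_of_nonneg
        add_nonneg_nonneg)
  qed
qed

lemma character_L2: "character k \<in> L2"
  by (intro bounded_measurable_L2 bounded_measurable_trig_poly trig_poly.character)

text \<open>
  The coefficients of \<open>|g|\<^sup>2\<close> are autocorrelations of those of \<open>g\<close>, hence summable. This puts \<open>g1\<close> on
  the same footing as \<open>g2\<close>: both enter through the squares of their moduli.
\<close>

lemma ACF_abs_square:
  assumes "g \<in> ACF"
  shows "(\<lambda>x. complex_of_real ((cmod (g x))\<^sup>2)) \<in> ACF"
proof -
  define a where "a = fourier_coeff g"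
  have a: "abs_summable a" and eq: "AE x in circle. g x = fourier_series a x"
    using ACF_eq_fourier_series[OF assms] unfolding a_def by auto
  have gm: "g \<in> borel_measurable circle"
    using assms by (auto simp: ACF_def intro: borel_measurable_integrable)
  have bm: "bounded_measurable (fourier_series a)" by (rule bounded_measurable_fourier_series[OF a])
  have sm: "fourier_series a \<in> borel_measurable circle" using bm by (simp add: bounded_measurable_def)
  define G where "G x = complex_of_real ((cmod (g x))\<^sup>2)" for x
  have Gm: "G \<in> borel_measurable circle" unfolding G_def using gm by measurable
  have Hm: "(\<lambda>x. fourier_series a x * cnj (fourier_series a x)) \<in> borel_measurable circle"
    using sm by measurable
  have Geq: "AE x in circle. G x = fourier_series a x * cnj (fourier_series a x)"
    using eq by eventually_elim (simp only: G_def complex_norm_square)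
  have "integrable circle G"
  proof (rule circle.integrable_const_bound[OF _ Gm])
    show "AE x in circle. norm (G x) \<le> (\<Sum>\<^sub>\<infinity>k. cmod (a k))\<^sup>2"
      using eq by eventually_elim (auto simp: G_def norm_power intro!: power_mono
          norm_fourier_series_le[OF a])
  qed
  moreover have "fourier_coeff G k = (\<Sum>\<^sub>\<infinity>j. a j * cnj (a (j - k)))" for k
  proof -
    have "fourier_coeff G k = (\<integral>x. character (-k) x * (fourier_series a x * cnj (fourier_series a
        x)) \<partial>circle)"
      unfolding fourier_coeff_def cnj_character
    proof (rule integral_cong_AE)
      show "AE x in circle. G x * character (- k) x = character (- k) x * (fourier_series a x *
          cnj (fourier_series a x))"
        using Geq by eventually_elim simp
    qed (intro borel_measurable_times Gm Hm borel_measurable_circle character_measurable)+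
    then show ?thesis by (simp add: integral_fourier_series_cnj[OF a a])
  qed
  moreover have "abs_summable (\<lambda>k. \<Sum>\<^sub>\<infinity>j. a j * cnj (a (j - k)))"
  proof (rule abs_summable_bounded(1)[OF summable_convolution(2)[OF a _ a]])
    fix k
    have s: "(\<lambda>i. cmod (a (i + k)) * cmod (a i)) summable_on UNIV"
      by (rule summable_convolution(1)[OF a _ a]) auto
    have "(\<Sum>\<^sub>\<infinity>j. a j * cnj (a (j - k))) = (\<Sum>\<^sub>\<infinity>j. a (j + k) * cnj (a j))"
      using summable_on_int_shift(2)[of "\<lambda>j. a j * cnj (a (j - k))" k] by simp
    also have "cmod \<dots> \<le> (\<Sum>\<^sub>\<infinity>i. cmod (a (i + k)) * cmod (a i))"
      by (rule abs_summable_bounded(3)[OF s]) (simp add: norm_mult)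
    finally show "cmod (\<Sum>\<^sub>\<infinity>j. a j * cnj (a (j - k))) \<le> (\<Sum>\<^sub>\<infinity>i. cmod (a (i + k)) * cmod (a i))" .
  qed auto
  ultimately show ?thesis unfolding ACF_def G_def by simp
qed

section \<open>The weighted operator and its energy density\<close>

lemma long_intervals_windowI:
  assumes "eventually P long_intervals"
  shows "\<exists>L0. \<forall>L\<ge>L0. \<forall>j. P {j..j + int L - 1}"
proof -
  have "eventually (\<lambda>I. I \<in> {I. \<exists>a b. I = {a..b}} \<longrightarrow> P I) (filtercomap card at_top)"
    using assms unfolding long_intervals_def eventually_inf_principal .
  then obtain Q where Q: "eventually Q at_top" "\<And>I. Q (card I) \<Longrightarrow> I \<in> {I. \<exists>a b. I = {a..b}} \<longrightarrow> P I"
    unfolding eventually_filtercomap by blast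
  then obtain L0 where L0: "\<And>L. L \<ge> L0 \<Longrightarrow> Q L"
    unfolding eventually_at_top_linorder by blast
  have "P {j..j + int L - 1}" if "L \<ge> L0" for L j
    using Q(2)[of "{j..j + int L - 1}"] L0[OF that] by auto
  then show ?thesis by blast
qed

lemma long_intervals_nontrivial: "long_intervals \<noteq> bot"
proof
  assume "long_intervals = bot"
  then have "eventually (\<lambda>_. False) long_intervals" by simp
  from long_intervals_windowI[OF this] show False by blast
qed

lemma window_mean_eq_interval:
  "window_mean L j f = 1 / of_nat (card {j..j + int L - 1}) * (\<Sum>l\<in>{j..j + int L - 1}. f l)"
proof -
  have "(\<Sum>l\<in>{j..j + int L - 1}. f l) = (\<Sum>s<L. f (j + int s))"
    by (rule sum.reindex_bij_witness[of _ "\<lambda>s. j + int s" "\<lambda>l. nat (l - j)"]) auto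
  then show ?thesis by (simp add: window_mean_def)
qed

locale regular_operator =
  fixes W :: operator
  assumes regular: "regular W"
begin

abbreviation entry :: "int \<Rightarrow> int \<Rightarrow> complex" where "entry \<equiv> matrix_entry W"

definition diag_sup :: "int \<Rightarrow> real" where
  "diag_sup k = (SUP j. cmod (entry (j + k) j))"

lemma bounded: "bounded_operator W"
  using regular by (simp add: regular_def diagonal_type_def)

sublocale dominated_matrix entry diag_sup
proof
  fix l j
  have "bdd_above (range (\<lambda>j. cmod (entry (j + (l - j')) j)))" for j'
    using regular by (simp add: regular_def diagonal_type_def)
  from cSUP_upper[OF UNIV_I this, of j j] show "cmod (entry l j) \<le> diag_sup (l - j)"
    by (simp add: diag_sup_def)
next
  show "diag_sup summable_on UNIV"
    using regular by (simp add: regular_def diagonal_type_def diag_sup_def[abs_def])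
qed

sublocale regular_matrix entry diag_sup "omega W"
proof
  fix m n and e :: real assume e: "e > 0"
  obtain v where v: "(correlation_mean W m n \<longlongrightarrow> v) long_intervals"
    using regular unfolding regular_def by blast
  then have "omega W m n = v"
    unfolding omega_def by (rule tendsto_Lim[OF long_intervals_nontrivial])
  then have "eventually (\<lambda>I. dist (correlation_mean W m n I) (omega W m n) < e) long_intervals"
    using v e by (simp add: tendstoD)
  from long_intervals_windowI[OF this] obtain L0 where
    L0: "\<And>L j. L \<ge> L0 \<Longrightarrow> dist (correlation_mean W m n {j..j + int L - 1}) (omega W m n) < e"
    by blast
  have "correlation_mean W m n {j..j + int L - 1} = window_mean L j (row_corr m n)" for L j
    unfolding correlation_mean_def window_mean_eq_interval row_corr_def ..
  then show "\<exists>L0. \<forall>L\<ge>L0. \<forall>j. cmod (window_mean L j (row_corr m n) - omega W m n) \<le> e"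
    using L0 by (metis dist_norm less_imp_le)
qed

lemma column_summable: "abs_summable (\<lambda>l. entry l j)"
proof (rule abs_summable_bounded(1))
  show "(\<lambda>l. diag_sup (l + (-j))) summable_on UNIV"
    unfolding summable_on_int_shift by (rule c_summable)
qed (use entry_le in simp)

text \<open>
  Since the columns are summable, the images of characters are given by absolutely convergent series.
  Inner products of such images thus reduce to integrating these series term by term.
\<close>

lemma column_fourier_series:
  "AE x in circle. W (character j) x = fourier_series (\<lambda>l. entry l j) x"
proof -
  have "W (character j) \<in> ACF"
    using column_summable[of j] L2_imp_integrable[OF bounded_operator_L2[OF bounded character_L2]]
    by (simp add: ACF_def matrix_entry_def)
  from ACF_eq_fourier_series(1)[OF this] show ?thesis
    by (simp add: matrix_entry_def)
qed

end

locale weighted_operator = regular_operator +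
  fixes g :: "real \<Rightarrow> complex"
  assumes g_ACF: "g \<in> ACF"
begin

text \<open>
  The sign makes \<open>r\<close> below a plain sum: \<open>r n\<close> is the \<open>n\<close>-th Fourier coefficient of
  \<open>\<integral> |g(x)|\<^sup>2 \<nu>(x,\<cdot>) dx/2\<pi>\<close>, in which \<open>\<omega> m n\<close> meets the coefficient of \<open>|g|\<^sup>2\<close> at \<open>- m\<close>.
\<close>

definition \<gamma> :: "int \<Rightarrow> complex" where
  "\<gamma> m = fourier_coeff (\<lambda>x. complex_of_real ((cmod (g x))\<^sup>2)) (- m)"

definition r :: "int \<Rightarrow> complex" where
  "r n = (\<Sum>\<^sub>\<infinity>m. \<gamma> m * omega W m n)"

definition \<rho> :: "real \<Rightarrow> real" where
  "\<rho> x = Re (fourier_series r x)"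

definition A :: operator where
  "A = mult_op g \<circ> W"

lemma g_measurable: "g \<in> borel_measurable circle"
  using g_ACF by (auto simp: ACF_def intro: borel_measurable_integrable)

lemma g_Linfty: "g \<in> Linfty"
proof -
  have "AE x in circle. cmod (g x) \<le> (\<Sum>\<^sub>\<infinity>k. cmod (fourier_coeff g k))"
    using ACF_eq_fourier_series(1)[OF g_ACF]
    by eventually_elim (simp add: norm_fourier_series_le ACF_eq_fourier_series(2)[OF g_ACF])
  then show ?thesis using g_measurable unfolding Linfty_def by blast
qed

lemma A_bounded: "bounded_operator A"
  unfolding A_def by (intro bounded_operator_comp bounded_operator_mult g_Linfty bounded)

lemma \<gamma>_summable: "abs_summable \<gamma>"
  using ACF_eq_fourier_series(2)[OF ACF_abs_square[OF g_ACF]]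
    summable_on_int_shift(3)[of "\<lambda>k. cmod (fourier_coeff (\<lambda>x. complex_of_real ((cmod (g x))\<^sup>2)) k)" 0]
  by (simp add: \<gamma>_def[abs_def])

lemma abs_square_g: "AE x in circle. complex_of_real ((cmod (g x))\<^sup>2) = fourier_series (\<lambda>m. \<gamma> (- m)) x"
  using ACF_eq_fourier_series(1)[OF ACF_abs_square[OF g_ACF]] by (simp add: \<gamma>_def)

lemma \<gamma>_minus_summable: "abs_summable (\<lambda>m. \<gamma> (- m))"
  using summable_on_int_shift(3)[of "\<lambda>k. cmod (\<gamma> k)" 0] \<gamma>_summable by simp

lemma r_summable: "abs_summable r"
  unfolding r_def by (rule summable_weighted_omega[OF \<gamma>_summable])

lemma \<rho>_continuous: "continuous_on S \<rho>"
  unfolding \<rho>_def by (intro continuous_intros continuous_on_fourier_series r_summable)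

lemma \<rho>_bounded: "\<bar>\<rho> x\<bar> \<le> (\<Sum>\<^sub>\<infinity>k. cmod (r k))"
  unfolding \<rho>_def using abs_Re_le_cmod norm_fourier_series_le[OF r_summable] order_trans by blast

definition gram :: "int \<Rightarrow> int \<Rightarrow> complex" where
  "gram j n = (\<Sum>\<^sub>\<infinity>m. \<gamma> m * col_corr m n j)"

text \<open>
  The factor \<open>|g|\<^sup>2\<close> is expanded into its Fourier series; multiplication by \<open>e\<^sub>m\<close> shifts the rows of
  \<open>W\<close>, which produces the column correlations.
\<close>

lemma A_gram: "(\<integral>x. A (character j) x * cnj (A (character k) x) \<partial>circle) = gram j (k - j)"
proof -
  define u where "u j = fourier_series (\<lambda>l. entry l j)" for j
  define G where "G = fourier_series (\<lambda>m. \<gamma> (- m))"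
  note bmG = bounded_measurable_fourier_series[OF \<gamma>_minus_summable, folded G_def]
  note bmu = bounded_measurable_fourier_series[OF column_summable, folded u_def]
  have m1: "u j \<in> borel_measurable circle" for j using bmu[of j] by (simp add: bounded_measurable_def)
  have m2: "G \<in> borel_measurable circle" using bmG by (simp add: bounded_measurable_def)
  have Am: "A (character j) \<in> borel_measurable circle" for j
    by (intro L2_measurable bounded_operator_L2[OF A_bounded] character_L2)
  have "(\<integral>x. A (character j) x * cnj (A (character k) x) \<partial>circle) = (\<integral>x. G x * (u j x * cnj (u k
      x)) \<partial>circle)"
  proof (rule integral_cong_AE)
    show "(\<lambda>x. A (character j) x * cnj (A (character k) x)) \<in> borel_measurable circle"
      using Am[of j] Am[of k] by measurable
    show "(\<lambda>x. G x * (u j x * cnj (u k x))) \<in> borel_measurable circle"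
      using m1[of j] m1[of k] m2 by measurable
    show "AE x in circle. A (character j) x * cnj (A (character k) x) = G x * (u j x * cnj (u k x))"
      using column_fourier_series[of j] column_fourier_series[of k] abs_square_g
    proof eventually_elim
      case (elim x)
      have "A (character j) x * cnj (A (character k) x) =
          (g x * cnj (g x)) * (W (character j) x * cnj (W (character k) x))"
        by (simp add: A_def mult_op_def mult_ac)
      also have "g x * cnj (g x) = G x"
        using elim(3) by (simp only: G_def complex_norm_square)
      finally show ?case using elim(1,2) by (simp add: u_def)
    qed
  qed
  also have "\<dots> = (\<Sum>\<^sub>\<infinity>m. \<gamma> (- m) * (\<integral>x. character m x * (u j x * cnj (u k x)) \<partial>circle))"
  proof -
    have "bounded_measurable (\<lambda>x. u j x * cnj (u k x))"
    proof (rule bounded_measurable_mult[OF bmu])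
      obtain C where "\<forall>x\<in>{0..<2*pi}. cmod (u k x) \<le> C"
        using bmu[of k] unfolding bounded_measurable_def by blast
      moreover have "(\<lambda>x. cnj (u k x)) \<in> borel_measurable circle"
        using m1[of k] by measurable
      ultimately show "bounded_measurable (\<lambda>x. cnj (u k x))"
        unfolding bounded_measurable_def by auto
    qed
    then obtain C where C: "\<forall>x\<in>{0..<2*pi}. cmod (u j x * cnj (u k x)) \<le> C"
      and m: "(\<lambda>x. u j x * cnj (u k x)) \<in> borel_measurable circle"
      unfolding bounded_measurable_def by blast
    show ?thesis
      unfolding G_def
      by (rule fourier_series_integral[OF circle.finite_measure_axioms m, of C "\<lambda>x. x", OF _ _
          \<gamma>_minus_summable])
         (use C in \<open>auto intro: borel_measurable_circle\<close>)
  qed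
  also have "\<dots> = (\<Sum>\<^sub>\<infinity>m. \<gamma> (- m) * (\<Sum>\<^sub>\<infinity>l. entry l j * cnj (entry (l + m) k)))"
    unfolding u_def by (simp add: integral_fourier_series_cnj column_summable)
  also have "\<dots> = (\<Sum>\<^sub>\<infinity>m. \<gamma> m * (\<Sum>\<^sub>\<infinity>l. entry l j * cnj (entry (l - m) k)))"
    using summable_on_int_shift(4)[of "\<lambda>m. \<gamma> m * (\<Sum>\<^sub>\<infinity>l. entry l j * cnj (entry (l - m) k))" 0] by simp
  also have "\<dots> = gram j (k - j)"
    unfolding gram_def col_corr_def
  proof (rule infsum_cong, rule arg_cong2[where f = "(*)"], rule refl)
    fix m :: int
    show "(\<Sum>\<^sub>\<infinity>l. entry l j * cnj (entry (l - m) k)) = (\<Sum>\<^sub>\<infinity>l. entry (l + m) j * cnj (entry l (j +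
        (k - j))))"
      using summable_on_int_shift(2)[of "\<lambda>l. entry l j * cnj (entry (l - m) k)" m] by simp
  qed
  finally show ?thesis .
qed

lemma integral_double_sum:
  assumes "finite S" "\<And>j. j \<in> S \<Longrightarrow> f j \<in> L2"
  shows "complex_of_real ((L2_norm (\<lambda>x. \<Sum>j\<in>S. p j * f j x))\<^sup>2) =
    (\<Sum>j\<in>S. \<Sum>k\<in>S. p j * cnj (p k) * (\<integral>x. f j x * cnj (f k x) \<partial>circle))"
proof -
  have int: "integrable circle (\<lambda>x. p j * cnj (p k) * (f j x * cnj (f k x)))" if "j \<in> S" "k \<in> S" for j k
  proof (rule integrable_mult_right)
    note jk = assms(2)[OF that(1)] assms(2)[OF that(2)]
    have "integrable circle (\<lambda>x. (cmod (f j x))\<^sup>2 + (cmod (f k x))\<^sup>2)"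
      by (intro Bochner_Integration.integrable_add L2_integrable jk)
    then show "integrable circle (\<lambda>x. f j x * cnj (f k x))"
    proof (rule Bochner_Integration.integrable_bound)
      show "(\<lambda>x. f j x * cnj (f k x)) \<in> borel_measurable circle"
        using jk[THEN L2_measurable] by measurable
      have "a * b \<le> a\<^sup>2 + b\<^sup>2" for a b :: real
        using sum_squares_bound[of a b] zero_le_power2[of a] zero_le_power2[of b]
        unfolding mult.assoc by linarith
      then show "AE x in circle. norm (f j x * cnj (f k x)) \<le> norm ((cmod (f j x))\<^sup>2 + (cmod (f k
          x))\<^sup>2)"
        by (simp add: norm_mult)
    qed
  qed
  have "complex_of_real ((L2_norm (\<lambda>x. \<Sum>j\<in>S. p j * f j x))\<^sup>2) =
      (\<integral>x. complex_of_real ((cmod (\<Sum>j\<in>S. p j * f j x))\<^sup>2) \<partial>circle)"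
    unfolding L2_norm_power2 by (rule integral_complex_of_real[symmetric])
  also have "\<dots> = (\<integral>x. (\<Sum>j\<in>S. \<Sum>k\<in>S. p j * cnj (p k) * (f j x * cnj (f k x))) \<partial>circle)"
    unfolding complex_norm_square
    by (intro Bochner_Integration.integral_cong refl) (simp add: sum_product mult_ac)
  also have "\<dots> = (\<Sum>j\<in>S. \<Sum>k\<in>S. (\<integral>x. p j * cnj (p k) * (f j x * cnj (f k x)) \<partial>circle))"
    using int by (simp add: Bochner_Integration.integral_sum)
  finally show ?thesis by simp
qed

text \<open>
  Schur's test for a matrix dominated by a function of the diagonal, via \<open>2|p j||p k| \<le> |p j|\<^sup>2 + |p k|\<^sup>2\<close>.
\<close>

lemma schur_bound:
  fixes p :: "int \<Rightarrow> complex" and D :: "int \<Rightarrow> int \<Rightarrow> complex"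
  assumes S: "finite S" and b: "b summable_on UNIV" "\<And>n. 0 \<le> b n"
    and D: "\<And>j k. cmod (D j k) \<le> b (k - j)"
  shows "cmod (\<Sum>j\<in>S. \<Sum>k\<in>S. p j * cnj (p k) * D j k) \<le> (\<Sum>\<^sub>\<infinity>n. b n) * (\<Sum>j\<in>S. (cmod (p j))\<^sup>2)"
proof -
  have row: "(\<Sum>k\<in>S. b (k - j)) \<le> (\<Sum>\<^sub>\<infinity>n. b n)" for j
  proof -
    have "(\<lambda>k. b (k - j)) summable_on UNIV"
      using summable_on_int_shift(1)[of b "- j"] b(1) by simp
    then have "(\<Sum>k\<in>S. b (k - j)) \<le> (\<Sum>\<^sub>\<infinity>k. b (k - j))"
      by (rule finite_sum_le_infsum) (use b S in auto)
    then show ?thesis using summable_on_int_shift(2)[of b "- j"] by simp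
  qed
  have col: "(\<Sum>j\<in>S. b (k - j)) \<le> (\<Sum>\<^sub>\<infinity>n. b n)" for k
  proof -
    have "(\<lambda>j. b (k - j)) summable_on UNIV"
      using summable_on_int_shift(3)[of b k] b(1) by simp
    then have "(\<Sum>j\<in>S. b (k - j)) \<le> (\<Sum>\<^sub>\<infinity>j. b (k - j))"
      by (rule finite_sum_le_infsum) (use b S in auto)
    then show ?thesis using summable_on_int_shift(4)[of b k] by simp
  qed
  have "cmod (\<Sum>j\<in>S. \<Sum>k\<in>S. p j * cnj (p k) * D j k) \<le> (\<Sum>j\<in>S. \<Sum>k\<in>S. ((cmod (p j))\<^sup>2 / 2 + (cmod (p
      k))\<^sup>2 / 2) * b (k - j))"
  proof (intro sum_norm_le)
    fix j k
    have "cmod (p j) * cmod (p k) \<le> (cmod (p j))\<^sup>2 / 2 + (cmod (p k))\<^sup>2 / 2"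
      using sum_squares_bound[of "cmod (p j)" "cmod (p k)"] by simp
    then show "cmod (p j * cnj (p k) * D j k) \<le> ((cmod (p j))\<^sup>2 / 2 + (cmod (p k))\<^sup>2 / 2) * b (k - j)"
      unfolding norm_mult complex_mod_cnj by (intro mult_mono D) auto
  qed
  also have "\<dots> = (\<Sum>j\<in>S. (cmod (p j))\<^sup>2 / 2 * (\<Sum>k\<in>S. b (k - j))) + (\<Sum>k\<in>S. (cmod (p k))\<^sup>2 / 2 *
      (\<Sum>j\<in>S. b (k - j)))"
    by (simp add: distrib_right sum.distrib sum_distrib_left sum.swap[of "\<lambda>j k. (cmod (p k))\<^sup>2 / 2
        * b (k - j)" S S])
       (subst sum.swap, simp)
  also have "\<dots> \<le> (\<Sum>j\<in>S. (cmod (p j))\<^sup>2 / 2 * (\<Sum>\<^sub>\<infinity>n. b n)) + (\<Sum>k\<in>S. (cmod (p k))\<^sup>2 / 2 * (\<Sum>\<^sub>\<infinity>n. b n))"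
    by (intro add_mono sum_mono mult_left_mono row col) auto
  also have "\<dots> = (\<Sum>\<^sub>\<infinity>n. b n) * (\<Sum>j\<in>S. (cmod (p j))\<^sup>2)"
    by (simp add: sum_distrib_left sum_distrib_right[symmetric] sum.distrib[symmetric] mult.commute)
  finally show ?thesis .
qed

definition energy :: "(real \<Rightarrow> complex) \<Rightarrow> real" where
  "energy h = (\<integral>x. \<rho> x * (cmod (h x))\<^sup>2 \<partial>circle)"

lemma \<rho>_measurable: "\<rho> \<in> borel_measurable circle"
  by (intro borel_measurable_circle borel_measurable_continuous_onI \<rho>_continuous)

lemma energy_integrable: "h \<in> L2 \<Longrightarrow> integrable circle (\<lambda>x. \<rho> x * (cmod (h x))\<^sup>2)"
proof -
  assume h: "h \<in> L2"
  have "integrable circle (\<lambda>x. (\<Sum>\<^sub>\<infinity>k. cmod (r k)) * (cmod (h x))\<^sup>2)"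
    by (rule integrable_mult_right[OF L2_integrable[OF h]])
  then show "integrable circle (\<lambda>x. \<rho> x * (cmod (h x))\<^sup>2)"
  proof (rule Bochner_Integration.integrable_bound)
  show "(\<lambda>x. \<rho> x * (cmod (h x))\<^sup>2) \<in> borel_measurable circle"
    using \<rho>_measurable L2_measurable[OF h] by measurable
  show "AE x in circle. norm (\<rho> x * (cmod (h x))\<^sup>2) \<le> norm ((\<Sum>\<^sub>\<infinity>k. cmod (r k)) * (cmod (h x))\<^sup>2)"
  proof (rule AE_I2)
    fix x
    have "\<bar>\<rho> x\<bar> * (cmod (h x))\<^sup>2 \<le> (\<Sum>\<^sub>\<infinity>k. cmod (r k)) * (cmod (h x))\<^sup>2"
      by (intro mult_right_mono \<rho>_bounded) simp
    also have "\<dots> \<le> \<bar>\<Sum>\<^sub>\<infinity>k. cmod (r k)\<bar> * (cmod (h x))\<^sup>2"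
      by (intro mult_right_mono abs_ge_self) simp
    finally show "norm (\<rho> x * (cmod (h x))\<^sup>2) \<le> norm ((\<Sum>\<^sub>\<infinity>k. cmod (r k)) * (cmod (h x))\<^sup>2)"
      by (simp add: abs_mult)
  qed
  qed
qed

lemma energy_trig_poly:
  assumes S: "finite S"
  shows "energy (\<lambda>x. \<Sum>k\<in>S. p k * character k x) = Re (\<Sum>j\<in>S. \<Sum>k\<in>S. p j * cnj (p k) * r (k - j))"
proof -
  define h where "h x = (\<Sum>k\<in>S. p k * character k x)" for x
  have R: "bounded_measurable (fourier_series r)" by (rule bounded_measurable_fourier_series[OF
      r_summable])
  have int: "integrable circle (\<lambda>x. character k x * fourier_series r x)" for k
    by (intro bounded_measurable_integrable[OF _ circle.finite_measure_axioms refl]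
        bounded_measurable_mult R
        bounded_measurable_trig_poly trig_poly.character)
  have coeff: "(\<integral>x. character (j - k) x * fourier_series r x \<partial>circle) = r (k - j)" for j k
    using fourier_coeff_fourier_series[OF r_summable, of "k - j"]
    by (simp add: fourier_coeff_def cnj_character mult.commute)
  have pt: "fourier_series r x * complex_of_real ((cmod (h x))\<^sup>2) =
      (\<Sum>j\<in>S. \<Sum>k\<in>S. p j * cnj (p k) * (character (j - k) x * fourier_series r x))" for x
  proof -
    have "h x * cnj (h x) = (\<Sum>j\<in>S. \<Sum>k\<in>S. (p j * character j x) * (cnj (p k) * character (- k) x))"
      unfolding h_def cnj_sum complex_cnj_mult cnj_character by (rule sum_product)
    then show ?thesis
      unfolding complex_norm_square diff_conv_add_uminus character_add
      by (simp only: sum_distrib_left mult_ac)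
  qed
  have "(\<integral>x. fourier_series r x * complex_of_real ((cmod (h x))\<^sup>2) \<partial>circle) =
      (\<Sum>j\<in>S. \<Sum>k\<in>S. p j * cnj (p k) * r (k - j))"
    unfolding pt using int by (simp add: Bochner_Integration.integral_sum coeff)
  moreover have "integrable circle (\<lambda>x. fourier_series r x * complex_of_real ((cmod (h x))\<^sup>2))"
    unfolding pt by (intro Bochner_Integration.integrable_sum integrable_mult_right int)
  from integral_Re[OF this]
  have "(\<integral>x. Re (fourier_series r x * complex_of_real ((cmod (h x))\<^sup>2)) \<partial>circle) =
      Re (\<integral>x. fourier_series r x * complex_of_real ((cmod (h x))\<^sup>2) \<partial>circle)" .
  moreover have "(\<lambda>x. Re (fourier_series r x * complex_of_real ((cmod (h x))\<^sup>2))) = (\<lambda>x. \<rho> x *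
      (cmod (h x))\<^sup>2)"
    unfolding \<rho>_def times_complex.sel Re_complex_of_real Im_complex_of_real by simp
  ultimately show ?thesis
    unfolding energy_def h_def[symmetric] by (simp only:)
qed

text \<open>
  Multiplying by \<open>e\<^sub>s\<close> moves the Gram matrix by \<open>s\<close> along its diagonals, so averaging over \<open>s\<close>
  averages each diagonal over a window.
\<close>

lemma modulated_energy_trig_poly:
  assumes p: "trig_poly p" and "L > 0" and b: "b summable_on UNIV" "\<And>n. 0 \<le> b n"
    and D: "\<And>j n. cmod (window_mean L j (\<lambda>s. gram s n) - r n) \<le> b n"
  shows "\<bar>(\<Sum>s<L. (L2_norm (A (\<lambda>x. character (int s) x * p x)))\<^sup>2) / real L - energy p\<bar> \<le> (\<Sum>\<^sub>\<infinity>n. b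
      n) * (L2_norm p)\<^sup>2"
proof -
  obtain S c where S: "finite S" and p: "p = (\<lambda>x. \<Sum>k\<in>S. c k * character k x)"
    using trig_poly_eq_sum[OF p] by blast
  have norm: "(L2_norm p)\<^sup>2 = (\<Sum>k\<in>S. (cmod (c k))\<^sup>2)"
  proof -
    have "complex_of_real ((L2_norm p)\<^sup>2) = (\<Sum>j\<in>S. \<Sum>k\<in>S. c j * cnj (c k) * (if j = k then 1 else 0))"
      unfolding p by (subst integral_double_sum[OF S character_L2])
        (simp add: cnj_character integral_character_mult)
    also have "\<dots> = (\<Sum>j\<in>S. c j * cnj (c j))"
      using S by (simp add: if_distrib sum.delta' cong: if_cong)
    also have "\<dots> = complex_of_real (\<Sum>k\<in>S. (cmod (c k))\<^sup>2)"
      by (simp only: of_real_sum complex_norm_square)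
    finally show ?thesis by (simp only: of_real_eq_iff)
  qed
  have one: "complex_of_real ((L2_norm (A (\<lambda>x. character (int s) x * p x)))\<^sup>2) =
      (\<Sum>j\<in>S. \<Sum>k\<in>S. c j * cnj (c k) * gram (j + int s) (k - j))" for s
  proof -
    have eq: "(\<lambda>x. character (int s) x * p x) = (\<lambda>x. \<Sum>k\<in>S. c k * character (k + int s) x)"
      unfolding p by (auto simp: sum_distrib_left character_add mult_ac)
    have bs: "(\<lambda>x. \<Sum>k\<in>S. c k * character (k + int s) x) \<in> L2"
      "AE x in circle. A (\<lambda>x. \<Sum>k\<in>S. c k * character (k + int s) x) x = (\<Sum>k\<in>S. c k * A (character
          (k + int s)) x)"
      using bounded_operator_sum[OF A_bounded S character_L2] by auto
    have AL: "A (character k) \<in> L2" for k by (rule bounded_operator_L2[OF A_bounded character_L2])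
    have "(\<lambda>x. \<Sum>k\<in>S. c k * A (character (k + int s)) x) \<in> L2"
      by (rule conjunct1[OF bounded_operator_sum[OF A_bounded S AL]])
    then have norm_eq: "L2_norm (A (\<lambda>x. character (int s) x * p x)) = L2_norm (\<lambda>x. \<Sum>k\<in>S. c k * A
        (character (k + int s)) x)"
      unfolding eq by (intro L2_norm_cong_AE bs bounded_operator_L2[OF A_bounded])
    then show ?thesis
      unfolding norm_eq integral_double_sum[OF S AL] A_gram by simp
  qed
  have "complex_of_real ((\<Sum>s<L. (L2_norm (A (\<lambda>x. character (int s) x * p x)))\<^sup>2) / real L) =
      (\<Sum>s<L. \<Sum>j\<in>S. \<Sum>k\<in>S. c j * cnj (c k) * gram (j + int s) (k - j)) / of_nat L"
    by (simp only: of_real_divide of_real_sum one of_real_of_nat_eq)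
  also have "\<dots> = (\<Sum>j\<in>S. \<Sum>k\<in>S. c j * cnj (c k) * window_mean L j (\<lambda>s. gram s (k - j)))"
    unfolding window_mean_def
    by (simp add: sum_divide_distrib sum_distrib_left sum.swap[of _ _ "{..<L}"])
  finally have avg: "complex_of_real ((\<Sum>s<L. (L2_norm (A (\<lambda>x. character (int s) x * p x)))\<^sup>2) /
      real L) = \<dots>" .
  have "(\<Sum>s<L. (L2_norm (A (\<lambda>x. character (int s) x * p x)))\<^sup>2) / real L - energy p =
      Re (\<Sum>j\<in>S. \<Sum>k\<in>S. c j * cnj (c k) * (window_mean L j (\<lambda>s. gram s (k - j)) - r (k - j)))"
    using arg_cong[OF avg, of Re] energy_trig_poly[OF S, of c]
    unfolding p[symmetric] by (simp add: right_diff_distrib sum_subtractf)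
  also have "\<bar>\<dots>\<bar> \<le> cmod (\<Sum>j\<in>S. \<Sum>k\<in>S. c j * cnj (c k) * (window_mean L j (\<lambda>s. gram s (k - j)) - r
      (k - j)))"
    by (rule abs_Re_le_cmod)
  also have "\<dots> \<le> (\<Sum>\<^sub>\<infinity>n. b n) * (\<Sum>j\<in>S. (cmod (c j))\<^sup>2)"
    by (rule schur_bound[OF S b D])
  finally show ?thesis unfolding norm .
qed

end

section \<open>Functions concentrated on short arcs\<close>

context weighted_operator
begin

text \<open>
  Adding a constant to \<open>\<rho>\<close> makes the weight nonnegative, and the energy becomes a difference of squared
  norms of bounded multiplication operators, which are continuous.
\<close>

lemma energy_convergent:
  assumes h: "h \<in> L2" and p: "\<And>n. p n \<in> L2" and lim: "(\<lambda>n. L2_norm (\<lambda>x. h x - p n x)) \<longlonglongrightarrow> 0"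
  shows "(\<lambda>n. energy (p n)) \<longlonglongrightarrow> energy h"
proof -
  define C where "C = (\<Sum>\<^sub>\<infinity>k. cmod (r k))"
  (* The energy of f is the squared norm of u f minus C times that of f. *)
  define u where "u x = complex_of_real (sqrt (\<rho> x + C))" for x
  have pos: "0 \<le> \<rho> x + C" for x
    using \<rho>_bounded[of x] unfolding C_def by linarith
  have "bounded_measurable u"
  proof (rule bounded_measurableI)
    show "u \<in> borel_measurable borel"
      unfolding u_def by (intro borel_measurable_continuous_onI continuous_intros \<rho>_continuous)
    show "cmod (u x) \<le> sqrt (2 * C)" for x
      using \<rho>_bounded[of x] pos[of x] by (simp add: u_def C_def)
  qed
  then have u: "bounded_operator (mult_op u)"
    by (intro bounded_operator_mult bounded_measurable_Linfty)
  have "energy f = (L2_norm (mult_op u f))\<^sup>2 - C * (L2_norm (mult_op (\<lambda>_. 1) f))\<^sup>2" if f: "f \<in> L2" for f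
  proof -
    have "(L2_norm (mult_op u f))\<^sup>2 = (\<integral>x. \<rho> x * (cmod (f x))\<^sup>2 + C * (cmod (f x))\<^sup>2 \<partial>circle)"
      unfolding L2_norm_power2 mult_op_def
      by (intro Bochner_Integration.integral_cong refl)
         (simp add: u_def norm_mult power_mult_distrib pos distrib_right)
    also have "\<dots> = energy f + C * (L2_norm (mult_op (\<lambda>_. 1) f))\<^sup>2"
      unfolding L2_norm_power2 mult_op_def energy_def
      by (simp add: energy_integrable[OF f] L2_integrable[OF f])
    finally show ?thesis by simp
  qed
  then show ?thesis
    using L2_norm_convergent[OF h p lim u]
      L2_norm_convergent[OF h p lim bounded_operator_mult[OF bounded_measurable_Linfty[OF
          bounded_measurable_const[of 1]]]]
    by (simp add: h p) (intro tendsto_intros)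
qed

lemma mult_character_bounded: "bounded_operator (mult_op (character k))"
  by (intro bounded_operator_mult bounded_measurable_Linfty bounded_measurable_trig_poly
      trig_poly.character)

text \<open>
  The estimate for trigonometric polynomials extends by density, as \<open>L\<close> does not depend on the
  polynomial.
\<close>

theorem modulated_energy:
  assumes "e > 0"
  obtains L where "L > 0"
    "\<And>h. h \<in> L2 \<Longrightarrow>
      \<bar>(\<Sum>s<L. (L2_norm (A (\<lambda>x. character (int s) x * h x)))\<^sup>2) / real L - energy h\<bar> \<le> e * (L2_norm h)\<^sup>2"
proof -
  obtain L b where L: "L > 0" and b: "b summable_on UNIV" "(\<Sum>\<^sub>\<infinity>n. b n) \<le> e" "\<And>n. 0 \<le> b n"
    and D: "\<And>j n. cmod (window_mean L j (\<lambda>s. \<Sum>\<^sub>\<infinity>m. \<gamma> m * col_corr m n s) - (\<Sum>\<^sub>\<infinity>m. \<gamma> m * omega W m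
        n)) \<le> b n"
    by (rule weighted_col_means[OF \<gamma>_summable assms]) (rule that; assumption)
  have D': "cmod (window_mean L j (\<lambda>s. gram s n) - r n) \<le> b n" for j n
    using D[of j n] unfolding gram_def r_def .
  show thesis
  proof (rule that[OF L])
    fix h assume h: "h \<in> L2"
    have "\<exists>p. trig_poly p \<and> L2_norm (\<lambda>x. h x - p x) < 1 / real (Suc n)" for n
      by (rule trig_poly_dense_L2[OF h]) simp
    then obtain p where p: "\<And>n. trig_poly (p n)" "\<And>n. L2_norm (\<lambda>x. h x - p n x) < 1 / real (Suc n)"
      by metis
    have pL: "p n \<in> L2" for n by (intro bounded_measurable_L2 bounded_measurable_trig_poly p)
    have "(\<lambda>n. L2_norm (\<lambda>x. h x - p n x)) \<longlonglongrightarrow> 0"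
    proof (rule tendsto_sandwich[OF _ _ tendsto_const])
      show "(\<lambda>n. 1 / real (Suc n)) \<longlonglongrightarrow> 0"
        using LIMSEQ_inverse_real_of_nat by (simp add: inverse_eq_divide)
      show "eventually (\<lambda>n. L2_norm (\<lambda>x. h x - p n x) \<le> 1 / real (Suc n)) sequentially"
        by (intro always_eventually allI less_imp_le p(2))
    qed (simp add: L2_norm_nonneg)
    note conv = L2_norm_convergent[OF h pL this] and en = energy_convergent[OF h pL this]
    have cA: "(\<lambda>n. L2_norm (A (\<lambda>x. character (int s) x * p n x))) \<longlonglongrightarrow> L2_norm (A (\<lambda>x. character (int
        s) x * h x))" for s
      using conv[OF bounded_operator_comp[OF A_bounded mult_character_bounded[of "int s"]]]
      by (simp add: mult_op_def o_def)
    have cn: "(\<lambda>n. L2_norm (p n)) \<longlonglongrightarrow> L2_norm h"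
      using conv[OF bounded_operator_mult[OF bounded_measurable_Linfty[OF
          bounded_measurable_const[of 1]]]]
      by (simp add: mult_op_def)
    show "\<bar>(\<Sum>s<L. (L2_norm (A (\<lambda>x. character (int s) x * h x)))\<^sup>2) / real L - energy h\<bar> \<le> e *
        (L2_norm h)\<^sup>2"
    proof (rule LIMSEQ_le)
      show "(\<lambda>n. \<bar>(\<Sum>s<L. (L2_norm (A (\<lambda>x. character (int s) x * p n x)))\<^sup>2) / real L - energy (p n)\<bar>) \<longlonglongrightarrow>
          \<bar>(\<Sum>s<L. (L2_norm (A (\<lambda>x. character (int s) x * h x)))\<^sup>2) / real L - energy h\<bar>"
        using L by (intro tendsto_intros cA en) simp
      show "(\<lambda>n. e * (L2_norm (p n))\<^sup>2) \<longlonglongrightarrow> e * (L2_norm h)\<^sup>2"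
        by (intro tendsto_intros cn)
      show "\<exists>N. \<forall>n\<ge>N. \<bar>(\<Sum>s<L. (L2_norm (A (\<lambda>x. character (int s) x * p n x)))\<^sup>2) / real L - energy
          (p n)\<bar>
          \<le> e * (L2_norm (p n))\<^sup>2"
        using modulated_energy_trig_poly[OF p(1) L b(1,3) D'] mult_right_mono[OF b(2) zero_le_power2]
        by (meson order_trans)
    qed
  qed
qed

lemma character_power_diff:
  assumes "cmod (character 1 x - \<zeta>) \<le> \<delta>" "cmod \<zeta> = 1"
  shows "cmod (character (int s) x - \<zeta> ^ s) \<le> real s * \<delta>"
proof -
  have "character (int s) x = character 1 x ^ s"
    by (simp add: character_def Complex.DeMoivre)
  then have "cmod (character (int s) x - \<zeta> ^ s) \<le> real s * cmod (character 1 x - \<zeta>)"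
    using norm_power_diff[of "character 1 x" \<zeta> s] assms(2) by simp
  also have "\<dots> \<le> real s * \<delta>" using assms(1) by (intro mult_left_mono) auto
  finally show ?thesis .
qed

text \<open>
  On the support of \<open>h\<close> the character \<open>e\<^sub>s\<close> differs from the constant \<open>\<zeta>\<^sup>s\<close> by at most \<open>s \<delta>\<close>, and
  \<open>A (\<zeta>\<^sup>s h)\<close> has the norm of \<open>A h\<close>. So every term of the modulated mean is close to \<open>\<parallel>A h\<parallel>\<^sup>2\<close> once
  \<open>\<delta>\<close> is small compared with \<open>1/L\<close>.
\<close>

theorem local_energy:
  assumes e: "e > 0"
  obtains \<delta> where "\<delta> > 0"
    "\<And>h \<zeta>. h \<in> L2 \<Longrightarrow> cmod \<zeta> = 1 \<Longrightarrow> (\<And>x. x \<in> {0..<2*pi} \<Longrightarrow> h x = 0 \<or> cmod (character 1 x - \<zeta>) \<le> \<delta>) \<Longrightarrow>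
      \<bar>(L2_norm (A h))\<^sup>2 - energy h\<bar> \<le> e * (L2_norm h)\<^sup>2"
proof -
  obtain L where L: "L > 0" "\<And>h. h \<in> L2 \<Longrightarrow>
      \<bar>(\<Sum>s<L. (L2_norm (A (\<lambda>x. character (int s) x * h x)))\<^sup>2) / real L - energy h\<bar> \<le> e/2 *
          (L2_norm h)\<^sup>2"
    using modulated_energy[of "e/2"] e by auto
  obtain B where B: "B \<ge> 0" "\<forall>f\<in>L2. L2_norm (A f) \<le> B * L2_norm f"
    using bounded_operator_bound[OF A_bounded] by blast
  (* B bounds A. The squares of the norms of A (e_s h) and A h differ by at most
     2 B^2 L \<delta> times the squared norm of h, which this choice keeps below e/2; the summand 1
     avoids a division by zero. *)
  define \<delta> where "\<delta> = e / (4 * (B\<^sup>2 + 1) * real L)"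
  have pos: "B\<^sup>2 + 1 > 0" by (simp add: add_nonneg_pos)
  have \<delta>: "\<delta> > 0" using e L(1) pos by (simp add: \<delta>_def)
  have small: "2 * B\<^sup>2 * (real L * \<delta>) \<le> e/2"
  proof -
    have "real L * \<delta> = e / (4 * (B\<^sup>2 + 1))" using L(1) by (simp add: \<delta>_def)
    then have "2 * B\<^sup>2 * (real L * \<delta>) = e/2 * (B\<^sup>2 / (B\<^sup>2 + 1))"
    proof -
      assume *: "real L * \<delta> = e / (4 * (B\<^sup>2 + 1))"
      have "2 * b * (e / (4 * t)) = e/2 * (b / t)" for b t :: real
        by (cases "t = 0") (simp_all add: field_simps)
      then show ?thesis unfolding * .
    qed
    also have "\<dots> \<le> e/2 * 1"
      using e pos by (intro mult_left_mono) auto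
    finally show ?thesis by simp
  qed
  show thesis
  proof (rule that[OF \<delta>])
    fix h \<zeta> assume h: "h \<in> L2" and \<zeta>: "cmod \<zeta> = 1"
      and near: "\<And>x. x \<in> {0..<2*pi} \<Longrightarrow> h x = 0 \<or> cmod (character 1 x - \<zeta>) \<le> \<delta>"
    define N where "N = L2_norm h"
    have N: "N \<ge> 0" by (simp add: N_def L2_norm_nonneg)
    have each: "\<bar>(L2_norm (A (\<lambda>x. character (int s) x * h x)))\<^sup>2 - (L2_norm (A h))\<^sup>2\<bar> \<le> e/2 * N\<^sup>2"
        if s: "s < L" for s
    proof -
      define f where "f x = character (int s) x * h x" for x
      define k where "k x = \<zeta> ^ s * h x" for x
      have f: "f \<in> L2" unfolding f_def
        using bounded_operator_L2[OF mult_character_bounded h] by (simp add: mult_op_def)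
      have k: "k \<in> L2" unfolding k_def by (rule L2_scale[OF h])
      have Nf: "L2_norm f = N" by (simp add: f_def N_def L2_norm_def norm_mult)
      have Nk: "L2_norm (A k) = L2_norm (A h)"
      proof -
        have "L2_norm (A k) = L2_norm (\<lambda>x. \<zeta> ^ s * A h x)"
          unfolding k_def
          by (rule L2_norm_cong_AE[OF _ _ bounded_operator_scale[OF A_bounded h]])
             (intro bounded_operator_L2[OF A_bounded] L2_scale h)+
        then show ?thesis by (simp add: L2_norm_scale norm_power \<zeta>)
      qed
      have "L2_norm (\<lambda>x. f x - k x) \<le> L2_norm (\<lambda>x. complex_of_real (real s * \<delta>) * h x)"
      proof (rule power2_le_imp_le[OF _ L2_norm_nonneg], unfold L2_norm_power2, rule integral_mono)
        show "integrable circle (\<lambda>x. (cmod (f x - k x))\<^sup>2)"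
          by (rule L2_integrable[OF L2_diff[OF f k]])
        show "integrable circle (\<lambda>x. (cmod (complex_of_real (real s * \<delta>) * h x))\<^sup>2)"
          by (rule L2_integrable[OF L2_scale[OF h]])
        fix x assume "x \<in> space circle"
        then have "h x = 0 \<or> cmod (character 1 x - \<zeta>) \<le> \<delta>"
          using near by simp
        then have "h x = 0 \<or> cmod (character (int s) x - \<zeta> ^ s) \<le> real s * \<delta>"
          using character_power_diff[OF _ \<zeta>] by blast
        then have "cmod (character (int s) x - \<zeta> ^ s) * cmod (h x) \<le> real s * \<delta> * cmod (h x)"
          by (auto intro: mult_right_mono)
        moreover have "cmod (f x - k x) = cmod (character (int s) x - \<zeta> ^ s) * cmod (h x)"
          by (simp only: f_def k_def left_diff_distrib[symmetric] norm_mult)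
        moreover have "cmod (complex_of_real (real s * \<delta>) * h x) = real s * \<delta> * cmod (h x)"
          using \<delta> by (simp add: norm_mult)
        ultimately show "(cmod (f x - k x))\<^sup>2 \<le> (cmod (complex_of_real (real s * \<delta>) * h x))\<^sup>2"
          by (intro power_mono) auto
      qed
      also have "\<dots> = real s * \<delta> * N"
        using \<delta> unfolding L2_norm_scale N_def by (simp add: norm_mult)
      also have "\<dots> \<le> real L * \<delta> * N"
        using s \<delta> N by (intro mult_right_mono) auto
      finally have fk: "L2_norm (\<lambda>x. f x - k x) \<le> real L * \<delta> * N" .
      have "\<bar>L2_norm (A f) - L2_norm (A k)\<bar> \<le> B * L2_norm (\<lambda>x. f x - k x)"
        using L2_norm_reverse_triangle[OF bounded_operator_L2[OF A_bounded f]
            bounded_operator_L2[OF A_bounded k]]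
          bounded_operator_diff_norm[OF A_bounded f k B(2)] by linarith
      also have "\<dots> \<le> B * (real L * \<delta> * N)" by (rule mult_left_mono[OF fk B(1)])
      finally have d: "\<bar>L2_norm (A f) - L2_norm (A h)\<bar> \<le> B * (real L * \<delta> * N)" unfolding Nk .
      have sm: "L2_norm (A f) + L2_norm (A h) \<le> 2 * B * N"
        using B(2)[rule_format, OF f] B(2)[rule_format, OF h] unfolding Nf N_def[symmetric] by linarith
      have "\<bar>(L2_norm (A f))\<^sup>2 - (L2_norm (A h))\<^sup>2\<bar> = \<bar>L2_norm (A f) - L2_norm (A h)\<bar> * (L2_norm
          (A f) + L2_norm (A h))"
        using L2_norm_nonneg[of "A f"] L2_norm_nonneg[of "A h"]
        by (simp add: power2_eq_square abs_mult[symmetric] square_diff_square_factored mult.commute)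
           (simp add: abs_mult)
      also have "\<dots> \<le> (B * (real L * \<delta> * N)) * (2 * B * N)"
        by (intro mult_mono d sm) (use L2_norm_nonneg B(1) \<delta> N in auto)
      also have "\<dots> = 2 * B\<^sup>2 * (real L * \<delta>) * N\<^sup>2" by (simp add: power2_eq_square)
      also have "\<dots> \<le> e/2 * N\<^sup>2" by (rule mult_right_mono[OF small]) simp
      finally show ?thesis unfolding f_def .
    qed
    define S where "S = (\<Sum>s<L. (L2_norm (A (\<lambda>x. character (int s) x * h x)))\<^sup>2)"
    have "\<bar>S - real L * (L2_norm (A h))\<^sup>2\<bar> \<le> real L * (e/2 * N\<^sup>2)"
    proof -
      have "S - real L * (L2_norm (A h))\<^sup>2 = (\<Sum>s<L. (L2_norm (A (\<lambda>x. character (int s) x * h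
          x)))\<^sup>2 - (L2_norm (A h))\<^sup>2)"
        by (simp add: S_def sum_subtractf)
      also have "\<bar>\<dots>\<bar> \<le> (\<Sum>s<L. e/2 * N\<^sup>2)"
        by (rule order_trans[OF sum_abs]) (intro sum_mono each, simp)
      finally show ?thesis by simp
    qed
    then have "\<bar>S / real L - (L2_norm (A h))\<^sup>2\<bar> \<le> e/2 * N\<^sup>2"
    proof -
      assume a: "\<bar>S - real L * (L2_norm (A h))\<^sup>2\<bar> \<le> real L * (e/2 * N\<^sup>2)"
      have "S / real L - (L2_norm (A h))\<^sup>2 = (S - real L * (L2_norm (A h))\<^sup>2) / real L"
        using L(1) by (simp add: diff_divide_distrib)
      then have "\<bar>S / real L - (L2_norm (A h))\<^sup>2\<bar> = \<bar>S - real L * (L2_norm (A h))\<^sup>2\<bar> / real L"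
        by simp
      also have "\<dots> \<le> e/2 * N\<^sup>2"
        using a L(1) by (simp add: pos_divide_le_eq mult.commute)
      finally show ?thesis .
    qed
    moreover have "\<bar>S / real L - energy h\<bar> \<le> e/2 * N\<^sup>2"
      using L(2)[OF h] by (simp add: S_def N_def)
    ultimately show "\<bar>(L2_norm (A h))\<^sup>2 - energy h\<bar> \<le> e * (L2_norm h)\<^sup>2"
      unfolding N_def by linarith
  qed
qed

end

section \<open>The partition norm\<close>

definition circle_arc :: "nat \<Rightarrow> nat \<Rightarrow> real set" where
  "circle_arc N j = {2*pi * real j / real N ..< 2*pi * real (Suc j) / real N}"

lemma arc_circle: 
  assumes "j < N"
  shows "circle_arc N j \<in> sets circle" "measure circle (circle_arc N j) = 1 / real N"
proof -
  have le: "2*pi * real (Suc j) / real N \<le> 2*pi"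
    using assms by (simp add: pos_divide_le_eq del: of_nat_Suc)
  have le': "2*pi * real j / real N \<le> 2*pi * real (Suc j) / real N"
    by (intro divide_right_mono mult_left_mono) auto
  have "0 \<le> 2*pi * real j / real N" by simp
  then have "circle_arc N j \<subseteq> {0..<2*pi}"
    unfolding circle_arc_def using le by (auto simp del: of_nat_Suc)
  then show "circle_arc N j \<in> sets circle" by (simp add: sets_circle_iff circle_arc_def)
  show "measure circle (circle_arc N j) = 1 / real N"
    unfolding circle_arc_def using le le' assms
    by (subst measure_circle_atLeastLessThan) (auto simp: field_simps)
qed

lemma sum_indicator_unique:
  assumes "finite I" "i0 \<in> I" "x \<in> Y i0" "\<And>i. i \<in> I \<Longrightarrow> x \<in> Y i \<Longrightarrow> i = i0"
  shows "(\<Sum>i\<in>I. indicator (Y i) x) = (1 :: real)"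
proof -
  have "(\<Sum>i\<in>I. indicator (Y i) x) = (\<Sum>i\<in>I. if i = i0 then 1 else (0::real))"
  proof (intro sum.cong refl)
    fix i assume "i \<in> I"
    then have "x \<in> Y i \<longleftrightarrow> i = i0"
      using assms(3,4) by blast
    then show "indicator (Y i) x = (if i = i0 then 1 else (0::real))"
      by (simp only: indicator_def of_bool_def)
  qed
  also have "\<dots> = 1" using assms(1,2) by simp
  finally show ?thesis .
qed

lemma sum_indicator_arcs:
  assumes N: "N > 0" and x: "x \<in> {0..<2*pi}"
  shows "(\<Sum>j<N. indicator (circle_arc N j) x) = (1 :: real)"
proof -
  define t where "t = x * real N / (2*pi)"
  have iff: "x \<in> circle_arc N j \<longleftrightarrow> real j \<le> t \<and> t < real j + 1" for j
    using N unfolding circle_arc_def t_def by (auto simp: field_simps)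
  have t: "0 \<le> t" "t < real N" using x N by (auto simp: t_def field_simps)
  show ?thesis
  proof (rule sum_indicator_unique[of _ "nat \<lfloor>t\<rfloor>"])
    show "nat \<lfloor>t\<rfloor> \<in> {..<N}" using t by (simp add: nat_less_iff floor_less_iff)
    show "x \<in> circle_arc N (nat \<lfloor>t\<rfloor>)" unfolding iff using t by simp
    show "i = nat \<lfloor>t\<rfloor>" if "x \<in> circle_arc N i" for i
      using that unfolding iff by linarith
  qed simp
qed

text \<open>
  Disjointness and covering up to null sets combine into one identity that can be integrated.
\<close>

lemma AE_sum_indicator_partition:
  assumes "partition_mod_null K Y"
  shows "AE x in circle. (\<Sum>i<K. indicator (Y i) x) = (1 :: real)"
proof -
  have "AE x in circle. \<forall>i\<in>{..<K}. \<forall>j\<in>{..<K}. i \<noteq> j \<longrightarrow> x \<notin> Y i \<inter> Y j"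
  proof (intro AE_ball_countable' countable_finite finite_lessThan)
    fix i j assume "i \<in> {..<K}" "j \<in> {..<K}"
    then show "AE x in circle. i \<noteq> j \<longrightarrow> x \<notin> Y i \<inter> Y j"
      using assms AE_not_in[of "Y i \<inter> Y j" circle] unfolding partition_mod_null_def by (cases "i =
          j") auto
  qed
  moreover have "AE x in circle. x \<in> (\<Union>i<K. Y i)"
    using assms by (simp add: partition_mod_null_def)
  ultimately show ?thesis
  proof eventually_elim
    case (elim x)
    then obtain i where "i < K" "x \<in> Y i" by blast
    then show ?case using elim(1) by (intro sum_indicator_unique[of _ i]) auto
  qed
qed

lemma cis_lipschitz: "cmod (cis x - cis a) \<le> \<bar>x - a\<bar>"
proof -
  have "cis x - cis a = cis a * (cis (x - a) - 1)"
    by (simp add: right_diff_distrib cis_mult)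
  then have "cmod (cis x - cis a) = cmod (exp (\<i> * complex_of_real (x - a)) - 1)"
    by (simp add: norm_mult cis_conv_exp)
  also have "\<dots> = 2 * \<bar>sin ((x - a) / 2)\<bar>" by (rule dist_exp_i_1)
  also have "\<dots> \<le> \<bar>x - a\<bar>" using abs_sin_x_le_abs_x[of "(x - a) / 2"] by simp
  finally show ?thesis .
qed

lemma arc_character_near:
  assumes "x \<in> circle_arc N j" "N > 0"
  shows "\<bar>x - 2*pi * real j / real N\<bar> \<le> 2*pi / real N"
    and "cmod (character 1 x - cis (2*pi * real j / real N)) \<le> 2*pi / real N"
proof -
  have "2*pi * real (Suc j) / real N = 2*pi * real j / real N + 2*pi / real N"
    by (simp add: add_divide_distrib distrib_left)
  then show 1: "\<bar>x - 2*pi * real j / real N\<bar> \<le> 2*pi / real N"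
    using assms(1) unfolding circle_arc_def by auto
  show "cmod (character 1 x - cis (2*pi * real j / real N)) \<le> 2*pi / real N"
    using order_trans[OF cis_lipschitz 1] by (simp add: character_def)
qed

lemma arcs_partition: "N > 0 \<Longrightarrow> partition_mod_null N (circle_arc N)"
  unfolding partition_mod_null_def
proof (intro conjI allI impI)
  assume N: "N > 0"
  have ex: "\<exists>j<N. x \<in> circle_arc N j" if x: "x \<in> {0..<2*pi}" for x
  proof (rule ccontr)
    assume "\<not> ?thesis"
    then have "(\<Sum>j<N. indicator (circle_arc N j) x) = (0 :: real)" by (intro sum.neutral) auto
    then show False using sum_indicator_arcs[OF N x] by simp
  qed
  then show "AE x in circle. x \<in> (\<Union>i<N. circle_arc N i)" by (intro AE_I2) auto
  show "circle_arc N i \<in> sets circle" if "i < N" for i by (rule arc_circle[OF that])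
  fix i j assume "i < N" "j < N" "i \<noteq> j"
  have False if "x \<in> circle_arc N i" "x \<in> circle_arc N j" for x
  proof -
    have "x \<in> {0..<2*pi}" using arc_circle(1)[OF \<open>i < N\<close>] that(1) by (auto simp: sets_circle_iff)
    from sum_indicator_arcs[OF N this]
    have "(\<Sum>k\<in>{i, j}. indicator (circle_arc N k) x) \<le> (1 :: real)"
      using sum_mono2[of "{..<N}" "{i, j}" "\<lambda>k. indicator (circle_arc N k) x :: real"] \<open>i < N\<close> \<open>j
          < N\<close> by simp
    then show False using that \<open>i \<noteq> j\<close> by simp
  qed
  then have "circle_arc N i \<inter> circle_arc N j = {}" by blast
  then show "circle_arc N i \<inter> circle_arc N j \<in> null_sets circle" by simp
qed

lemma mult_indicator_bounded:
  "Y \<in> sets circle \<Longrightarrow> bounded_operator (mult_op (indicator Y))"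
  by (intro bounded_operator_mult bounded_measurable_Linfty bounded_measurable_indicator)

lemma L2_norm_indicator:
  assumes "Y \<in> sets circle"
  shows "(indicator Y :: real \<Rightarrow> complex) \<in> L2" "(L2_norm (indicator Y))\<^sup>2 = measure circle Y"
proof -
  show "(indicator Y :: real \<Rightarrow> complex) \<in> L2"
    by (intro bounded_measurable_L2 bounded_measurable_indicator assms)
  have "(\<lambda>x. (cmod (indicator Y x))\<^sup>2) = indicat_real Y" by (auto simp: indicator_def)
  then show "(L2_norm (indicator Y))\<^sup>2 = measure circle Y"
    using assms sets.sets_into_space[OF assms] unfolding L2_norm_power2 by (simp add: Int_absorb2)
qed

context weighted_operator
begin

abbreviation piece_norm :: "(real \<Rightarrow> complex) \<Rightarrow> real set \<Rightarrow> real" where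
  "piece_norm h Y \<equiv> operator_norm ((A \<circ> mult_op h) \<circ> mult_op (indicator Y))"

lemma energy_indicator:
  assumes h: "h \<in> L2" and Z: "Z \<in> sets circle"
  shows "energy (\<lambda>x. h x * indicator Z x) + t * (L2_norm (\<lambda>x. h x * indicator Z x))\<^sup>2 =
     (\<integral>x. indicator Z x * ((\<rho> x + t) * (cmod (h x))\<^sup>2) \<partial>circle)"
    and "integrable circle (\<lambda>x. indicator Z x * ((\<rho> x + t) * (cmod (h x))\<^sup>2))"
proof -
  have hZ: "(\<lambda>x. h x * indicator Z x) \<in> L2"
    using bounded_operator_L2[OF mult_indicator_bounded[OF Z] h] by (simp add: mult_op_def mult.commute)
  have eq: "indicator Z x * ((\<rho> x + t) * (cmod (h x))\<^sup>2) =
      \<rho> x * (cmod (h x * indicator Z x))\<^sup>2 + t * (cmod (h x * indicator Z x))\<^sup>2" for x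
    by (simp add: indicator_def distrib_right)
  show "integrable circle (\<lambda>x. indicator Z x * ((\<rho> x + t) * (cmod (h x))\<^sup>2))"
    unfolding eq by (intro Bochner_Integration.integrable_add integrable_mult_right
        energy_integrable L2_integrable hZ)
  show "energy (\<lambda>x. h x * indicator Z x) + t * (L2_norm (\<lambda>x. h x * indicator Z x))\<^sup>2 =
     (\<integral>x. indicator Z x * ((\<rho> x + t) * (cmod (h x))\<^sup>2) \<partial>circle)"
    unfolding eq energy_def L2_norm_power2
    by (subst Bochner_Integration.integral_add)
       (auto intro: energy_integrable[OF hZ] L2_integrable[OF hZ])
qed

text \<open>
  Cut every piece \<open>Y i\<close> along short arcs. On a part \<open>Z\<close> of \<open>Y i\<close> inside an arc, the indicator of \<open>Z\<close> is a
  test function of squared norm \<open>\<mu>(Z)\<close>, so the local principle gives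
  \<open>\<mu>(Z) \<parallel>A h \<pi>\<^sub>Y\<parallel>\<^sup>2 \<ge> \<integral>\<^sub>Z (\<rho> - e) |h|\<^sup>2\<close>. These inequalities add up.
\<close>

lemma partition_sum_lower:
  assumes h: "h \<in> L2" and hb: "h \<in> Linfty" and Y: "partition_mod_null K Y" and e: "e > 0"
  shows "energy h - e * (L2_norm h)\<^sup>2 \<le>
    (\<Sum>i<K. measure circle (Y i) * (piece_norm h (Y i))\<^sup>2)"
proof -
  obtain \<delta> where \<delta>: "\<delta> > 0" and loc: "\<And>h \<zeta>. h \<in> L2 \<Longrightarrow> cmod \<zeta> = 1 \<Longrightarrow>
      (\<And>x. x \<in> {0..<2*pi} \<Longrightarrow> h x = 0 \<or> cmod (character 1 x - \<zeta>) \<le> \<delta>) \<Longrightarrow>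
      \<bar>(L2_norm (A h))\<^sup>2 - energy h\<bar> \<le> e * (L2_norm h)\<^sup>2"
    using local_energy[OF e] by blast
  obtain N where N: "2*pi / \<delta> < real N" using reals_Archimedean2 by blast
  have N0: "N > 0" using order.strict_trans[OF divide_pos_pos[OF _ \<delta>, of "2*pi"] N] by simp
  have Nd: "2*pi / real N \<le> \<delta>" using N N0 \<delta> by (simp add: field_simps)
  define q where "q x = (\<rho> x + - e) * (cmod (h x))\<^sup>2" for x
  have Ys: "Y i \<in> sets circle" if "i < K" for i using Y that by (simp add: partition_mod_null_def)
  have Zs: "Y i \<inter> circle_arc N j \<in> sets circle" if "i < K" "j < N" for i j
    using Ys[OF that(1)] arc_circle(1)[OF that(2)] by blast
  have piece: "(\<integral>x. indicator (Y i \<inter> circle_arc N j) x * q x \<partial>circle) \<le>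
      measure circle (Y i \<inter> circle_arc N j) * (piece_norm h (Y i))\<^sup>2"
    if i: "i < K" and j: "j < N" for i j
  proof -
    define Z where "Z = Y i \<inter> circle_arc N j"
    have Z: "Z \<in> sets circle" unfolding Z_def by (rule Zs[OF i j])
    define T where "T = (A \<circ> mult_op h) \<circ> mult_op (indicator (Y i))"
    have T: "bounded_operator T"
      unfolding T_def by (intro bounded_operator_comp A_bounded bounded_operator_mult hb
          mult_indicator_bounded Ys i)
    have hZ: "(\<lambda>x. h x * indicator Z x) \<in> L2"
      using bounded_operator_L2[OF mult_indicator_bounded[OF Z] h] by (simp add: mult_op_def
          mult.commute)
    have "(\<lambda>x. h x * (indicator (Y i) x * indicator Z x)) = (\<lambda>x. h x * indicator Z x)"
      by (auto simp: Z_def indicator_def)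
    then have TZ: "T (indicator Z) = A (\<lambda>x. h x * indicator Z x)"
      by (simp add: T_def mult_op_def)
    have "\<bar>(L2_norm (A (\<lambda>x. h x * indicator Z x)))\<^sup>2 - energy (\<lambda>x. h x * indicator Z x)\<bar> \<le> e *
        (L2_norm (\<lambda>x. h x * indicator Z x))\<^sup>2"
    proof (rule loc[OF hZ, of "cis (2*pi * real j / real N)"])
      fix x
      show "h x * indicator Z x = 0 \<or> cmod (character 1 x - cis (2*pi * real j / real N)) \<le> \<delta>"
        using order_trans[OF arc_character_near(2)[OF _ N0] Nd, of x j] by (auto simp: Z_def
            indicator_def)
    qed simp
    then have "energy (\<lambda>x. h x * indicator Z x) + - e * (L2_norm (\<lambda>x. h x * indicator Z x))\<^sup>2 \<le>
        (L2_norm (T (indicator Z)))\<^sup>2"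
      unfolding TZ by linarith
    also have "\<dots> \<le> (operator_norm T * L2_norm (indicator Z))\<^sup>2"
      by (rule power_mono[OF operator_norm_upper(1)[OF T L2_norm_indicator(1)[OF Z]] L2_norm_nonneg])
    also have "\<dots> = measure circle Z * (operator_norm T)\<^sup>2"
      by (simp add: power_mult_distrib L2_norm_indicator(2)[OF Z])
    finally show ?thesis
      by (simp only: energy_indicator(1)[OF h Z] flip: q_def Z_def T_def)
  qed
  have total: "AE x in circle. (\<Sum>i<K. \<Sum>j<N. indicator (Y i \<inter> circle_arc N j) x * q x) = q x"
    using AE_sum_indicator_partition[OF Y] AE_space
  proof eventually_elim
    case (elim x)
    have "(\<Sum>i<K. \<Sum>j<N. indicator (Y i \<inter> circle_arc N j) x * q x) =
        (\<Sum>i<K. indicator (Y i) x) * (\<Sum>j<N. indicator (circle_arc N j) x) * q x"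
      unfolding sum_product by (simp only: sum_distrib_right indicator_inter_arith)
    also have "\<dots> = 1 * 1 * q x"
      using elim(2) by (simp only: elim(1) sum_indicator_arcs[OF N0] space_circle)
    finally show ?case by simp
  qed
  have qint: "integrable circle (\<lambda>x. indicator (Y i \<inter> circle_arc N j) x * q x)" if "i < K" "j < N"
      for i j
    unfolding q_def by (rule energy_indicator(2)[OF h Zs[OF that]])
  have qeq: "q = (\<lambda>x. \<rho> x * (cmod (h x))\<^sup>2 - e * (cmod (h x))\<^sup>2)"
    by (auto simp: q_def algebra_simps)
  have "energy h - e * (L2_norm h)\<^sup>2 = (\<integral>x. q x \<partial>circle)"
    unfolding qeq energy_def L2_norm_power2
    by (simp add: energy_integrable[OF h] L2_integrable[OF h])
  also have "\<dots> = (\<integral>x. (\<Sum>i<K. \<Sum>j<N. indicator (Y i \<inter> circle_arc N j) x * q x) \<partial>circle)"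
  proof (rule integral_cong_AE)
    show "q \<in> borel_measurable circle"
      unfolding qeq
      by (intro borel_measurable_integrable[OF Bochner_Integration.integrable_diff]
          energy_integrable integrable_mult_right L2_integrable h)
    show "(\<lambda>x. \<Sum>i<K. \<Sum>j<N. indicator (Y i \<inter> circle_arc N j) x * q x) \<in> borel_measurable circle"
      by (intro borel_measurable_sum borel_measurable_integrable[OF qint]) auto
  qed (use total in auto)
  also have "\<dots> = (\<Sum>i<K. \<Sum>j<N. \<integral>x. indicator (Y i \<inter> circle_arc N j) x * q x \<partial>circle)"
  proof -
    have "(\<integral>x. (\<Sum>i<K. \<Sum>j<N. indicator (Y i \<inter> circle_arc N j) x * q x) \<partial>circle) =
        (\<Sum>i<K. \<integral>x. (\<Sum>j<N. indicator (Y i \<inter> circle_arc N j) x * q x) \<partial>circle)"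
      by (intro Bochner_Integration.integral_sum Bochner_Integration.integrable_sum qint) auto
    also have "\<dots> = (\<Sum>i<K. \<Sum>j<N. \<integral>x. indicator (Y i \<inter> circle_arc N j) x * q x \<partial>circle)"
      by (intro sum.cong refl Bochner_Integration.integral_sum qint) auto
    finally show ?thesis .
  qed
  also have "\<dots> \<le> (\<Sum>i<K. \<Sum>j<N. measure circle (Y i \<inter> circle_arc N j) * (piece_norm h (Y i))\<^sup>2)"
    by (intro sum_mono piece) auto
  also have "\<dots> = (\<Sum>i<K. measure circle (Y i) * (piece_norm h (Y i))\<^sup>2)"
  proof (intro sum.cong refl)
    fix i assume "i \<in> {..<K}"
    then have i: "i < K" by simp
    have m: "measure circle Z = (\<integral>x. indicator Z x \<partial>circle)" if "Z \<in> sets circle" for Z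
      using sets.sets_into_space[OF that] by (simp add: Int_absorb2)
    have "(\<Sum>j<N. measure circle (Y i \<inter> circle_arc N j)) = (\<Sum>j<N. \<integral>x. indicator (Y i \<inter> circle_arc N
        j) x \<partial>circle)"
      by (intro sum.cong refl m Zs i) simp
    also have "\<dots> = (\<integral>x. (\<Sum>j<N. indicator (Y i \<inter> circle_arc N j) x) \<partial>circle)"
      by (intro Bochner_Integration.integral_sum[symmetric] integrable_real_indicator)
         (use Zs i in \<open>auto simp: less_top[symmetric]\<close>)
    also have "\<dots> = (\<integral>x. indicator (Y i) x \<partial>circle)"
    proof (intro Bochner_Integration.integral_cong refl)
      fix x assume "x \<in> space circle"
      then have "(\<Sum>j<N. indicator (circle_arc N j) x) = (1 :: real)" by (intro
          sum_indicator_arcs[OF N0]) simp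
      then show "(\<Sum>j<N. indicator (Y i \<inter> circle_arc N j) x) = (indicator (Y i) x :: real)"
        by (simp add: indicator_inter_arith sum_distrib_left[symmetric])
    qed
    finally have "(\<Sum>j<N. measure circle (Y i \<inter> circle_arc N j)) = measure circle (Y i)"
      using m[OF Ys[OF i]] by simp
    then show "(\<Sum>j<N. measure circle (Y i \<inter> circle_arc N j) * (piece_norm h (Y i))\<^sup>2) =
        measure circle (Y i) * (piece_norm h (Y i))\<^sup>2"
      by (simp add: sum_distrib_right[symmetric])
  qed
  finally show ?thesis .
qed

text \<open>
  On a short arc the operator norm squared is at most the supremum of a continuous version of
  \<open>(\<rho> + e) |h|\<^sup>2\<close>, so the sum over arcs is bounded by an upper Riemann sum.
\<close>

lemma arc_sum_upper:
  assumes h: "h \<in> L2" and hb: "h \<in> Linfty" and e: "e > 0"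
    and Q: "continuous_on {0..2*pi} Q" "AE x in circle. (cmod (h x))\<^sup>2 = Q x"
  obtains N where "N > 0"
    "(\<Sum>i<N. measure circle (circle_arc N i) * (piece_norm h (circle_arc N i))\<^sup>2)
      \<le> energy h + e * (L2_norm h)\<^sup>2 + 2 * e"
proof -
  obtain \<delta> where \<delta>: "\<delta> > 0" and loc: "\<And>h \<zeta>. h \<in> L2 \<Longrightarrow> cmod \<zeta> = 1 \<Longrightarrow>
      (\<And>x. x \<in> {0..<2*pi} \<Longrightarrow> h x = 0 \<or> cmod (character 1 x - \<zeta>) \<le> \<delta>) \<Longrightarrow>
      \<bar>(L2_norm (A h))\<^sup>2 - energy h\<bar> \<le> e * (L2_norm h)\<^sup>2"
    using local_energy[OF e] by blast
  define q where "q x = (\<rho> x + e) * Q x" for x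
  have "uniformly_continuous_on {0..2*pi} q"
    unfolding q_def by (intro compact_uniformly_continuous continuous_intros \<rho>_continuous Q) simp
  then obtain d where d: "d > 0"
    "\<And>x y. x \<in> {0..2*pi} \<Longrightarrow> y \<in> {0..2*pi} \<Longrightarrow> dist x y < d \<Longrightarrow> dist (q x) (q y) < e"
    unfolding uniformly_continuous_on_def using e by metis
  define \<eta> where "\<eta> = min \<delta> (d / 2)"
  have \<eta>: "\<eta> > 0" using \<delta> d(1) by (simp add: \<eta>_def)
  obtain N where N: "2*pi / \<eta> < real N" using reals_Archimedean2 by blast
  have N0: "N > 0" using order.strict_trans[OF divide_pos_pos[OF _ \<eta>, of "2*pi"] N] by simp
  have Nd: "2*pi / real N \<le> \<eta>" using N N0 \<eta> by (simp add: field_simps)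
  define a where "a i = 2*pi * real i / real N" for i
  have osc: "\<bar>q x - q (a i)\<bar> \<le> e" if "x \<in> circle_arc N i" "i < N" for x i
  proof -
    have "x \<in> {0..2*pi}" using arc_circle(1)[OF that(2)] that(1) by (auto simp: sets_circle_iff)
    moreover have "a i \<in> {0..2*pi}" using that(2) N0 by (simp add: a_def pos_divide_le_eq)
    moreover have "dist x (a i) < d"
      using order_trans[OF arc_character_near(1)[OF that(1) N0] Nd] d(1)
      by (simp add: dist_real_def a_def \<eta>_def)
    ultimately show ?thesis using d(2) by (fastforce simp: dist_real_def)
  qed
  have qhm: "(\<lambda>x. (\<rho> x + e) * (cmod (h x))\<^sup>2) \<in> borel_measurable circle"
    using \<rho>_measurable L2_measurable[OF h] by measurable
  have qeq: "AE x in circle. (\<rho> x + e) * (cmod (h x))\<^sup>2 = q x"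
    using Q(2) by eventually_elim (simp add: q_def)
  have opn: "(piece_norm h (circle_arc N i))\<^sup>2 \<le> q (a i) + e" if i: "i < N" for i
  proof -
    note J = arc_circle[OF i]
    have main: "(L2_norm (A (\<lambda>x. h x * (indicator (circle_arc N i) x * f x))))\<^sup>2 \<le> (q (a i) + e) *
        (L2_norm (\<lambda>x. indicator (circle_arc N i) x * f x))\<^sup>2"
      if f: "f \<in> L2" for f
    proof -
      have Jf: "(\<lambda>x. indicator (circle_arc N i) x * f x) \<in> L2"
        using bounded_operator_L2[OF mult_indicator_bounded[OF J(1)] f] by (simp add: mult_op_def)
      define k where "k x = h x * (indicator (circle_arc N i) x * f x)" for x
      have k: "k \<in> L2"
        using bounded_operator_L2[OF bounded_operator_mult[OF hb] Jf] by (simp add: mult_op_def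
            k_def[abs_def])
      have "\<bar>(L2_norm (A k))\<^sup>2 - energy k\<bar> \<le> e * (L2_norm k)\<^sup>2"
      proof (rule loc[OF k, of "cis (2*pi * real i / real N)"])
        fix x
        show "k x = 0 \<or> cmod (character 1 x - cis (2*pi * real i / real N)) \<le> \<delta>"
          using order_trans[OF arc_character_near(2)[OF _ N0] Nd, of x i] by (auto simp: k_def
              indicator_def \<eta>_def)
      qed simp
      then have "(L2_norm (A k))\<^sup>2 \<le> energy k + e * (L2_norm k)\<^sup>2" by linarith
      also have "\<dots> = (\<integral>x. \<rho> x * (cmod (k x))\<^sup>2 + e * (cmod (k x))\<^sup>2 \<partial>circle)"
        unfolding energy_def L2_norm_power2
        by (simp add: energy_integrable[OF k] L2_integrable[OF k])
      also have "\<dots> \<le> (\<integral>x. (q (a i) + e) * (cmod (indicator (circle_arc N i) x * f x))\<^sup>2 \<partial>circle)"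
      proof (rule integral_mono_AE)
        show "integrable circle (\<lambda>x. \<rho> x * (cmod (k x))\<^sup>2 + e * (cmod (k x))\<^sup>2)"
          by (intro Bochner_Integration.integrable_add integrable_mult_right energy_integrable
              L2_integrable k)
        show "integrable circle (\<lambda>x. (q (a i) + e) * (cmod (indicator (circle_arc N i) x * f x))\<^sup>2)"
          by (intro integrable_mult_right L2_integrable Jf)
        show "AE x in circle. \<rho> x * (cmod (k x))\<^sup>2 + e * (cmod (k x))\<^sup>2 \<le> (q (a i) + e) * (cmod
            (indicator (circle_arc N i) x * f x))\<^sup>2"
          using qeq
        proof eventually_elim
          case (elim x)
          have "\<rho> x * (cmod (k x))\<^sup>2 + e * (cmod (k x))\<^sup>2 = (\<rho> x + e) * (cmod (h x))\<^sup>2 * (cmod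
              (indicator (circle_arc N i) x * f x))\<^sup>2"
            by (simp add: k_def norm_mult power_mult_distrib algebra_simps)
          also have "\<dots> = q x * (cmod (indicator (circle_arc N i) x * f x))\<^sup>2" by (simp only: elim)
          also have "\<dots> \<le> (q (a i) + e) * (cmod (indicator (circle_arc N i) x * f x))\<^sup>2"
          proof (cases "x \<in> circle_arc N i")
            case True
            then have "q x \<le> q (a i) + e" using osc[OF True i] by linarith
            then show ?thesis by (intro mult_right_mono) auto
          qed simp
          finally show ?case .
        qed
      qed
      finally show ?thesis unfolding L2_norm_power2 k_def by simp
    qed
    have one: "(\<lambda>_. 1) \<in> L2" by (simp add: L2_def)
    (* The constant need not be positive a priori; testing with the indicator of the arc shows it. *)
    have "0 \<le> (q (a i) + e) * (1 / real N)"
      using order_trans[OF zero_le_power2 main[OF one]] L2_norm_indicator(2)[OF J(1)] J(2) by simp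
    then have nonneg: "0 \<le> q (a i) + e" using N0 by (simp add: zero_le_divide_iff)
    show ?thesis
    proof (rule operator_norm_least)
      fix f assume f: "f \<in> L2"
      have "(cmod (indicator (circle_arc N i) x))  \<le> 1" for x by (simp add: indicator_def)
      then have "L2_norm (\<lambda>x. indicator (circle_arc N i) x * f x) \<le> \<bar>1\<bar> * L2_norm f"
        by (intro L2_mult(2)[OF f] AE_I2) (use bounded_measurable_indicator[OF J(1)] in \<open>auto
            simp: bounded_measurable_def\<close>)
      then have "(L2_norm (\<lambda>x. indicator (circle_arc N i) x * f x))\<^sup>2 \<le> (L2_norm f)\<^sup>2"
        by (intro power_mono L2_norm_nonneg) simp
      then have "(q (a i) + e) * (L2_norm (\<lambda>x. indicator (circle_arc N i) x * f x))\<^sup>2 \<le> (q (a i) +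
          e) * (L2_norm f)\<^sup>2"
        by (rule mult_left_mono[OF _ nonneg])
      then show "(L2_norm (((A \<circ> mult_op h) \<circ> mult_op (indicator (circle_arc N i))) f))\<^sup>2 \<le> (q (a
          i) + e) * (L2_norm f)\<^sup>2"
        using main[OF f] by (simp add: mult_op_def)
    qed
  qed
  have qint: "integrable circle (\<lambda>x. (\<rho> x + e) * (cmod (h x))\<^sup>2)"
    unfolding distrib_right by (intro Bochner_Integration.integrable_add integrable_mult_right
        energy_integrable L2_integrable h)
  have piece: "measure circle (circle_arc N i) * (piece_norm h (circle_arc N i))\<^sup>2 \<le>
     (\<integral>x. indicator (circle_arc N i) x * ((\<rho> x + e) * (cmod (h x))\<^sup>2) \<partial>circle) + 2 * e * measure
         circle (circle_arc N i)" if i: "i < N" for i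
  proof -
    note J = arc_circle[OF i]
    have Jint: "integrable circle (indicator (circle_arc N i) :: real \<Rightarrow> real)"
      using J(1) by (intro integrable_real_indicator) (auto simp: less_top[symmetric])
    have m: "measure circle (circle_arc N i) = (\<integral>x. indicator (circle_arc N i) x \<partial>circle)"
      using sets.sets_into_space[OF J(1)] by (simp add: Int_absorb2)
    have "measure circle (circle_arc N i) * (piece_norm h (circle_arc N i))\<^sup>2 \<le>
        measure circle (circle_arc N i) * (q (a i) + e)"
      by (intro mult_left_mono opn i) simp
    also have "\<dots> = (\<integral>x. indicator (circle_arc N i) x * (q (a i) + e) \<partial>circle)"
      unfolding m by simp
    also have "\<dots> \<le> (\<integral>x. indicator (circle_arc N i) x * ((\<rho> x + e) * (cmod (h x))\<^sup>2) + 2 * e *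
        indicator (circle_arc N i) x \<partial>circle)"
    proof (rule integral_mono_AE)
      show "integrable circle (\<lambda>x. indicator (circle_arc N i) x * (q (a i) + e))"
        by (intro integrable_mult_left Jint)
      show "integrable circle (\<lambda>x. indicator (circle_arc N i) x * ((\<rho> x + e) * (cmod (h x))\<^sup>2) + 2
          * e * indicator (circle_arc N i) x)"
        by (intro Bochner_Integration.integrable_add energy_indicator(2)[OF h J(1)]
            integrable_mult_right Jint)
      show "AE x in circle. indicator (circle_arc N i) x * (q (a i) + e) \<le>
          indicator (circle_arc N i) x * ((\<rho> x + e) * (cmod (h x))\<^sup>2) + 2 * e * indicator
              (circle_arc N i) x"
        using qeq
      proof eventually_elim
        case (elim x)
        show ?case
          unfolding elim using osc[OF _ i, of x] by (cases "x \<in> circle_arc N i") auto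
      qed
    qed
    also have "\<dots> = (\<integral>x. indicator (circle_arc N i) x * ((\<rho> x + e) * (cmod (h x))\<^sup>2) \<partial>circle) + 2 *
        e * measure circle (circle_arc N i)"
      unfolding m using energy_indicator(2)[OF h J(1), of e] Jint by simp
    finally show ?thesis .
  qed
  have "(\<Sum>i<N. measure circle (circle_arc N i) * (piece_norm h (circle_arc N i))\<^sup>2) \<le>
     (\<Sum>i<N. (\<integral>x. indicator (circle_arc N i) x * ((\<rho> x + e) * (cmod (h x))\<^sup>2) \<partial>circle) + 2 * e *
         measure circle (circle_arc N i))"
    by (intro sum_mono piece) simp
  also have "\<dots> = (\<Sum>i<N. (\<integral>x. indicator (circle_arc N i) x * ((\<rho> x + e) * (cmod (h x))\<^sup>2) \<partial>circle))
      + 2 * e"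
    using N0 arc_circle(2) by (simp add: sum.distrib)
  also have "(\<Sum>i<N. (\<integral>x. indicator (circle_arc N i) x * ((\<rho> x + e) * (cmod (h x))\<^sup>2) \<partial>circle)) =
      (\<integral>x. (\<Sum>i<N. indicator (circle_arc N i) x * ((\<rho> x + e) * (cmod (h x))\<^sup>2)) \<partial>circle)"
    by (intro Bochner_Integration.integral_sum[symmetric] energy_indicator(2)[OF h] arc_circle) simp
  also have "\<dots> = (\<integral>x. \<rho> x * (cmod (h x))\<^sup>2 + e * (cmod (h x))\<^sup>2 \<partial>circle)"
  proof (intro Bochner_Integration.integral_cong refl)
    fix x assume "x \<in> space circle"
    then have "(\<Sum>i<N. indicator (circle_arc N i) x) = (1 :: real)" by (intro sum_indicator_arcs[OF
        N0]) simp
    then show "(\<Sum>i<N. indicator (circle_arc N i) x * ((\<rho> x + e) * (cmod (h x))\<^sup>2)) = \<rho> x * (cmod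
        (h x))\<^sup>2 + e * (cmod (h x))\<^sup>2"
      by (simp add: sum_distrib_right[symmetric] distrib_right)
  qed
  also have "\<dots> = energy h + e * (L2_norm h)\<^sup>2"
    unfolding energy_def L2_norm_power2 by (simp add: energy_integrable[OF h] L2_integrable[OF h])
  finally show thesis by (intro that[OF N0])
qed

text \<open>
  Applied with \<open>h = g2\<close>, whose squared modulus has a continuous version \<open>Q\<close>; continuity is what lets
  Riemann sums converge.
\<close>

theorem mu_norm_eq_energy:
  assumes h: "h \<in> Linfty" and Q: "continuous_on {0..2*pi} Q" "AE x in circle. (cmod (h x))\<^sup>2 = Q x"
  shows "(mu_norm (A \<circ> mult_op h))\<^sup>2 = energy h"
proof -
  have hL: "h \<in> L2"
  proof -
    have "(\<lambda>_. 1) \<in> L2" by (simp add: L2_def)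
    from bounded_operator_L2[OF bounded_operator_mult[OF h] this] show ?thesis by (simp add:
        mult_op_def)
  qed
  define S where "S = {\<Sum>i<K. measure circle (Y i) * (piece_norm h (Y i))\<^sup>2
      | K Y. partition_mod_null K Y}"
  have inS: "(\<Sum>i<K. measure circle (Y i) * (piece_norm h (Y i))\<^sup>2) \<in> S"
    if "partition_mod_null K Y" for K Y
    unfolding S_def by (intro CollectI exI conjI) (rule refl, rule that)
  have S0: "0 \<le> s" if "s \<in> S" for s using that unfolding S_def by (auto intro!: sum_nonneg)
  have bdd: "bdd_below S" by (rule bdd_belowI[OF S0])
  have ne: "S \<noteq> {}" using inS[OF arcs_partition[OF zero_less_one]] by blast
  define n where "n = (L2_norm h)\<^sup>2"
  have n: "n \<ge> 0" by (simp add: n_def)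
  have lower: "energy h \<le> s" if sS: "s \<in> S" for s
  proof (rule field_le_epsilon)
    fix e :: real assume e: "e > 0"
    obtain K Y where Y: "partition_mod_null K Y"
      "s = (\<Sum>i<K. measure circle (Y i) * (piece_norm h (Y i))\<^sup>2)"
      using sS unfolding S_def by (elim CollectE exE conjE) (rule that; assumption)
    have e': "e / (n + 1) > 0" using e n by simp
    have "energy h - e / (n + 1) * n \<le> s"
      using partition_sum_lower[OF hL h Y(1) e'] unfolding Y(2) n_def .
    moreover have "e / (n + 1) * n \<le> e" using e n by (simp add: field_simps)
    ultimately show "energy h \<le> s + e" by linarith
  qed
  have "Inf S \<le> energy h"
  proof (rule field_le_epsilon)
    fix e :: real assume e: "e > 0"
    have e': "e / (n + 2) > 0" using e n by simp
    obtain N where N: "N > 0"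
      "(\<Sum>i<N. measure circle (circle_arc N i) * (piece_norm h (circle_arc N i))\<^sup>2)
        \<le> energy h + e / (n + 2) * (L2_norm h)\<^sup>2 + 2 * (e / (n + 2))"
      by (rule arc_sum_upper[OF hL h e' Q])
    have "(\<Sum>i<N. measure circle (circle_arc N i) * (piece_norm h (circle_arc N i))\<^sup>2) \<in> S"
      by (rule inS[OF arcs_partition[OF N(1)]])
    from cInf_lower[OF this bdd] N(2)
    have "Inf S \<le> energy h + e / (n + 2) * n + 2 * (e / (n + 2))" unfolding n_def by linarith
    also have "\<dots> = energy h + e / (n + 2) * (n + 2)" 
    proof -
      have "E + t * n + 2 * t = E + t * (n + 2)" for E t :: real by (simp add: algebra_simps)
      then show ?thesis .
    qed
    also have "\<dots> = energy h + e" using n by simp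
    finally show "Inf S \<le> energy h + e" .
  qed
  moreover have "energy h \<le> Inf S" by (rule cInf_greatest[OF ne lower])
  ultimately have "Inf S = energy h" by simp
  moreover have "0 \<le> Inf S" by (rule cInf_greatest[OF ne S0])
  ultimately show ?thesis unfolding mu_norm_def S_def[symmetric] by simp
qed

end

section \<open>A space-filling curve with a measurable section\<close>

text \<open>
  Schoenberg's construction uses an even function of period 2 that vanishes on \<open>[0, 1/3]\<close> and equals 1
  on \<open>[2/3, 1]\<close>. Clipping a cosine gives one for which continuity and periodicity are evident.
\<close>

definition ramp :: "real \<Rightarrow> real" where
  "ramp t = max 0 (min 1 (1/2 - cos (pi * t)))"

lemma ramp_bounds: "0 \<le> ramp t" "ramp t \<le> 1"
  by (auto simp: ramp_def)

lemma ramp_even_shift: "ramp (2 * of_int k + t) = ramp t"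
proof -
  have "pi * (2 * of_int k + t) = pi * t + 2 * pi * of_int k" by (simp add: algebra_simps)
  moreover have "cos (pi * t + 2 * pi * of_int k) = cos (pi * t)"
    by (simp add: cos_add cos_int_2pin sin_int_2pin)
  ultimately show ?thesis by (simp add: ramp_def)
qed

lemma ramp_low: "0 \<le> t \<Longrightarrow> t \<le> 1/3 \<Longrightarrow> ramp t = 0"
proof -
  assume t: "0 \<le> t" "t \<le> 1/3"
  have "cos (pi / 3) \<le> cos (pi * t)"
    using t by (intro cos_monotone_0_pi_le) auto
  then show ?thesis by (simp add: ramp_def cos_60)
qed

lemma ramp_high: "2/3 \<le> t \<Longrightarrow> t \<le> 1 \<Longrightarrow> ramp t = 1"
proof -
  assume t: "2/3 \<le> t" "t \<le> 1"
  have "cos (pi * t) \<le> cos (pi * (2/3))"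
    using t by (intro cos_monotone_0_pi_le mult_left_mono) auto
  also have "cos (pi * (2/3)) = -1/2" using cos_120 by (simp add: field_simps)
  finally show ?thesis by (simp add: ramp_def)
qed

text \<open>
  For digits 0 and 1 these are the points of Cantor's ternary set.
\<close>

definition ternary :: "(nat \<Rightarrow> real) \<Rightarrow> real" where
  "ternary a = (\<Sum>j. 2 * a j / 3 ^ Suc j)"

lemma ternary_summable:
  assumes "\<And>j. a j \<in> {0, 1}"
  shows "summable (\<lambda>j. 2 * a j / 3 ^ Suc j :: real)"
proof (rule summable_comparison_test')
  show "summable (\<lambda>j. 2/3 * (1/3 :: real) ^ j)" by (intro summable_mult summable_geometric) simp
  show "norm (2 * a j / 3 ^ Suc j) \<le> 2/3 * (1/3) ^ j" for j
    using assms[of j] by (auto simp: power_divide)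
qed

lemma ternary_bounds:
  assumes "\<And>j. a j \<in> {0, 1}" shows "0 \<le> ternary a" "ternary a \<le> 1"
proof -
  have s: "(\<lambda>j. 2/3 * (1/3 :: real) ^ j) sums (2/3 * (1 / (1 - 1/3)))"
    by (intro sums_mult geometric_sums) simp
  have a: "0 \<le> a j" "a j \<le> 1" for j using assms[of j] by auto
  show "0 \<le> ternary a"
    unfolding ternary_def by (intro suminf_nonneg ternary_summable assms) (simp add: a)
  have "ternary a \<le> (\<Sum>j. 2/3 * (1/3 :: real) ^ j)"
    unfolding ternary_def
  proof (rule suminf_le[OF _ ternary_summable[OF assms] sums_summable[OF s]])
    show "2 * a j / 3 ^ Suc j \<le> 2/3 * (1/3) ^ j" for j
      using a(2)[of j] by (simp add: power_divide divide_right_mono)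
  qed
  also have "\<dots> = 1" using sums_unique[OF s] by simp
  finally show "ternary a \<le> 1" .
qed

lemma ternary_shift:
  assumes "\<And>j. a j \<in> {0, 1}"
  shows "3 * ternary a = 2 * a 0 + ternary (\<lambda>j. a (Suc j))"
proof -
  have "ternary a = 2 * a 0 / 3 + (\<Sum>j. 2 * a (Suc j) / 3 ^ Suc (Suc j))"
    unfolding ternary_def using suminf_split_head[of "\<lambda>j. 2 * a j / 3 ^ Suc j", OF
        ternary_summable[OF assms]] by simp
  also have "(\<Sum>j. 2 * a (Suc j) / 3 ^ Suc (Suc j)) = (\<Sum>j. 1/3 * (2 * a (Suc j) / 3 ^ Suc j))"
    by (simp add: field_simps)
  also have "\<dots> = 1/3 * ternary (\<lambda>j. a (Suc j))"
    unfolding ternary_def by (intro suminf_mult ternary_summable) (rule assms)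
  finally show ?thesis by simp
qed

text \<open>
  Modulo 2, the number \<open>3\<^sup>n ternary a\<close> lies in \<open>[0, 1/3]\<close> or in \<open>[2/3, 1]\<close> according to the digit
  \<open>a n\<close>, so that \<open>ramp\<close> reads off the digit.
\<close>

lemma ramp_ternary:
  assumes "\<And>j. a j \<in> {0, 1}"
  shows "ramp (3 ^ n * ternary a) = a n"
proof -
  have "\<exists>k::int. 3 ^ n * ternary a = 2 * of_int k + ternary (\<lambda>j. a (n + j))"
  proof (induction n)
    case 0
    show ?case by (intro exI[of _ 0]) simp
  next
    case (Suc n)
    then obtain k :: int where "3 ^ n * ternary a = 2 * of_int k + ternary (\<lambda>j. a (n + j))" by blast
    then have "3 ^ Suc n * ternary a = 2 * of_int (3 * k) + 3 * ternary (\<lambda>j. a (n + j))" by simp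
    also have "3 * ternary (\<lambda>j. a (n + j)) = 2 * a n + ternary (\<lambda>j. a (Suc n + j))"
      using ternary_shift[of "\<lambda>j. a (n + j)"] assms by simp
    also have "a n = of_int (if a n = 1 then 1 else 0)" using assms[of n] by auto
    finally show ?case
      by (intro exI[of _ "3 * k + (if a n = 1 then 1 else 0)"]) (simp add: algebra_simps)
  qed
  then obtain k :: int where "3 ^ n * ternary a = 2 * of_int k + ternary (\<lambda>j. a (n + j))" by blast
  then have eq: "ramp (3 ^ n * ternary a) = ramp (ternary (\<lambda>j. a (n + j)))"
    by (simp add: ramp_even_shift)
  define T where "T = ternary (\<lambda>j. a (Suc n + j))"
  have T: "0 \<le> T" "T \<le> 1" unfolding T_def by (intro ternary_bounds assms)+
  have e: "ternary (\<lambda>j. a (n + j)) = 2/3 * a n + T / 3"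
    using ternary_shift[of "\<lambda>j. a (n + j)"] assms by (simp add: T_def)
  show ?thesis
  proof (cases "a n = 0")
    case True
    then show ?thesis unfolding eq e using T by (simp add: ramp_low)
  next
    case False
    then have "a n = 1" using assms[of n] by auto
    then show ?thesis unfolding eq e using T by (simp add: ramp_high)
  qed
qed

text \<open>
  Coordinate \<open>i\<close> of the curve: the ternary digits at the positions congruent to \<open>i\<close> modulo 2 become
  binary digits.
\<close>

definition curve :: "nat \<Rightarrow> real \<Rightarrow> real" where
  "curve i t = (\<Sum>\<^sub>\<infinity>k. ramp (3 ^ (2 * k + i) * t) / 2 ^ Suc k)"

lemma half_powers: "(\<lambda>k. 1 / 2 ^ Suc k :: real) summable_on UNIV"
proof -
  have "summable (\<lambda>k. 1/2 * (1/2 :: real) ^ k)" by (intro summable_mult summable_geometric) simp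
  then have "summable (\<lambda>k. 1 / 2 ^ Suc k :: real)" by (simp add: power_divide)
  then show ?thesis by (subst summable_on_UNIV_nonneg_real_iff) auto
qed

lemma continuous_on_curve: "continuous_on UNIV (curve i)"
  unfolding continuous_on_sequentially
proof safe
  fix x :: "nat \<Rightarrow> real" and l assume x: "x \<longlonglongrightarrow> l"
  show "(curve i \<circ> x) \<longlonglongrightarrow> curve i l"
    unfolding o_def curve_def
  proof (rule infsum_dominated_convergence[OF half_powers])
    show "norm (ramp (3 ^ (2 * k + i) * x n) / 2 ^ Suc k) \<le> 1 / 2 ^ Suc k" for n k
      using ramp_bounds by (simp add: divide_right_mono)
    show "(\<lambda>n. ramp (3 ^ (2 * k + i) * x n) / 2 ^ Suc k) \<longlonglongrightarrow> ramp (3 ^ (2 * k + i) * l) / 2 ^ Suc k" for k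
      unfolding ramp_def by (intro tendsto_intros x) auto
  qed
qed

text \<open>
  In this form the partial sums of the binary expansion telescope, and measurability is that of the
  floor function.
\<close>

definition binary_digit :: "real \<Rightarrow> nat \<Rightarrow> real" where
  "binary_digit x k = of_int \<lfloor>2 ^ Suc k * x\<rfloor> - 2 * of_int \<lfloor>2 ^ k * x\<rfloor>"

lemma binary_digit_01: "binary_digit x k \<in> {0, 1}"
proof -
  have "\<lfloor>2 * (2 ^ k * x)\<rfloor> = 2 * \<lfloor>2 ^ k * x\<rfloor> \<or> \<lfloor>2 * (2 ^ k * x)\<rfloor> = 2 * \<lfloor>2 ^ k * x\<rfloor> + 1"
    by linarith
  then show ?thesis by (auto simp: binary_digit_def mult.assoc)
qed

lemma binary_expansion:
  assumes "0 \<le> x" "x < 1"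
  shows "(\<Sum>\<^sub>\<infinity>k. binary_digit x k / 2 ^ Suc k) = x"
proof -
  have part: "(\<Sum>k<n. binary_digit x k / 2 ^ Suc k) = of_int \<lfloor>2 ^ n * x\<rfloor> / 2 ^ n" for n
  proof -
    have "(\<Sum>k<n. binary_digit x k / 2 ^ Suc k) = (\<Sum>k<n. of_int \<lfloor>2 ^ Suc k * x\<rfloor> / 2 ^ Suc k -
        of_int \<lfloor>2 ^ k * x\<rfloor> / 2 ^ k)"
      by (intro sum.cong refl) (simp add: binary_digit_def field_simps)
    also have "\<dots> = of_int \<lfloor>2 ^ n * x\<rfloor> / 2 ^ n - of_int \<lfloor>2 ^ 0 * x\<rfloor> / 2 ^ 0"
      by (rule sum_lessThan_telescope)
    also have "\<lfloor>2 ^ 0 * x\<rfloor> = 0" using assms by (simp add: floor_eq_iff)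
    finally show ?thesis by simp
  qed
  have "(\<lambda>n. of_int \<lfloor>2 ^ n * x\<rfloor> / 2 ^ n) \<longlonglongrightarrow> x"
  proof (rule tendsto_sandwich)
    have "(\<lambda>n. x - (1/2) ^ n) \<longlonglongrightarrow> x - 0" by (intro tendsto_intros LIMSEQ_realpow_zero) auto
    then show "(\<lambda>n. x - (1/2) ^ n) \<longlonglongrightarrow> x" by simp
    show "eventually (\<lambda>n. x - (1/2) ^ n \<le> of_int \<lfloor>2 ^ n * x\<rfloor> / 2 ^ n) sequentially"
    proof (intro always_eventually allI)
      fix n :: nat
      have "2 ^ n * x - 1 \<le> of_int \<lfloor>2 ^ n * x\<rfloor>" by linarith
      then have "(2 ^ n * x - 1) / 2 ^ n \<le> of_int \<lfloor>2 ^ n * x\<rfloor> / 2 ^ n" by (intro divide_right_mono) auto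
      then show "x - (1/2) ^ n \<le> of_int \<lfloor>2 ^ n * x\<rfloor> / 2 ^ n"
        by (simp add: diff_divide_distrib power_divide)
    qed
    show "eventually (\<lambda>n. of_int \<lfloor>2 ^ n * x\<rfloor> / 2 ^ n \<le> x) sequentially"
    proof (intro always_eventually allI)
      fix n :: nat
      have "of_int \<lfloor>2 ^ n * x\<rfloor> / 2 ^ n \<le> 2 ^ n * x / 2 ^ n" by (intro divide_right_mono) auto
      then show "of_int \<lfloor>2 ^ n * x\<rfloor> / 2 ^ n \<le> x" by simp
    qed
  qed (rule tendsto_const)
  then have "(\<lambda>k. binary_digit x k / 2 ^ Suc k) sums x"
    unfolding sums_def part .
  moreover have nn: "0 \<le> binary_digit x k / 2 ^ Suc k" for k using binary_digit_01[of x k] by auto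
  ultimately show ?thesis
    by (intro infsumI) (subst sums_nonneg_imp_has_sum, auto)
qed

text \<open>
  The binary digits of the two coordinates are interleaved. Only points of the half-open unit square
  are claimed to be recovered, which suffices for the torus.
\<close>

definition curve_section :: "real \<Rightarrow> real \<Rightarrow> real" where
  "curve_section x y = ternary (\<lambda>j. binary_digit (if even j then x else y) (j div 2))"

lemma curve_section:
  assumes "0 \<le> x" "x < 1" "0 \<le> y" "y < 1"
  shows "curve 0 (curve_section x y) = x" "curve 1 (curve_section x y) = y"
    "0 \<le> curve_section x y" "curve_section x y \<le> 1"
proof -
  have ramp: "ramp (3 ^ n * curve_section x y) = binary_digit (if even n then x else y) (n div 2)" for n
    unfolding curve_section_def by (rule ramp_ternary) (rule binary_digit_01)
  show "curve 0 (curve_section x y) = x" "curve 1 (curve_section x y) = y"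
    unfolding curve_def ramp using binary_expansion assms by simp_all
  show "0 \<le> curve_section x y" "curve_section x y \<le> 1"
    unfolding curve_section_def by (intro ternary_bounds binary_digit_01)+
qed

lemma curve_section_measurable:
  "(\<lambda>z. curve_section (fst z) (snd z)) \<in> borel_measurable (borel \<Otimes>\<^sub>M borel)"
proof -
  have d: "(\<lambda>x. binary_digit x k) \<in> borel_measurable borel" for k
    unfolding binary_digit_def by measurable
  have "(\<lambda>z. binary_digit (if even j then fst z else snd z) (j div 2)) \<in> borel_measurable (borel
      \<Otimes>\<^sub>M borel)" for j
    using measurable_compose[OF measurable_fst d] measurable_compose[OF measurable_snd d]
    by (cases "even j") auto
  then show ?thesis
    unfolding curve_section_def ternary_def
    by (intro borel_measurable_suminf borel_measurable_divide borel_measurable_times) auto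
qed

section \<open>Weak compactness on the torus\<close>

abbreviation torus :: "(real \<times> real) measure" where
  "torus \<equiv> circle \<Otimes>\<^sub>M circle"

definition wrap :: "real \<Rightarrow> real" where
  "wrap y = y - 2 * pi * of_int \<lfloor>y / (2 * pi)\<rfloor>"

lemma wrap_mem: "wrap y \<in> {0..<2*pi}"
proof -
  have "of_int \<lfloor>y / (2*pi)\<rfloor> \<le> y / (2*pi)" "y / (2*pi) < of_int \<lfloor>y / (2*pi)\<rfloor> + 1" by linarith+
  then have "of_int \<lfloor>y / (2*pi)\<rfloor> * (2*pi) \<le> y" "y < (of_int \<lfloor>y / (2*pi)\<rfloor> + 1) * (2*pi)"
    by (simp_all only: pos_le_divide_eq pos_divide_less_eq pi_gt_zero mult_pos_pos zero_less_numeral)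
  then show ?thesis by (simp add: wrap_def algebra_simps)
qed

lemma character_wrap: "character k (wrap y) = character k y"
  using character_periodic[of k "wrap y" "\<lfloor>y / (2*pi)\<rfloor>"] by (simp add: wrap_def)

lemma wrap_measurable: "wrap \<in> borel_measurable borel"
  unfolding wrap_def [abs_def] by measurable

lemma space_torus: "space torus = {0..<2*pi} \<times> {0..<2*pi}"
  by (simp add: space_pair_measure)

lemma measurable_fst_circle: "fst \<in> borel_measurable torus"
  using measurable_compose[OF measurable_fst borel_measurable_circle[OF measurable_ident]] by simp

lemma measurable_snd_circle: "snd \<in> borel_measurable torus"
  using measurable_compose[OF measurable_snd borel_measurable_circle[OF measurable_ident]] by simp

definition torus_character :: "int \<Rightarrow> int \<Rightarrow> real \<times> real \<Rightarrow> complex" where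
  "torus_character m n z = cnj (character m (fst z)) * cnj (character n (snd z))"

lemma torus_character_measurable: "torus_character m n \<in> borel_measurable torus"
  unfolding torus_character_def [abs_def]
  by (intro borel_measurable_times measurable_compose[OF _ cnj_measurable]
      measurable_compose[OF measurable_fst_circle character_measurable]
      measurable_compose[OF measurable_snd_circle character_measurable])

lemma norm_torus_character [simp]: "cmod (torus_character m n z) = 1"
  by (simp add: torus_character_def norm_mult)

text \<open>
  The measures are pushed to the line by the section \<open>\<sigma>\<close> of the space-filling curve, where Helly's
  theorem provides a weak limit, and the limit is pushed back along the curve. The section is only
  measurable, but the curve is continuous, so a character of the torus composed with the curve is a
  continuous test function on the line, and composing it with \<open>\<sigma>\<close> gives the character back.
\<close>

lemma torus_measure_limit:
  assumes N: "\<And>L. finite_measure (N L)" "\<And>L. sets (N L) = sets torus"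
    and lim: "\<And>m n. (\<lambda>L::nat. \<integral>z. torus_character m n z \<partial>N L) \<longlonglongrightarrow> \<omega> m n"
  shows "\<exists>M. finite_measure M \<and> sets M = sets torus \<and>
    (\<forall>m n. (\<integral>z. torus_character m n z \<partial>M) = \<omega> m n)"
proof -
  define mass where "mass L = measure (N L) (space (N L))" for L
  have tc: "torus_character m n \<in> borel_measurable (N L)" for m n L
    using torus_character_measurable measurable_cong_sets[OF N(2) refl] by blast
  have le: "cmod (\<integral>z. torus_character m n z \<partial>N L) \<le> mass L" for m n L
  proof -
    interpret finite_measure "N L" by (rule N)
    have "cmod (\<integral>z. torus_character m n z \<partial>N L) \<le> (\<integral>z. cmod (torus_character m n z) \<partial>N L)"
      by (rule integral_norm_bound)
    then show ?thesis by (simp add: mass_def)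
  qed
  have m0: "(\<integral>z. torus_character 0 0 z \<partial>N L) = complex_of_real (mass L)" for L
    by (simp add: torus_character_def mass_def scaleR_conv_of_real)
  define c where "c = Re (\<omega> 0 0)"
  have massc: "mass \<longlonglongrightarrow> c"
    using tendsto_Re[OF lim[of 0 0]] unfolding m0 c_def by simp
  have c0: "0 \<le> c"
    using massc by (rule LIMSEQ_le_const) (auto simp: mass_def)
  show ?thesis
  proof (cases "c = 0")
    case True
    have "\<omega> m n = 0" for m n
    proof (rule LIMSEQ_unique[OF lim])
      show "(\<lambda>L. \<integral>z. torus_character m n z \<partial>N L) \<longlonglongrightarrow> 0"
        by (rule Lim_null_comparison[OF _ massc[unfolded True]]) (intro always_eventually allI le)
    qed
    moreover have "finite_measure (null_measure torus)" by (rule finite_measureI) simp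
    ultimately show ?thesis by (intro exI[of _ "null_measure torus"]) auto
  next
    case False
    then have cpos: "0 < c" using c0 by simp
    then have "eventually (\<lambda>L. 0 < mass L) sequentially"
      using massc by (intro order_tendstoD(1))
    then obtain L0 where L0: "\<And>L. L \<ge> L0 \<Longrightarrow> 0 < mass L"
      unfolding eventually_sequentially by blast
    define \<sigma> where "\<sigma> z = curve_section (fst z / (2*pi)) (snd z / (2*pi))" for z :: "real \<times> real"
    have \<sigma>P: "\<sigma> \<in> borel_measurable torus"
    proof -
      have "(\<lambda>z. (fst z / (2*pi), snd z / (2*pi))) \<in> torus \<rightarrow>\<^sub>M (borel \<Otimes>\<^sub>M borel)"
        by (intro measurable_Pair borel_measurable_divide measurable_fst_circle
            measurable_snd_circle) auto
      from measurable_compose[OF this curve_section_measurable] show ?thesis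
        by (simp add: \<sigma>_def[abs_def])
    qed
    have sp: "space (N L) = space torus" for L by (rule sets_eq_imp_space_eq[OF N(2)])
    (* Helly's theorem concerns probability measures, hence the normalisation;
       L0 skips vanishing masses. *)
    define D where "D L = density (N (L + L0)) (\<lambda>_. ennreal (1 / mass (L + L0)))" for L
    have sD: "sets (D L) = sets torus" for L by (simp add: D_def N(2))
    have spD: "space (D L) = space torus" for L by (rule sets_eq_imp_space_eq[OF sD])
    have \<sigma>: "\<sigma> \<in> borel_measurable (D L)" for L
      using \<sigma>P measurable_cong_sets[OF sD refl] by blast
    have probD: "prob_space (D L)" for L
    proof
      interpret finite_measure "N (L + L0)" by (rule N)
      have "emeasure (D L) (space (D L)) = ennreal (1 / mass (L + L0)) * emeasure (N (L + L0))
          (space (N (L + L0)))"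
        unfolding D_def by (subst emeasure_density_const) auto
      also have "\<dots> = 1"
        using L0[of "L + L0"] by (simp add: emeasure_eq_measure mass_def ennreal_mult[symmetric])
      finally show "emeasure (D L) (space (D L)) = 1" .
    qed
    define Q where "Q L = distr (D L) borel \<sigma>" for L
    have Qd: "real_distribution (Q L)" for L
    proof -
      interpret prob_space "D L" by (rule probD)
      show ?thesis unfolding Q_def by (intro real_distribution_distr \<sigma>)
    qed
    have Q1: "measure (Q L) {-1<..1} = 1" for L
    proof -
      interpret prob_space "D L" by (rule probD)
      have "\<sigma> -` {-1<..1} \<inter> space (D L) = space (D L)"
      proof -
        have "\<sigma> z \<in> {-1<..1}" if "z \<in> space (D L)" for z
        proof -
          have "fst z \<in> {0..<2*pi}" "snd z \<in> {0..<2*pi}"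
            using that unfolding spD space_torus by auto
          then have "0 \<le> \<sigma> z" "\<sigma> z \<le> 1"
            unfolding \<sigma>_def by (intro curve_section; simp)+
          then show ?thesis by simp
        qed
        then show ?thesis by blast
      qed
      then show ?thesis
        unfolding Q_def using prob_space by (subst measure_distr[OF \<sigma>]) auto
    qed
    have "tight Q"
      unfolding tight_def
    proof (intro conjI allI impI Qd)
      fix e :: real assume "e > 0"
      then show "\<exists>a b. a < b \<and> (\<forall>n. 1 - e < measure (Q n) {a<..b})"
        by (intro exI[of _ "-1"] exI[of _ 1]) (simp add: Q1)
    qed
    from tight_imp_convergent_subsubsequence[OF this strict_mono_id] obtain r M where
      r: "strict_mono r" and M: "real_distribution M" and wc: "weak_conv_m (Q \<circ> id \<circ> r) M"
      by blast
    define \<kappa> where "\<kappa> t = (wrap (2*pi * curve 0 t), wrap (2*pi * curve 1 t))" for t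
    have cm: "(\<lambda>t. wrap (2*pi * curve i t)) \<in> measurable M circle" for i
    proof (rule measurable_to_circle[OF _ wrap_mem])
      have "(\<lambda>t. 2*pi * curve i t) \<in> borel_measurable borel"
        by (intro borel_measurable_continuous_onI continuous_intros continuous_on_curve)
      from measurable_compose[OF this wrap_measurable]
      show "(\<lambda>t. wrap (2*pi * curve i t)) \<in> borel_measurable M"
        using measurable_cong_sets[OF real_distribution.events_eq_borel[OF M] refl] by blast
    qed
    have \<kappa>: "\<kappa> \<in> measurable M torus"
      unfolding \<kappa>_def by (intro measurable_Pair cm)
    define R where "R = density (distr M torus \<kappa>) (\<lambda>_. ennreal c)"
    have probM: "prob_space M" using M by (simp add: real_distribution_def)
    have "finite_measure R"
    proof (rule finite_measureI)
      interpret prob_space "distr M torus \<kappa>" by (rule prob_space.prob_space_distr[OF probM \<kappa>])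
      show "emeasure R (space R) \<noteq> \<infinity>"
        unfolding R_def using emeasure_space_1 by (subst emeasure_density_const) auto
    qed
    moreover have "sets R = sets torus" by (simp add: R_def)
    moreover have "(\<integral>z. torus_character m n z \<partial>R) = \<omega> m n" for m n
    proof -
      define F where "F t = torus_character m n (2*pi * curve 0 t, 2*pi * curve 1 t)" for t
      have Fk: "torus_character m n (\<kappa> t) = F t" for t
        by (simp add: torus_character_def \<kappa>_def F_def character_wrap)
      have "continuous_on UNIV F"
        unfolding F_def torus_character_def fst_conv snd_conv
        by (intro continuous_intros continuous_on_curve)
      then have cF: "isCont F t" for t by (simp add: continuous_on_eq_continuous_at)
      have Fm: "F \<in> borel_measurable borel"
        by (rule borel_measurable_continuous_onI) fact
      have rdQ: "real_distribution ((Q \<circ> id \<circ> r) k)" for k by (simp add: Qd)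
      have "(\<lambda>k. integral\<^sup>L ((Q \<circ> id \<circ> r) k) F) \<longlonglongrightarrow> integral\<^sup>L M F"
        by (rule weak_conv_imp_integral_bdd_continuous_conv[OF rdQ M wc cF, of 1]) (simp add: F_def)
      moreover have "integral\<^sup>L ((Q \<circ> id \<circ> r) k) F =
          (\<integral>z. torus_character m n z \<partial>N (r k + L0)) / mass (r k + L0)" for k
      proof -
        have "integral\<^sup>L ((Q \<circ> id \<circ> r) k) F = (\<integral>z. F (\<sigma> z) \<partial>D (r k))"
          unfolding Q_def o_def id_def by (rule integral_distr[OF \<sigma> Fm])
        also have "\<dots> = (\<integral>z. torus_character m n z \<partial>D (r k))"
        proof (intro Bochner_Integration.integral_cong refl)
          fix z assume "z \<in> space (D (r k))"
          then have "fst z \<in> {0..<2*pi}" "snd z \<in> {0..<2*pi}"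
            unfolding spD space_torus by auto
          then have "curve 0 (\<sigma> z) = fst z / (2*pi)" "curve 1 (\<sigma> z) = snd z / (2*pi)"
            unfolding \<sigma>_def by (intro curve_section; simp)+
          then show "F (\<sigma> z) = torus_character m n z" by (simp add: F_def torus_character_def)
        qed
        also have "\<dots> = (\<integral>z. (1 / mass (r k + L0)) *\<^sub>R torus_character m n z \<partial>N (r k + L0))"
          unfolding D_def
          by (rule integral_density[OF tc]) (auto simp: mass_def)
        finally show ?thesis by (simp add: scaleR_conv_of_real)
      qed
      moreover have "(\<lambda>k. (\<integral>z. torus_character m n z \<partial>N (r k + L0)) / mass (r k + L0)) \<longlonglongrightarrow> \<omega> m n / c"
      proof -
        have f: "filterlim (\<lambda>k. r k + L0) sequentially sequentially"
          by (rule filterlim_subseq) (use r in \<open>simp add: strict_mono_def\<close>)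
        show ?thesis
          by (intro tendsto_divide tendsto_of_real filterlim_compose[OF lim f]
              filterlim_compose[OF massc f])
             (use cpos in simp)
      qed
      ultimately have IF: "integral\<^sup>L M F = \<omega> m n / c"
        using LIMSEQ_unique by simp
      have "(\<integral>z. torus_character m n z \<partial>R) = (\<integral>z. c *\<^sub>R torus_character m n z \<partial>distr M torus \<kappa>)"
        unfolding R_def using c0
        by (intro integral_density) (auto intro: torus_character_measurable)
      also have "\<dots> = (\<integral>t. c *\<^sub>R F t \<partial>M)"
        unfolding Fk[symmetric]
        by (rule integral_distr[OF \<kappa>]) (intro borel_measurable_scaleR torus_character_measurable
            borel_measurable_const)
      also have "\<dots> = \<omega> m n"
        using cpos by (simp add: IF scaleR_conv_of_real)
      finally show ?thesis .
    qed
    ultimately show ?thesis by blast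
  qed
qed

section \<open>Existence of the measure and the marginals\<close>

lemma bounded_measurable_cnj: "bounded_measurable f \<Longrightarrow> bounded_measurable (\<lambda>x. cnj (f x))"
  unfolding bounded_measurable_def using measurable_compose[OF _ cnj_measurable] by auto

lemma torus_product:
  assumes f: "bounded_measurable f" and g: "bounded_measurable g"
  shows "integrable torus (\<lambda>z. f (fst z) * g (snd z))"
    and "(\<integral>z. f (fst z) * g (snd z) \<partial>torus) = (\<integral>x. f x \<partial>circle) * (\<integral>x. g x \<partial>circle)"
proof -
  interpret P: pair_prob_space circle circle by unfold_locales
  obtain C D where C: "\<forall>x\<in>{0..<2*pi}. cmod (f x) \<le> C" and D: "\<forall>x\<in>{0..<2*pi}. cmod (g x) \<le> D"
    and fm: "f \<in> borel_measurable circle" and gm: "g \<in> borel_measurable circle"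
    using f g unfolding bounded_measurable_def by blast
  have m: "(\<lambda>z. f (fst z) * g (snd z)) \<in> borel_measurable torus"
    by (intro borel_measurable_times measurable_compose[OF measurable_fst fm]
        measurable_compose[OF measurable_snd gm])
  show int: "integrable torus (\<lambda>z. f (fst z) * g (snd z))"
  proof (rule P.integrable_const_bound[OF AE_I2 m])
    fix z assume "z \<in> space torus"
    then have "cmod (f (fst z)) \<le> C" "cmod (g (snd z)) \<le> D"
      using C D unfolding space_torus by auto
    then show "norm (f (fst z) * g (snd z)) \<le> C * D"
      unfolding norm_mult by (intro mult_mono) (auto intro: order_trans[OF norm_ge_zero])
  qed
  have "(\<integral>z. f (fst z) * g (snd z) \<partial>torus) = (\<integral>x. (\<integral>y. f x * g y \<partial>circle) \<partial>circle)"
    using P.integral_fst'[OF int] by simp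
  then show "(\<integral>z. f (fst z) * g (snd z) \<partial>torus) = (\<integral>x. f x \<partial>circle) * (\<integral>x. g x \<partial>circle)"
    by simp
qed

lemma finite_measure_density_bounded:
  assumes "finite_measure M" and v: "v \<in> borel_measurable M" "\<And>z. z \<in> space M \<Longrightarrow> v z \<le> (C :: real)"
  shows "finite_measure (density M (\<lambda>z. ennreal (v z)))"
proof (rule finite_measureI)
  interpret finite_measure M by fact
  have "emeasure (density M (\<lambda>z. ennreal (v z))) (space M) = (\<integral>\<^sup>+z. ennreal (v z) \<partial>M)"
    using v by (subst emeasure_density) (auto intro!: nn_integral_cong)
  also have "\<dots> \<le> (\<integral>\<^sup>+z. ennreal C \<partial>M)" by (intro nn_integral_mono ennreal_leI v)
  also have "\<dots> = ennreal C * emeasure M (space M)" by simp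
  also have "\<dots> < \<infinity>"
  proof -
    have "emeasure M (space M) < \<infinity>" using emeasure_finite less_top by (metis infinity_ennreal_def)
    then show ?thesis by (simp add: ennreal_mult_less_top)
  qed
  finally show "emeasure (density M (\<lambda>z. ennreal (v z))) (space (density M (\<lambda>z. ennreal (v z)))) \<noteq>
      \<infinity>" by simp
qed

lemma norm_sum_diff_window:
  assumes "\<And>l. cmod (f l) \<le> B"
  shows "cmod ((\<Sum>l<L. if 0 \<le> int l + m \<and> int l + m < int L then f l else 0) - (\<Sum>l<L. f l)) \<le>
      \<bar>real_of_int m\<bar> * B"
proof -
  define S where "S = {l. l < L \<and> \<not> (0 \<le> int l + m \<and> int l + m < int L)}"
  have "finite S" "card S \<le> nat \<bar>m\<bar>"
  proof -
    have sub: "S \<subseteq> (if m \<ge> 0 then {L - nat m..<L} else {..<nat (-m)})"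
      by (auto simp: S_def)
    show "finite S" unfolding S_def by simp
    have "card S \<le> card (if m \<ge> 0 then {L - nat m..<L} else {..<nat (-m)})"
      by (rule card_mono[OF _ sub]) simp
    also have "\<dots> \<le> nat \<bar>m\<bar>" by auto
    finally show "card S \<le> nat \<bar>m\<bar>" .
  qed
  have B: "0 \<le> B" using order_trans[OF norm_ge_zero assms] .
  have "(\<Sum>l<L. if 0 \<le> int l + m \<and> int l + m < int L then f l else 0) - (\<Sum>l<L. f l) =
      (\<Sum>l<L. if l \<in> S then - f l else 0)"
    unfolding sum_subtractf[symmetric] by (intro sum.cong refl) (auto simp: S_def)
  also have "\<dots> = (\<Sum>l\<in>S. - f l)"
    by (subst sum.inter_filter[symmetric]) (auto simp: S_def intro!: sum.cong)
  also have "cmod \<dots> \<le> real (card S) * B"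
    by (rule sum_norm_bound) (simp add: assms)
  also have "\<dots> \<le> \<bar>real_of_int m\<bar> * B"
    using \<open>card S \<le> nat \<bar>m\<bar>\<close> B by (intro mult_right_mono) linarith+
  finally show ?thesis .
qed

context regular_operator
begin

definition row_series :: "int \<Rightarrow> real \<Rightarrow> complex" where
  "row_series l = fourier_series (\<lambda>j. entry l (- j))"

lemma row_summable: "abs_summable (\<lambda>j. entry l (- j))"
proof (rule abs_summable_bounded(1))
  show "(\<lambda>j. diag_sup (j + l)) summable_on UNIV"
    unfolding summable_on_int_shift by (rule c_summable)
  show "cmod (entry l (- j)) \<le> diag_sup (j + l)" for j
    using entry_le[of l "- j"] by (simp add: add.commute)
qed

lemma row_series_inner:
  "(\<integral>x. character (- n) x * (row_series l x * cnj (row_series l' x)) \<partial>circle) =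
     (\<Sum>\<^sub>\<infinity>j. entry l j * cnj (entry l' (j + n)))"
proof -
  have "(\<integral>x. character (- n) x * (row_series l x * cnj (row_series l' x)) \<partial>circle) =
     (\<Sum>\<^sub>\<infinity>j. entry l (- j) * cnj (entry l' (- (j + - n))))"
    unfolding row_series_def by (rule integral_fourier_series_cnj[OF row_summable row_summable])
  also have "\<dots> = (\<Sum>\<^sub>\<infinity>j. entry l (0 - j) * cnj (entry l' ((0 - j) + n)))"
    by (intro infsum_cong) (simp add: algebra_simps)
  also have "\<dots> = (\<Sum>\<^sub>\<infinity>j. entry l j * cnj (entry l' (j + n)))"
    by (rule summable_on_int_shift(4))
  finally show ?thesis .
qed

text \<open>
  The squared modulus of the double Fourier series of \<open>L\<close> rows of \<open>W\<close>; being a square, it is a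
  nonnegative density.
\<close>

definition periodogram :: "nat \<Rightarrow> real \<times> real \<Rightarrow> real" where
  "periodogram L z = (cmod (\<Sum>l<L. character (int l) (fst z) * row_series (int l) (snd z)))\<^sup>2 / real L"

lemma bm_row: "bounded_measurable (row_series l)"
  unfolding row_series_def by (rule bounded_measurable_fourier_series[OF row_summable])

lemma bm_char: "bounded_measurable (character k)"
  by (intro bounded_measurable_trig_poly trig_poly.character)

lemma periodogram_expansion:
  "periodogram L z *\<^sub>R torus_character m n z =
     (\<Sum>l<L. \<Sum>l'<L. (character (int l - int l' - m) (fst z) *
        (character (- n) (snd z) * (row_series (int l) (snd z) * cnj (row_series (int l') (snd
            z)))))) / of_nat L"
proof -
  have "complex_of_real ((cmod (\<Sum>l<L. character (int l) (fst z) * row_series (int l) (snd z)))\<^sup>2) =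
      (\<Sum>l<L. \<Sum>l'<L. (character (int l) (fst z) * row_series (int l) (snd z)) *
         (character (- int l') (fst z) * cnj (row_series (int l') (snd z))))"
    unfolding complex_norm_square cnj_sum complex_cnj_mult cnj_character by (rule sum_product)
  then have "periodogram L z *\<^sub>R torus_character m n z =
     (\<Sum>l<L. \<Sum>l'<L. (character (int l) (fst z) * row_series (int l) (snd z)) *
         (character (- int l') (fst z) * cnj (row_series (int l') (snd z)))) * torus_character m n
             z / of_nat L"
    by (simp only: periodogram_def scaleR_conv_of_real of_real_divide of_real_of_nat_eq
        times_divide_eq_left)
  also have "\<dots> = (\<Sum>l<L. \<Sum>l'<L. (character (int l - int l' - m) (fst z) *
        (character (- n) (snd z) * (row_series (int l) (snd z) * cnj (row_series (int l') (snd
            z)))))) / of_nat L"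
    unfolding sum_distrib_right
    by (intro arg_cong2[where f = "(/)"] sum.cong refl)
       (simp add: torus_character_def cnj_character character_add diff_conv_add_uminus del:
           add_uminus_conv_diff)
  finally show ?thesis .
qed

text \<open>
  A pair of rows contributes only if both lie in the window, which loses at most \<open>|m|\<close> of the \<open>L\<close>
  terms of the correlation mean.
\<close>

lemma integral_periodogram:
  "(\<integral>z. periodogram L z *\<^sub>R torus_character m n z \<partial>torus) =
     (\<Sum>l<L. if 0 \<le> int l + m \<and> int l + m < int L then row_corr m n (int l) else 0) / of_nat L"
proof -
  define X where "X l l' = (\<Sum>\<^sub>\<infinity>j. entry (int l) j * cnj (entry (int l') (j + n)))" for l l' :: nat
  define H where "H l l' z = character (int l - int l' - m) (fst z) *
        (character (- n) (snd z) * (row_series (int l) (snd z) * cnj (row_series (int l') (snd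
            z))))" for l l' :: nat and z
  have bm2: "bounded_measurable (\<lambda>x. character (- n) x * (row_series (int l) x * cnj (row_series
      (int l') x)))" for l l' :: nat
    by (intro bounded_measurable_mult bm_char bm_row bounded_measurable_cnj)
  have H: "integrable torus (H l l')"
    "(\<integral>z. H l l' z \<partial>torus) = (if int l = int l' + m then X l l' else 0)" for l l'
  proof -
    show "integrable torus (H l l')"
      unfolding H_def by (rule torus_product(1)[OF bm_char bm2])
    have "(\<integral>z. H l l' z \<partial>torus) = (if int l - int l' - m = 0 then 1 else 0) * X l l'"
      unfolding H_def torus_product(2)[OF bm_char bm2] integral_character row_series_inner X_def ..
    then show "(\<integral>z. H l l' z \<partial>torus) = (if int l = int l' + m then X l l' else 0)"
      by (auto simp: algebra_simps)
  qed
  have "(\<integral>z. periodogram L z *\<^sub>R torus_character m n z \<partial>torus) =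
      (\<integral>z. (\<Sum>l<L. \<Sum>l'<L. H l l' z) / of_nat L \<partial>torus)"
    unfolding periodogram_expansion H_def ..
  also have "\<dots> = (\<Sum>l<L. \<Sum>l'<L. \<integral>z. H l l' z \<partial>torus) / of_nat L"
  proof -
    have "(\<integral>z. (\<Sum>l<L. \<Sum>l'<L. H l l' z) \<partial>torus) = (\<Sum>l<L. \<integral>z. (\<Sum>l'<L. H l l' z) \<partial>torus)"
      by (intro Bochner_Integration.integral_sum Bochner_Integration.integrable_sum H)
    also have "\<dots> = (\<Sum>l<L. \<Sum>l'<L. \<integral>z. H l l' z \<partial>torus)"
      by (intro sum.cong refl Bochner_Integration.integral_sum H)
    finally show ?thesis by simp
  qed
  also have "(\<Sum>l<L. \<Sum>l'<L. \<integral>z. H l l' z \<partial>torus) = (\<Sum>l'<L. \<Sum>l<L. if int l = int l' + m then X l l'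
      else 0)"
    unfolding H by (rule sum.swap)
  also have "\<dots> = (\<Sum>l<L. if 0 \<le> int l + m \<and> int l + m < int L then row_corr m n (int l) else 0)"
  proof (intro sum.cong refl)
    fix l'
    show "(\<Sum>l<L. if int l = int l' + m then X l l' else 0) =
      (if 0 \<le> int l' + m \<and> int l' + m < int L then row_corr m n (int l') else 0)"
    proof (cases "0 \<le> int l' + m \<and> int l' + m < int L")
      case True
      define k where "k = nat (int l' + m)"
      have k: "k < L" "int k = int l' + m" using True by (auto simp: k_def)
      have "(\<Sum>l<L. if int l = int l' + m then X l l' else 0) = (\<Sum>l<L. if l = k then X l l' else 0)"
        using k(2) by (intro sum.cong refl) auto
      also have "\<dots> = X k l'" using k(1) by simp
      also have "\<dots> = row_corr m n (int l')"
        unfolding X_def row_corr_def k(2) ..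
      finally show ?thesis using True by simp
    next
      case False
      have "(\<Sum>l<L. if int l = int l' + m then X l l' else 0) = (\<Sum>l<L. 0)"
        using False by (intro sum.cong refl) auto
      then show ?thesis unfolding if_not_P[OF False] by simp
    qed
  qed
  finally show ?thesis .
qed

lemma periodogram_coeff_tendsto:
  "(\<lambda>L. \<integral>z. periodogram L z *\<^sub>R torus_character m n z \<partial>torus) \<longlonglongrightarrow> omega W m n"
proof -
  have "(\<lambda>L. window_mean L 0 (row_corr m n)) \<longlonglongrightarrow> omega W m n"
  proof (rule LIMSEQ_I)
    fix e :: real assume "e > 0"
    then have "e/2 > 0" by simp
    from row_mean_uniform[OF this] obtain L0 where
      L0: "\<And>L j. L \<ge> L0 \<Longrightarrow> cmod (window_mean L j (row_corr m n) - omega W m n) \<le> e/2"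
      by blast
    show "\<exists>L0. \<forall>L\<ge>L0. norm (window_mean L 0 (row_corr m n) - omega W m n) < e"
      by (intro exI[of _ L0] allI impI order.strict_trans1[OF L0]) (use \<open>e > 0\<close> in auto)
  qed
  moreover have "(\<lambda>L. (\<integral>z. periodogram L z *\<^sub>R torus_character m n z \<partial>torus) - window_mean L 0
      (row_corr m n)) \<longlonglongrightarrow> 0"
  proof (rule Lim_null_comparison[OF always_eventually])
    show "(\<lambda>L. \<bar>real_of_int m\<bar> * corr_bound (m + n) / real L) \<longlonglongrightarrow> 0" by (rule lim_const_over_n)
    show "\<forall>L. norm ((\<integral>z. periodogram L z *\<^sub>R torus_character m n z \<partial>torus) - window_mean L 0
        (row_corr m n))
        \<le> \<bar>real_of_int m\<bar> * corr_bound (m + n) / real L"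
    proof
      fix L
      show "norm ((\<integral>z. periodogram L z *\<^sub>R torus_character m n z \<partial>torus) - window_mean L 0
          (row_corr m n))
        \<le> \<bar>real_of_int m\<bar> * corr_bound (m + n) / real L"
        unfolding integral_periodogram window_mean_def add_0 diff_divide_distrib[symmetric]
            norm_divide norm_of_nat
        by (intro divide_right_mono norm_sum_diff_window row_corr_le) simp
    qed
  qed
  ultimately show ?thesis by (rule Lim_transform)
qed

text \<open>
  The choice in the definition of \<open>nu\<close> is legitimate because the limit of the periodograms is a
  witness.
\<close>

lemma nu_properties:
  "finite_measure (nu W)" "sets (nu W) = sets torus"
  "(\<integral>z. torus_character m n z \<partial>nu W) = omega W m n"
proof -
  interpret P: pair_prob_space circle circle by unfold_locales
  define N where "N L = density torus (\<lambda>z. ennreal (periodogram L z))" for L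
  have pm: "periodogram L \<in> borel_measurable torus" for L
  proof -
    have "row_series (int l) \<in> borel_measurable borel" for l
      unfolding row_series_def by (rule fourier_series_measurable[OF row_summable])
    then have "(\<lambda>z. \<Sum>l<L. character (int l) (fst z) * row_series (int l) (snd z)) \<in>
        borel_measurable torus"
      by (intro borel_measurable_sum borel_measurable_times measurable_compose[OF
          measurable_fst_circle character_measurable]
          measurable_compose[OF measurable_snd_circle])
    from measurable_compose[OF this borel_measurable_norm] show ?thesis
      unfolding periodogram_def
      by (intro borel_measurable_divide borel_measurable_power borel_measurable_const)
  qed
  have "\<exists>C. \<forall>z. periodogram L z \<le> C" for L
  proof -
    define c where "c l = (\<Sum>\<^sub>\<infinity>j. cmod (entry l (- j)))" for l
    have "cmod (\<Sum>l<L. character (int l) (fst z) * row_series (int l) (snd z)) \<le> (\<Sum>l<L. c (int l))"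
        for z :: "real \<times> real"
      by (rule sum_norm_le) (simp add: norm_mult c_def row_series_def norm_fourier_series_le
          row_summable)
    then have "periodogram L z \<le> (\<Sum>l<L. c (int l))\<^sup>2 / real L" for z
      unfolding periodogram_def by (intro divide_right_mono power_mono) auto
    then show ?thesis by blast
  qed
  then obtain C where C: "\<And>L z. periodogram L z \<le> C L" by metis
  have fin: "finite_measure (N L)" for L
    unfolding N_def by (rule finite_measure_density_bounded[OF P.finite_measure_axioms pm C])
  have "sets (N L) = sets torus" for L by (simp add: N_def)
  moreover have "(\<integral>z. torus_character m n z \<partial>N L) = (\<integral>z. periodogram L z *\<^sub>R torus_character m n z
      \<partial>torus)" for m n L
    unfolding N_def
    by (rule integral_density[OF torus_character_measurable pm]) (simp add: periodogram_def)
  ultimately have "\<exists>M. finite_measure M \<and> sets M = sets torus \<and> (\<forall>m n. (\<integral>z. torus_character m n z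
      \<partial>M) = omega W m n)"
    using periodogram_coeff_tendsto by (intro torus_measure_limit[of N] fin) auto
  then have "\<exists>N. finite_measure N \<and> space N = space torus \<and> sets N = sets torus \<and>
      (\<forall>m n. (\<integral>z. cnj (character m (fst z)) * cnj (character n (snd z)) \<partial>N) = omega W m n)"
    unfolding torus_character_def by (metis sets_eq_imp_space_eq)
  from someI_ex[OF this, folded nu_def]
  show "finite_measure (nu W)" "sets (nu W) = sets torus" "(\<integral>z. torus_character m n z \<partial>nu W) =
      omega W m n"
    unfolding torus_character_def by blast+
qed

lemma nu_measurable: "f \<in> measurable torus M \<Longrightarrow> f \<in> measurable (nu W) M"
  using measurable_cong_sets[OF nu_properties(2) refl] by blast

lemma AE_nu_coordinate:
  assumes f: "f \<in> measurable (nu W) circle"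
    and coeff: "abs_summable (\<lambda>n. \<integral>z. cnj (character n (f z)) \<partial>nu W)"
    and P: "AE x in circle. P x"
  shows "AE z in nu W. P (f z)"
proof -
  interpret finite_measure "nu W" by (rule nu_properties)
  have "(\<integral>x. cnj (character n x) \<partial>distr (nu W) circle f) = (\<integral>z. cnj (character n (f z)) \<partial>nu W)" for n
    by (rule integral_distr[OF f]) (simp add: cnj_character borel_measurable_circle)
  then have "abs_summable (\<lambda>n. \<integral>x. cnj (character n x) \<partial>distr (nu W) circle f)"
    by (simp only: coeff)
  then have "AE x in distr (nu W) circle f. P x"
    by (rule AE_of_summable_fourier_coeff[OF finite_measure_distr[OF f] sets_distr _ P])
  then show ?thesis by (rule AE_distrD[OF f])
qed

lemma
  assumes "AE x in circle. P x"
  shows AE_nu_fst: "AE z in nu W. P (fst z)" and AE_nu_snd: "AE z in nu W. P (snd z)"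
proof -
  have "(\<integral>z. cnj (character n (fst z)) \<partial>nu W) = omega W n 0" for n
    using nu_properties(3)[of n 0] by (simp add: torus_character_def)
  then show "AE z in nu W. P (fst z)"
    using omega_marginals_summable(1)
    by (intro AE_nu_coordinate[OF nu_measurable[OF measurable_fst] _ assms]) (simp only:)
  have "(\<integral>z. cnj (character n (snd z)) \<partial>nu W) = omega W 0 n" for n
    using nu_properties(3)[of 0 n] by (simp add: torus_character_def)
  then show "AE z in nu W. P (snd z)"
    using omega_marginals_summable(2)
    by (intro AE_nu_coordinate[OF nu_measurable[OF measurable_snd] _ assms]) (simp only:)
qed

end

context weighted_operator
begin

text \<open>
  Both sides equal \<open>\<Sum>\<^sub>k \<beta>\<^sub>k r\<^sub>-\<^sub>k\<close>, where \<open>\<beta>\<close> are the Fourier coefficients of \<open>|h|\<^sup>2\<close>. Replacing the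
  functions by their Fourier series under \<open>nu W\<close> is possible because null sets of the circle lift to
  null sets of \<open>nu W\<close> in either coordinate.
\<close>

lemma nu_integral_eq_energy:
  assumes h: "h \<in> L2" and hA: "(\<lambda>x. complex_of_real ((cmod (h x))\<^sup>2)) \<in> ACF"
  shows "(\<integral>z. (cmod (g (fst z)))\<^sup>2 * (cmod (h (snd z)))\<^sup>2 \<partial>nu W) = energy h"
proof -
  define \<beta> where "\<beta> = fourier_coeff (\<lambda>x. complex_of_real ((cmod (h x))\<^sup>2))"
  have \<beta>: "abs_summable \<beta>" and heq: "AE x in circle. complex_of_real ((cmod (h x))\<^sup>2) =
      fourier_series \<beta> x"
    using ACF_eq_fourier_series[OF hA] by (auto simp: \<beta>_def)
  define \<alpha> where "\<alpha> m = \<gamma> (- m)" for m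
  have \<alpha>: "abs_summable \<alpha>" unfolding \<alpha>_def by (rule \<gamma>_minus_summable)
  have geq: "AE x in circle. complex_of_real ((cmod (g x))\<^sup>2) = fourier_series \<alpha> x"
    using abs_square_g by (simp add: \<alpha>_def[abs_def])
  note hm = L2_measurable[OF h]
  have fstm: "fst \<in> borel_measurable (nu W)" and sndm: "snd \<in> borel_measurable (nu W)"
    by (intro nu_measurable measurable_fst_circle measurable_snd_circle)+
  have fsm: "(\<lambda>z. fourier_series a (f z)) \<in> borel_measurable (nu W)"
    if "abs_summable a" "f \<in> borel_measurable (nu W)" for a f
    by (rule measurable_compose[OF that(2) fourier_series_measurable[OF that(1)]])
  have coeff: "(\<integral>z. character m (fst z) * character k (snd z) \<partial>nu W) = omega W (- m) (- k)" for m k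
    using nu_properties(3)[of "- m" "- k"] by (simp add: torus_character_def cnj_character)
  have inner: "(\<integral>z. character k (snd z) * fourier_series \<alpha> (fst z) \<partial>nu W) = r (- k)" for k
  proof -
    have "(\<integral>z. fourier_series \<alpha> (fst z) * character k (snd z) \<partial>nu W) =
        (\<Sum>\<^sub>\<infinity>m. \<alpha> m * (\<integral>z. character m (fst z) * character k (snd z) \<partial>nu W))"
      by (rule fourier_series_integral[OF nu_properties(1) measurable_compose[OF sndm
          character_measurable] _ fstm \<alpha>, of k 1]) simp
    also have "\<dots> = (\<Sum>\<^sub>\<infinity>m. \<gamma> (0 - m) * omega W (0 - m) (- k))"
      unfolding coeff \<alpha>_def by simp
    also have "\<dots> = r (- k)"
      unfolding r_def by (rule summable_on_int_shift(4))
    finally show ?thesis by (simp add: mult.commute)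
  qed
  have "complex_of_real (\<integral>z. (cmod (g (fst z)))\<^sup>2 * (cmod (h (snd z)))\<^sup>2 \<partial>nu W) =
      (\<integral>z. complex_of_real ((cmod (g (fst z)))\<^sup>2 * (cmod (h (snd z)))\<^sup>2) \<partial>nu W)"
    by (rule integral_complex_of_real[symmetric])
  also have "\<dots> = (\<integral>z. fourier_series \<beta> (snd z) * fourier_series \<alpha> (fst z) \<partial>nu W)"
  proof (rule integral_cong_AE)
    have "(\<lambda>z. g (fst z)) \<in> borel_measurable (nu W)" "(\<lambda>z. h (snd z)) \<in> borel_measurable (nu W)"
      by (intro nu_measurable measurable_compose[OF measurable_fst g_measurable]
          measurable_compose[OF measurable_snd hm])+
    from this[THEN measurable_compose, OF borel_measurable_norm]
    have "(\<lambda>z. (cmod (g (fst z)))\<^sup>2 * (cmod (h (snd z)))\<^sup>2) \<in> borel_measurable (nu W)"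
      by (intro borel_measurable_times borel_measurable_power)
    then show "(\<lambda>z. complex_of_real ((cmod (g (fst z)))\<^sup>2 * (cmod (h (snd z)))\<^sup>2)) \<in>
        borel_measurable (nu W)"
      by measurable
    show "(\<lambda>z. fourier_series \<beta> (snd z) * fourier_series \<alpha> (fst z)) \<in> borel_measurable (nu W)"
      by (intro borel_measurable_times fsm \<alpha> \<beta> fstm sndm)
    show "AE z in nu W. complex_of_real ((cmod (g (fst z)))\<^sup>2 * (cmod (h (snd z)))\<^sup>2) =
        fourier_series \<beta> (snd z) * fourier_series \<alpha> (fst z)"
      using AE_nu_fst[OF geq] AE_nu_snd[OF heq]
      by eventually_elim (simp only: of_real_mult mult.commute)
  qed
  also have "\<dots> = (\<Sum>\<^sub>\<infinity>k. \<beta> k * (\<integral>z. character k (snd z) * fourier_series \<alpha> (fst z) \<partial>nu W))"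
    by (rule fourier_series_integral[OF nu_properties(1) fsm[OF \<alpha> fstm] norm_fourier_series_le[OF
        \<alpha>] sndm \<beta>])
  also have "\<dots> = (\<Sum>\<^sub>\<infinity>k. \<beta> k * r (- k))" unfolding inner ..
  finally have left: "complex_of_real (\<integral>z. (cmod (g (fst z)))\<^sup>2 * (cmod (h (snd z)))\<^sup>2 \<partial>nu W) =
      (\<Sum>\<^sub>\<infinity>k. \<beta> k * r (- k))" .
  have rm: "fourier_series r \<in> borel_measurable circle"
    by (intro borel_measurable_circle fourier_series_measurable r_summable)
  have bm: "bounded_measurable (fourier_series r)" by (rule bounded_measurable_fourier_series[OF
      r_summable])
  have int: "integrable circle (\<lambda>x. fourier_series r x * complex_of_real ((cmod (h x))\<^sup>2))"
    by (rule integrable_bounded_measurable_mult[OF bm]) (use hA in \<open>simp add: ACF_def\<close>)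
  have "(\<integral>x. fourier_series r x * complex_of_real ((cmod (h x))\<^sup>2) \<partial>circle) = (\<integral>x. fourier_series
      \<beta> x * fourier_series r x \<partial>circle)"
  proof (rule integral_cong_AE)
    show "(\<lambda>x. fourier_series r x * complex_of_real ((cmod (h x))\<^sup>2)) \<in> borel_measurable circle"
      by (rule borel_measurable_integrable[OF int])
    show "(\<lambda>x. fourier_series \<beta> x * fourier_series r x) \<in> borel_measurable circle"
      by (intro borel_measurable_times rm borel_measurable_circle fourier_series_measurable \<beta>)
    show "AE x in circle. fourier_series r x * complex_of_real ((cmod (h x))\<^sup>2) = fourier_series \<beta>
        x * fourier_series r x"
      using heq by eventually_elim (simp only: mult.commute)
  qed
  also have "\<dots> = (\<Sum>\<^sub>\<infinity>k. \<beta> k * (\<integral>x. character k x * fourier_series r x \<partial>circle))"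
    by (rule fourier_series_integral[OF circle.finite_measure_axioms rm norm_fourier_series_le[OF
        r_summable] borel_measurable_circle[OF measurable_ident, unfolded id_def] \<beta>])
  also have "\<dots> = (\<Sum>\<^sub>\<infinity>k. \<beta> k * r (- k))"
  proof -
    have "(\<integral>x. character k x * fourier_series r x \<partial>circle) = r (- k)" for k
      using fourier_coeff_fourier_series[OF r_summable, of "- k"]
      by (simp add: fourier_coeff_def cnj_character mult.commute)
    then show ?thesis by (simp only:)
  qed
  finally have right: "(\<integral>x. fourier_series r x * complex_of_real ((cmod (h x))\<^sup>2) \<partial>circle) =
      (\<Sum>\<^sub>\<infinity>k. \<beta> k * r (- k))" .
  have "energy h = (\<integral>x. Re (fourier_series r x * complex_of_real ((cmod (h x))\<^sup>2)) \<partial>circle)"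
    unfolding energy_def \<rho>_def times_complex.sel Re_complex_of_real Im_complex_of_real by simp
  also have "\<dots> = Re (\<integral>x. fourier_series r x * complex_of_real ((cmod (h x))\<^sup>2) \<partial>circle)"
    by (rule integral_Re[OF int])
  also have "\<dots> = (\<integral>z. (cmod (g (fst z)))\<^sup>2 * (cmod (h (snd z)))\<^sup>2 \<partial>nu W)"
    unfolding right left[symmetric] by (rule Re_complex_of_real)
  finally show ?thesis ..
qed

end

section \<open>The norm identity\<close>

theorem corollary6p4:
  fixes W :: operator and g1 g2 :: "real \<Rightarrow> complex"
  assumes "regular W"
    and "g2 \<in> Linfty"
    and "g1 \<in> ACF"
    and "(\<lambda>x. complex_of_real ((cmod (g2 x))\<^sup>2)) \<in> ACF"
  shows "(mu_norm (mult_op g1 \<circ> W \<circ> mult_op g2))\<^sup>2 =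
    (\<integral>z. (cmod (g1 (fst z)))\<^sup>2 * (cmod (g2 (snd z)))\<^sup>2 \<partial>nu W)"
proof -
  interpret weighted_operator W g1
    by unfold_locales (rule assms)+
  define \<beta> where "\<beta> = fourier_coeff (\<lambda>x. complex_of_real ((cmod (g2 x))\<^sup>2))"
  have \<beta>: "abs_summable \<beta>" "AE x in circle. complex_of_real ((cmod (g2 x))\<^sup>2) = fourier_series \<beta> x"
    using ACF_eq_fourier_series[OF assms(4)] by (auto simp: \<beta>_def)
  have "AE x in circle. (cmod (g2 x))\<^sup>2 = Re (fourier_series \<beta> x)"
    using \<beta>(2) by eventually_elim (metis Re_complex_of_real)
  moreover have "continuous_on {0..2*pi} (\<lambda>x. Re (fourier_series \<beta> x))"
    by (intro continuous_intros continuous_on_fourier_series \<beta>)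
  ultimately have "(mu_norm (A \<circ> mult_op g2))\<^sup>2 = energy g2"
    by (intro mu_norm_eq_energy assms)
  moreover have "(\<lambda>_. 1) \<in> L2" by (simp add: L2_def)
  from bounded_operator_L2[OF bounded_operator_mult[OF assms(2)] this] have "g2 \<in> L2"
    by (simp add: mult_op_def)
  ultimately show ?thesis
    using nu_integral_eq_energy[OF _ assms(4)] by (simp add: A_def)
qed

end
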